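(* Let $(Q,[\cdot_\lambda\cdot])$ be a finite Leibniz conformal algebra which is free as a $\mathbf{k}[\partial]$-module. Suppose that there is a Leibniz conformal algebra structure on the conformal dual $Q^{*c}$ which is obtained from a $\mathbf{k}[\partial]$-module homomorphism $\Delta:Q\to Q\otimes Q$, i.e. $\langle[f_\lambda g],a\rangle_\mu=\langle f\otimes g,\Delta(a)\rangle_{\lambda,\mu-\lambda}$ for all $f,g\in Q^{*c}$, $a\in Q$. Then the following conditions are equivalent: (a) $(Q,Q^{*c};(L^*,-L^*-R^* ),(\mathcal{L}^*,-\mathcal{L}^*-\mathcal{R}^* ))$ is a matched pair of Leibniz conformal algebras; (b) $(Q\oplus Q^{*c},Q,Q^{*c})$ is a conformal Manin triple of Leibniz conformal algebras (i.e. $Q\oplus Q^{*c}$ carries a Leibniz conformal algebra structure, containing $Q$ and $Q^{*c}$ with their given structures as subalgebras, making it one), where the invariant skew-symmetric conformal bilinear form on $Q\oplus Q^{*c}$ is $B_\lambda(a+f,b+g)=\langle f,b\rangle_\lambda-\langle g,a\rangle_{-\lambda}$ for all $a,b\in Q$, $f,g\in Q^{*c}$; (c) $(Q,[\cdot_\lambda\cdot],\Delta)$ is a Leibniz conformal bialgebra.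
   Context: $\mathbf{k}$ is a field of characteristic zero; tensors are over $\mathbf{k}$; $\tau(a\otimes b)=b\otimes a$, $\tau_{12}=\tau\otimes\mathrm{id}$; $\partial$ acts on $Q\otimes Q$ by $\partial^{\otimes^2}:=\partial\otimes\mathrm{id}+\mathrm{id}\otimes\partial$. A Leibniz conformal algebra is a $\mathbf{k}[\partial]$-module $Q$ with a $\mathbf{k}$-bilinear map $[\cdot_\lambda\cdot]:Q\times Q\to Q[\lambda]$ with $[\partial a_\lambda b]=-\lambda[a_\lambda b]$, $[a_\lambda\partial b]=(\lambda+\partial)[a_\lambda b]$, $[a_\lambda[b_\mu c]]=[[a_\lambda b]_{\lambda+\mu}c]+[b_\mu[a_\lambda c]]$. It is finite if it is finitely generated over $\mathbf{k}[\partial]$. Substitution conventions: if an expression $p_\nu$ is a polynomial $\sum\nu^nv_n$ in $\nu$ with module coefficients, then $p_{-\lambda-\partial}:=\sum(-\lambda-\partial)^nv_n$. Similarly, for an operator such as $R(a)_\nu\otimes\mathrm{id}$, one first computes the polynomial in $\nu$ with coefficients in $Q\otimes Q$ and then substitutes for $\nu$ the indicated expression in $\lambda,\partial\otimes\mathrm{id},\mathrm{id}\otimes\partial$, acting on the coefficients. For $\mathbf{k}[\partial]$-modules $U,V$, a conformal linear map is a $\mathbf{k}$-linear $a_\lambda:U\to V[\lambda]$ with $a_\lambda(\partial u)=(\lambda+\partial)a_\lambda u$; these form the $\mathbf{k}[\partial]$-module $\mathrm{Chom}(U,V)$, $(\partial a)_\lambda u=-\lambda a_\lambda u$; $\mathrm{Cend}(V)=\mathrm{Chom}(V,V)$;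 $U^{*c}=\mathrm{Chom}(U,\mathbf{k})$ with $\mathbf{k}$ the trivial module ($\partial=0$). For $f\in U^{*c}$, $u\in U$ put $\langle f,u\rangle_\lambda=f_\lambda u$, $\langle u,f\rangle_{-\lambda}:=-\langle f,u\rangle_\lambda$, and $\langle f\otimes g,a\otimes b\rangle_{\lambda,\mu}=\langle f,a\rangle_\lambda\langle g,b\rangle_\mu$. A representation of a Leibniz conformal algebra $Q$ is $(M,l,r)$ with $M$ a $\mathbf{k}[\partial]$-module and $l,r:Q\to\mathrm{Cend}(M)$ $\mathbf{k}[\partial]$-module homomorphisms such that for $a,b\in Q$, $v\in M$: $l(a)_\lambda(l(b)_\mu v)=l([a_\lambda b])_{\lambda+\mu}v+l(b)_\mu(l(a)_\lambda v)$; $l(a)_\lambda(r(b)_{-\mu-\partial}v)=r(b)_{-\lambda-\mu-\partial}(l(a)_\lambda v)+r([a_\lambda b])_{-\mu-\partial}v$; $r(b)_{-\lambda-\mu-\partial}(r(a)_{-\mu-\partial}v)=-r(b)_{-\lambda-\mu-\partial}(l(a)_\lambda v)$. For a Leibniz conformal algebra $Q$: $L(a)_\lambda b=[a_\lambda b]$, $R(a)_\lambda b=[b_{-\lambda-\partial}a]$, and $L^*,R^*:Q\to\mathrm{Cend}(Q^{*c})$ are given by $\langle L^*(a)_\lambda f,b\rangle_\mu=-\langle f,L(a)_\lambda b\rangle_{\mu-\lambda}$, $\langle R^*(a)_\lambda f,b\rangle_\mu=-\langle f,R(a)_\lambda b\rangle_{\mu-\lambda}$. $\mathcal{L},\mathcal{R}$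 denote the analogous maps for the Leibniz conformal algebra $Q^{*c}$: $\mathcal{L}(f)_\lambda g=[f_\lambda g]$, $\mathcal{R}(f)_\lambda g=[g_{-\lambda-\partial}f]$, and $\mathcal{L}^*,\mathcal{R}^*:Q^{*c}\to\mathrm{Cend}(Q)$ are given by $\langle\mathcal{L}^*(f)_\lambda a,g\rangle_\mu=-\langle a,\mathcal{L}(f)_\lambda g\rangle_{\mu-\lambda}$, $\langle\mathcal{R}^*(f)_\lambda a,g\rangle_\mu=-\langle a,\mathcal{R}(f)_\lambda g\rangle_{\mu-\lambda}$ (identifying $(Q^{*c})^{*c}$ with $Q$). Matched pair: for Leibniz conformal algebras $Q_1,Q_2$, $(Q_1,Q_2;(l,r),(\phi,\psi))$ is a matched pair if $(Q_2,l,r)$ is a representation of $Q_1$, $(Q_1,\phi,\psi)$ is a representation of $Q_2$, and for all $a,b\in Q_1$, $x,y\in Q_2$: $[x_\lambda(r(a)_{-\mu-\partial}y)]+r(\phi(y)_\mu a)_{-\lambda-\partial}x=r(a)_{-\lambda-\mu-\partial}([x_\lambda y])+[y_\mu(r(a)_{-\lambda-\partial}x)]+r(\phi(x)_\lambda a)_{-\mu-\partial}y$; $l(a)_\lambda([x_\mu y])=[(l(a)_\lambda x)_{\lambda+\mu}y]+l(\psi(x)_{-\lambda-\partial}a)_{\lambda+\mu}y+[x_\mu(l(a)_\lambda y)]+r(\psi(y)_{-\lambda-\partial}a)_{-\mu-\partial}x$; $[x_\lambda(l(a)_\mu y)]+r(\psi(y)_{-\mu-\partial}a)_{-\lambda-\partial}x=l(\phi(x)_\lambda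 a)_{\lambda+\mu}y+l(a)_\mu([x_\lambda y])+[(r(a)_{-\lambda-\partial}x)_{\lambda+\mu}y]$; $[a_\lambda(\psi(x)_{-\mu-\partial}b)]+\psi(l(b)_\mu x)_{-\lambda-\partial}a=\psi(x)_{-\lambda-\mu-\partial}[a_\lambda b]+[b_\mu(\psi(x)_{-\lambda-\partial}a)]+\psi(l(a)_\lambda x)_{-\mu-\partial}b$; $[a_\lambda(\phi(x)_\mu b)]+\psi(r(b)_{-\mu-\partial}x)_{-\lambda-\partial}a=[(\psi(x)_{-\lambda-\partial}a)_{\lambda+\mu}b]+\phi(l(a)_\lambda x)_{\lambda+\mu}b+\phi(x)_\mu([a_\lambda b])$; $[(\phi(x)_\lambda a)_{\lambda+\mu}b]+\phi(r(a)_{-\lambda-\partial}x)_{\lambda+\mu}b+[(\psi(x)_{-\mu-\partial}a)_{\lambda+\mu}b]+\phi(l(a)_\mu x)_{\lambda+\mu}b=0$. A conformal bilinear form on a $\mathbf{k}[\partial]$-module $M$ is a $\mathbf{k}$-bilinear $B_\lambda:M\times M\to\mathbf{k}[\lambda]$ with $B_\lambda(\partial u,v)=-\lambda B_\lambda(u,v)$, $B_\lambda(u,\partial v)=\lambda B_\lambda(u,v)$; it is skew-symmetric if $B_\lambda(u,v)=-B_{-\lambda}(v,u)$, and non-degenerate if $v\mapsto(w\mapsto B_\lambda(v,w))$ is an isomorphism $M\to M^{*c}$ of $\mathbf{k}[\partial]$-modules. A conformal Manin triple is a triple $(E,Q_0,Q_1)$ of finite Leibniz conformal algebras such that: (1)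 $E$ has a non-degenerate skew-symmetric conformal bilinear form that is invariant, i.e. $B_\mu(a,[b_\lambda c])=B_{-\lambda}([a_\mu c]+[c_{-\mu-\partial}a],b)$ for all $a,b,c\in E$; (2) $Q_0,Q_1$ are subalgebras of $E$ and $E=Q_0\oplus Q_1$ as $\mathbf{k}[\partial]$-modules; (3) $B_\lambda(Q_i,Q_i)=0$ for $i=0,1$. A Leibniz conformal coalgebra is a $\mathbf{k}[\partial]$-module $Q$ with a $\mathbf{k}[\partial]$-module homomorphism $\Delta:Q\to Q\otimes Q$ such that $(\mathrm{id}\otimes\Delta)\Delta(a)=(\Delta\otimes\mathrm{id})\Delta(a)+\tau_{12}(\mathrm{id}\otimes\Delta)\Delta(a)$. A Leibniz conformal bialgebra $(Q,[\cdot_\lambda\cdot],\Delta)$ is a Leibniz conformal algebra which is also a Leibniz conformal coalgebra, such that for all $a,b\in Q$: $(R(a)_{\lambda-\partial\otimes\mathrm{id}}\otimes\mathrm{id})\Delta(b)=\tau\big((R(b)_{-\lambda-\partial\otimes\mathrm{id}}\otimes\mathrm{id})\Delta(a)\big)$; $\Delta([a_\lambda b])=(\mathrm{id}\otimes R(b)_{-\lambda-\partial^{\otimes^2}}-L(b)_{-\lambda-\partial^{\otimes^2}}\otimes\mathrm{id}-R(b)_{-\lambda-\partial^{\otimes^2}}\otimes\mathrm{id})(\tau+\mathrm{id})\Delta(a)+(\mathrm{id}\otimes L(a)_\lambda+L(a)_\lambda\otimes\mathrm{id})\Delta(b)$. *)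

theory Defs
  imports Complex_Main
    "HOL-Computational_Algebra.Polynomial"
    "HOL-Library.Function_Algebras"
    "HOL-Library.Product_Plus"
begin

section \<open>Modules over \<open>k[\<partial>]\<close>\<close>

text \<open>
  A \<open>k[\<partial>]\<close>-module is given by a scalar multiplication \<open>s :: 'k poly \<Rightarrow> 'v \<Rightarrow> 'v\<close> satisfying
  \<^locale>\<open>module\<close>, together with a submodule \<open>V :: 'v set\<close> as carrier.  Carriers are needed since
  the conformal dual and \<open>Q \<oplus> Q\<^sup>*\<^sup>c\<close> are proper submodules of the ambient function and
  product types.
\<close>

abbreviation base_scale :: "('k::comm_ring_1 poly \<Rightarrow> 'v \<Rightarrow> 'v) \<Rightarrow> 'k \<Rightarrow> 'v \<Rightarrow> 'v" where
  "base_scale s c v \<equiv> s [:c:] v"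

abbreviation pd :: "('k::comm_ring_1 poly \<Rightarrow> 'v \<Rightarrow> 'v) \<Rightarrow> 'v \<Rightarrow> 'v" where
  "pd s v \<equiv> s [:0, 1:] v"

definition kd_module :: "('k::field_char_0 poly \<Rightarrow> 'v::ab_group_add \<Rightarrow> 'v) \<Rightarrow> 'v set \<Rightarrow> bool" where
  "kd_module s V \<longleftrightarrow> module s \<and> module.subspace s V"

definition finitely_generated ::
    "('k::field_char_0 poly \<Rightarrow> 'v::ab_group_add \<Rightarrow> 'v) \<Rightarrow> 'v set \<Rightarrow> bool" where
  "finitely_generated s V \<longleftrightarrow> (\<exists>S. finite S \<and> module.span s S = V)"

definition free_module ::
    "('k::field_char_0 poly \<Rightarrow> 'v::ab_group_add \<Rightarrow> 'v) \<Rightarrow> 'v set \<Rightarrow> bool" where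
  "free_module s V \<longleftrightarrow> (\<exists>S. \<not> module.dependent s S \<and> module.span s S = V)"

definition kd_hom ::
    "('k::field_char_0 poly \<Rightarrow> 'u::ab_group_add \<Rightarrow> 'u) \<Rightarrow> 'u set \<Rightarrow>
     ('k poly \<Rightarrow> 'v::ab_group_add \<Rightarrow> 'v) \<Rightarrow> 'v set \<Rightarrow> ('u \<Rightarrow> 'v) \<Rightarrow> bool" where
  "kd_hom s U s' V f \<longleftrightarrow>
     (\<forall>x\<in>U. f x \<in> V) \<and>
     (\<forall>x\<in>U. \<forall>y\<in>U. f (x + y) = f x + f y) \<and>
     (\<forall>p. \<forall>x\<in>U. f (s p x) = s' p (f x))"

text \<open>The action of \<open>k[\<partial>]\<close> determined by a \<open>k\<close>-scaling and the operator by which \<open>\<partial>\<close> acts.\<close>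

definition kd_action ::
    "('k::zero \<Rightarrow> 'v \<Rightarrow> 'v) \<Rightarrow> ('v \<Rightarrow> 'v) \<Rightarrow> 'k poly \<Rightarrow> 'v \<Rightarrow> 'v::ab_group_add" where
  "kd_action k d p v = (\<Sum>n\<le>degree p. k (coeff p n) ((d ^^ n) v))"

definition triv_scale :: "'k::comm_ring_1 poly \<Rightarrow> 'k \<Rightarrow> 'k" where
  "triv_scale p c = poly p 0 * c"

definition prod_scale ::
    "('k poly \<Rightarrow> 'u \<Rightarrow> 'u) \<Rightarrow> ('k::comm_ring_1 poly \<Rightarrow> 'v \<Rightarrow> 'v) \<Rightarrow> 'k poly \<Rightarrow> 'u \<times> 'v \<Rightarrow> 'u \<times> 'v" where
  "prod_scale s s' p v = (s p (fst v), s' p (snd v))"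


section \<open>Polynomials with module coefficients and substitution\<close>

text \<open>
  \<open>V[\<lambda>]\<close> is \<open>'v poly\<close>, and \<open>V[\<lambda>,\<mu>]\<close> is \<open>'v poly poly\<close> with outer variable \<open>\<mu>\<close>.  Indeterminates and
  \<open>\<partial>\<close> are represented by the commuting operators by which they act, so that an expression such
  as \<open>- \<lambda> - \<mu> - \<partial>\<close> is literally the operator \<open>- lam - mu - del s\<close> (pointwise operations on functions).
  The index 1 marks the one-variable versions.
\<close>

definition poly_over :: "'v::zero set \<Rightarrow> 'v poly set" where
  "poly_over V = {p. \<forall>n. coeff p n \<in> V}"

definition lam1 :: "'v::ab_group_add poly \<Rightarrow> 'v poly" where
  "lam1 = pCons 0"

definition del1 :: "('k::comm_ring_1 poly \<Rightarrow> 'v::ab_group_add \<Rightarrow> 'v) \<Rightarrow> 'v poly \<Rightarrow> 'v poly" where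
  "del1 s = map_poly (pd s)"

definition lam :: "'v::ab_group_add poly poly \<Rightarrow> 'v poly poly" where
  "lam = map_poly (pCons 0)"

definition mu :: "'v::ab_group_add poly poly \<Rightarrow> 'v poly poly" where
  "mu = pCons 0"

definition del :: "('k::comm_ring_1 poly \<Rightarrow> 'v::ab_group_add \<Rightarrow> 'v) \<Rightarrow> 'v poly poly \<Rightarrow> 'v poly poly" where
  "del s = map_poly (map_poly (pd s))"

text \<open>\<open>p\<^sub>T = (\<Sum>n. T\<^sup>n v\<^sub>n)\<close> for \<open>p\<^sub>\<nu> = (\<Sum>n. \<nu>\<^sup>n v\<^sub>n)\<close>.\<close>

definition subst1 :: "('v poly \<Rightarrow> 'v poly) \<Rightarrow> 'v::ab_group_add poly \<Rightarrow> 'v poly" where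
  "subst1 T p = (\<Sum>n\<le>degree p. (T ^^ n) [:coeff p n:])"

definition subst :: "('v poly poly \<Rightarrow> 'v poly poly) \<Rightarrow> 'v::ab_group_add poly \<Rightarrow> 'v poly poly" where
  "subst T p = (\<Sum>n\<le>degree p. (T ^^ n) [:[:coeff p n:]:])"

text \<open>
  \<open>app f T P\<close> is \<open>f\<^sub>T(P)\<close>: for \<open>P = (\<Sum>i j. \<lambda>\<^sup>j \<mu>\<^sup>i u\<^sub>i\<^sub>j)\<close> over \<open>U\<close> and \<open>f\<^sub>\<nu> : U \<rightarrow> V[\<nu>]\<close>, it is
  \<open>(\<Sum>i j. \<lambda>\<^sup>j \<mu>\<^sup>i f\<^sub>T(u\<^sub>i\<^sub>j))\<close>.  Nested occurrences evaluate the inner expression first, including any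
  \<open>\<partial>\<close> in it.
\<close>

definition app ::
    "('u::ab_group_add \<Rightarrow> 'v::ab_group_add poly) \<Rightarrow> ('v poly poly \<Rightarrow> 'v poly poly) \<Rightarrow>
     'u poly poly \<Rightarrow> 'v poly poly" where
  "app f T P = (\<Sum>i\<le>degree P. \<Sum>j\<le>degree (coeff P i).
     (mu ^^ i) ((lam ^^ j) (subst T (f (coeff (coeff P i) j)))))"


section \<open>Leibniz conformal algebras\<close>

definition leibniz_conformal_algebra ::
    "('k::field_char_0 poly \<Rightarrow> 'v::ab_group_add \<Rightarrow> 'v) \<Rightarrow> 'v set \<Rightarrow> ('v \<Rightarrow> 'v \<Rightarrow> 'v poly) \<Rightarrow> bool" where
  "leibniz_conformal_algebra s V br \<longleftrightarrow>
     kd_module s V \<and>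
     (\<forall>a\<in>V. \<forall>b\<in>V. br a b \<in> poly_over V) \<and>
     (\<forall>a\<in>V. \<forall>b\<in>V. \<forall>c\<in>V. br (a + b) c = br a c + br b c \<and> br a (b + c) = br a b + br a c) \<and>
     (\<forall>x. \<forall>a\<in>V. \<forall>b\<in>V. br (base_scale s x a) b = map_poly (base_scale s x) (br a b) \<and>
                       br a (base_scale s x b) = map_poly (base_scale s x) (br a b)) \<and>
     (\<forall>a\<in>V. \<forall>b\<in>V. br (pd s a) b = - lam1 (br a b) \<and>
                   br a (pd s b) = (lam1 + del1 s) (br a b)) \<and>
     (\<forall>a\<in>V. \<forall>b\<in>V. \<forall>c\<in>V.
        app (br a) lam (subst mu (br b c)) =
        app (\<lambda>x. br x c) (lam + mu) (subst lam (br a b)) + app (br b) mu (subst lam (br a c)))"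

definition finite_leibniz_conformal_algebra ::
    "('k::field_char_0 poly \<Rightarrow> 'v::ab_group_add \<Rightarrow> 'v) \<Rightarrow> 'v set \<Rightarrow> ('v \<Rightarrow> 'v \<Rightarrow> 'v poly) \<Rightarrow> bool" where
  "finite_leibniz_conformal_algebra s V br \<longleftrightarrow>
     leibniz_conformal_algebra s V br \<and> finitely_generated s V"

definition Lop :: "('v \<Rightarrow> 'v \<Rightarrow> 'v poly) \<Rightarrow> 'v::ab_group_add \<Rightarrow> 'v \<Rightarrow> 'v poly" where
  "Lop br a b = br a b"

definition Rop ::
    "('k::comm_ring_1 poly \<Rightarrow> 'v \<Rightarrow> 'v) \<Rightarrow> ('v \<Rightarrow> 'v \<Rightarrow> 'v poly) \<Rightarrow> 'v::ab_group_add \<Rightarrow> 'v \<Rightarrow> 'v poly" where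
  "Rop s br a b = subst1 (- lam1 - del1 s) (br b a)"


section \<open>Conformal linear maps, conformal duals, representations\<close>

definition conformal_linear ::
    "('k::field_char_0 poly \<Rightarrow> 'u::ab_group_add \<Rightarrow> 'u) \<Rightarrow> 'u set \<Rightarrow>
     ('k poly \<Rightarrow> 'v::ab_group_add \<Rightarrow> 'v) \<Rightarrow> 'v set \<Rightarrow> ('u \<Rightarrow> 'v poly) \<Rightarrow> bool" where
  "conformal_linear s U s' V f \<longleftrightarrow>
     (\<forall>u\<in>U. f u \<in> poly_over V) \<and>
     (\<forall>u\<in>U. \<forall>v\<in>U. f (u + v) = f u + f v) \<and>
     (\<forall>x. \<forall>u\<in>U. f (base_scale s x u) = map_poly (base_scale s' x) (f u)) \<and>
     (\<forall>u\<in>U. f (pd s u) = (lam1 + del1 s') (f u))"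

text \<open>The \<open>k[\<partial>]\<close>-module structure of \<open>Chom(U,V)\<close>: \<open>\<partial>\<close> acts by \<open>- \<lambda>\<close>.\<close>

definition chom_scale ::
    "('k::comm_ring_1 poly \<Rightarrow> 'v \<Rightarrow> 'v) \<Rightarrow> 'k poly \<Rightarrow> ('u \<Rightarrow> 'v poly) \<Rightarrow> 'u \<Rightarrow> 'v::ab_group_add poly" where
  "chom_scale s' = kd_action (\<lambda>x f u. map_poly (base_scale s' x) (f u)) (\<lambda>f u. - lam1 (f u))"

abbreviation dual_scale :: "'k::field_char_0 poly \<Rightarrow> ('u \<Rightarrow> 'k poly) \<Rightarrow> 'u \<Rightarrow> 'k poly" where
  "dual_scale \<equiv> chom_scale triv_scale"

text \<open>Elements of the dual of \<open>U\<close> are normalised to vanish outside the carrier, so that equality of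
  functions is equality in \<open>U\<^sup>*\<^sup>c\<close>.\<close>

definition conformal_dual ::
    "('k::field_char_0 poly \<Rightarrow> 'u::ab_group_add \<Rightarrow> 'u) \<Rightarrow> 'u set \<Rightarrow> ('u \<Rightarrow> 'k poly) set" where
  "conformal_dual s U = {f. conformal_linear s U triv_scale UNIV f \<and> (\<forall>u. u \<notin> U \<longrightarrow> f u = 0)}"

definition cend_hom ::
    "('k::field_char_0 poly \<Rightarrow> 'v::ab_group_add \<Rightarrow> 'v) \<Rightarrow> 'v set \<Rightarrow>
     ('k poly \<Rightarrow> 'm::ab_group_add \<Rightarrow> 'm) \<Rightarrow> 'm set \<Rightarrow> ('v \<Rightarrow> 'm \<Rightarrow> 'm poly) \<Rightarrow> bool" where
  "cend_hom s V sM M l \<longleftrightarrow>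
     (\<forall>a\<in>V. conformal_linear sM M sM M (l a)) \<and>
     (\<forall>a\<in>V. \<forall>b\<in>V. \<forall>v\<in>M. l (a + b) v = l a v + l b v) \<and>
     (\<forall>p. \<forall>a\<in>V. \<forall>v\<in>M. l (s p a) v = chom_scale sM p (l a) v)"

definition representation ::
    "('k::field_char_0 poly \<Rightarrow> 'v::ab_group_add \<Rightarrow> 'v) \<Rightarrow> 'v set \<Rightarrow> ('v \<Rightarrow> 'v \<Rightarrow> 'v poly) \<Rightarrow>
     ('k poly \<Rightarrow> 'm::ab_group_add \<Rightarrow> 'm) \<Rightarrow> 'm set \<Rightarrow>
     ('v \<Rightarrow> 'm \<Rightarrow> 'm poly) \<Rightarrow> ('v \<Rightarrow> 'm \<Rightarrow> 'm poly) \<Rightarrow> bool" where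
  "representation s V br sM M l r \<longleftrightarrow>
     leibniz_conformal_algebra s V br \<and> kd_module sM M \<and>
     cend_hom s V sM M l \<and> cend_hom s V sM M r \<and>
     (\<forall>a\<in>V. \<forall>b\<in>V. \<forall>v\<in>M.
        app (l a) lam (subst mu (l b v)) =
          app (\<lambda>x. l x v) (lam + mu) (subst lam (br a b)) + app (l b) mu (subst lam (l a v)) \<and>
        app (l a) lam (subst (- mu - del sM) (r b v)) =
          app (r b) (- lam - mu - del sM) (subst lam (l a v)) +
          app (\<lambda>x. r x v) (- mu - del sM) (subst lam (br a b)) \<and>
        app (r b) (- lam - mu - del sM) (subst (- mu - del sM) (r a v)) =
          - app (r b) (- lam - mu - del sM) (subst lam (l a v)))"


section \<open>Matched pairs\<close>

definition matched_pair ::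
    "('k::field_char_0 poly \<Rightarrow> 'a::ab_group_add \<Rightarrow> 'a) \<Rightarrow> 'a set \<Rightarrow> ('a \<Rightarrow> 'a \<Rightarrow> 'a poly) \<Rightarrow>
     ('k poly \<Rightarrow> 'b::ab_group_add \<Rightarrow> 'b) \<Rightarrow> 'b set \<Rightarrow> ('b \<Rightarrow> 'b \<Rightarrow> 'b poly) \<Rightarrow>
     ('a \<Rightarrow> 'b \<Rightarrow> 'b poly) \<Rightarrow> ('a \<Rightarrow> 'b \<Rightarrow> 'b poly) \<Rightarrow>
     ('b \<Rightarrow> 'a \<Rightarrow> 'a poly) \<Rightarrow> ('b \<Rightarrow> 'a \<Rightarrow> 'a poly) \<Rightarrow> bool" where
  "matched_pair s1 Q1 br1 s2 Q2 br2 l r \<phi> \<psi> \<longleftrightarrow>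
     leibniz_conformal_algebra s1 Q1 br1 \<and> leibniz_conformal_algebra s2 Q2 br2 \<and>
     representation s1 Q1 br1 s2 Q2 l r \<and> representation s2 Q2 br2 s1 Q1 \<phi> \<psi> \<and>
     (\<forall>a\<in>Q1. \<forall>x\<in>Q2. \<forall>y\<in>Q2.
        app (br2 x) lam (subst (- mu - del s2) (r a y)) +
        app (\<lambda>c. r c x) (- lam - del s2) (subst mu (\<phi> y a)) =
          app (r a) (- lam - mu - del s2) (subst lam (br2 x y)) +
          app (br2 y) mu (subst (- lam - del s2) (r a x)) +
          app (\<lambda>c. r c y) (- mu - del s2) (subst lam (\<phi> x a)) \<and>
        app (l a) lam (subst mu (br2 x y)) =
          app (\<lambda>z. br2 z y) (lam + mu) (subst lam (l a x)) +
          app (\<lambda>c. l c y) (lam + mu) (subst (- lam - del s1) (\<psi> x a)) +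
          app (br2 x) mu (subst lam (l a y)) +
          app (\<lambda>c. r c x) (- mu - del s2) (subst (- lam - del s1) (\<psi> y a)) \<and>
        app (br2 x) lam (subst mu (l a y)) +
        app (\<lambda>c. r c x) (- lam - del s2) (subst (- mu - del s1) (\<psi> y a)) =
          app (\<lambda>c. l c y) (lam + mu) (subst lam (\<phi> x a)) +
          app (l a) mu (subst lam (br2 x y)) +
          app (\<lambda>z. br2 z y) (lam + mu) (subst (- lam - del s2) (r a x))) \<and>
     (\<forall>a\<in>Q1. \<forall>b\<in>Q1. \<forall>x\<in>Q2.
        app (br1 a) lam (subst (- mu - del s1) (\<psi> x b)) +
        app (\<lambda>z. \<psi> z a) (- lam - del s1) (subst mu (l b x)) =
          app (\<psi> x) (- lam - mu - del s1) (subst lam (br1 a b)) +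
          app (br1 b) mu (subst (- lam - del s1) (\<psi> x a)) +
          app (\<lambda>z. \<psi> z b) (- mu - del s1) (subst lam (l a x)) \<and>
        app (br1 a) lam (subst mu (\<phi> x b)) +
        app (\<lambda>z. \<psi> z a) (- lam - del s1) (subst (- mu - del s2) (r b x)) =
          app (\<lambda>c. br1 c b) (lam + mu) (subst (- lam - del s1) (\<psi> x a)) +
          app (\<lambda>z. \<phi> z b) (lam + mu) (subst lam (l a x)) +
          app (\<phi> x) mu (subst lam (br1 a b)) \<and>
        app (\<lambda>c. br1 c b) (lam + mu) (subst lam (\<phi> x a)) +
        app (\<lambda>z. \<phi> z b) (lam + mu) (subst (- lam - del s2) (r a x)) +
        app (\<lambda>c. br1 c b) (lam + mu) (subst (- mu - del s1) (\<psi> x a)) +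
        app (\<lambda>z. \<phi> z b) (lam + mu) (subst mu (l a x)) = 0)"

text \<open>
  For a pairing \<open>\<langle>v,w\<rangle>\<^sub>\<nu>\<close> of \<open>V\<close> with \<open>W\<close> and \<open>A\<^sub>\<lambda> : W \<rightarrow> W[\<lambda>]\<close>, \<open>star pr V W A v\<close> is the element
  \<open>A\<^sup>*\<^sub>\<lambda> v\<close> of \<open>V[\<lambda>]\<close> determined by \<open>\<langle>A\<^sup>*\<^sub>\<lambda> v, w\<rangle>\<^sub>\<mu> = - \<langle>v, A\<^sub>\<lambda> w\<rangle>\<^sub>\<mu>\<^sub>-\<^sub>\<lambda>\<close> for all \<open>w \<in> W\<close>.
\<close>

definition star ::
    "('v::ab_group_add \<Rightarrow> 'w::ab_group_add \<Rightarrow> 'k::field_char_0 poly) \<Rightarrow> 'v set \<Rightarrow> 'w set \<Rightarrow>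
     ('w \<Rightarrow> 'w poly) \<Rightarrow> 'v \<Rightarrow> 'v poly" where
  "star pr V W A v = (THE p. p \<in> poly_over V \<and>
     (\<forall>w\<in>W. app (\<lambda>x. pr x w) mu (subst lam p) = - app (pr v) (mu - lam) (subst lam (A w))))"

definition pair_dual :: "('u \<Rightarrow> 'k::field_char_0 poly) \<Rightarrow> 'u \<Rightarrow> 'k poly" where
  "pair_dual f u = f u"

text \<open>\<open>\<langle>u,f\<rangle>\<^sub>\<lambda> = - \<langle>f,u\<rangle>\<^sub>-\<^sub>\<lambda>\<close>; this is the identification of \<open>U\<close> with its double dual.\<close>

definition pair_bidual :: "'u \<Rightarrow> ('u \<Rightarrow> 'k::field_char_0 poly) \<Rightarrow> 'k poly" where
  "pair_bidual u f = - pcompose (pair_dual f u) [:0, -1:]"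

text \<open>\<open>L\<^sup>*\<close>, \<open>R\<^sup>*\<close> for a Leibniz conformal algebra on \<open>Q = UNIV\<close>; the duals of \<open>\<L>\<close>, \<open>\<R>\<close> for
  one on \<open>Q\<^sup>*\<^sup>c\<close>.\<close>

definition Lstar ::
    "('k::field_char_0 poly \<Rightarrow> 'q::ab_group_add \<Rightarrow> 'q) \<Rightarrow> ('q \<Rightarrow> 'q \<Rightarrow> 'q poly) \<Rightarrow>
     'q \<Rightarrow> ('q \<Rightarrow> 'k poly) \<Rightarrow> ('q \<Rightarrow> 'k poly) poly" where
  "Lstar s br a = star pair_dual (conformal_dual s UNIV) UNIV (Lop br a)"

definition Rstar ::
    "('k::field_char_0 poly \<Rightarrow> 'q::ab_group_add \<Rightarrow> 'q) \<Rightarrow> ('q \<Rightarrow> 'q \<Rightarrow> 'q poly) \<Rightarrow>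
     'q \<Rightarrow> ('q \<Rightarrow> 'k poly) \<Rightarrow> ('q \<Rightarrow> 'k poly) poly" where
  "Rstar s br a = star pair_dual (conformal_dual s UNIV) UNIV (Rop s br a)"

definition dual_Lstar ::
    "('k::field_char_0 poly \<Rightarrow> 'q::ab_group_add \<Rightarrow> 'q) \<Rightarrow>
     (('q \<Rightarrow> 'k poly) \<Rightarrow> ('q \<Rightarrow> 'k poly) \<Rightarrow> ('q \<Rightarrow> 'k poly) poly) \<Rightarrow>
     ('q \<Rightarrow> 'k poly) \<Rightarrow> 'q \<Rightarrow> 'q poly" where
  "dual_Lstar s brd f = star pair_bidual UNIV (conformal_dual s UNIV) (Lop brd f)"

definition dual_Rstar ::
    "('k::field_char_0 poly \<Rightarrow> 'q::ab_group_add \<Rightarrow> 'q) \<Rightarrow>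
     (('q \<Rightarrow> 'k poly) \<Rightarrow> ('q \<Rightarrow> 'k poly) \<Rightarrow> ('q \<Rightarrow> 'k poly) poly) \<Rightarrow>
     ('q \<Rightarrow> 'k poly) \<Rightarrow> 'q \<Rightarrow> 'q poly" where
  "dual_Rstar s brd f = star pair_bidual UNIV (conformal_dual s UNIV) (Rop dual_scale brd f)"


section \<open>Conformal Manin triples\<close>

definition conformal_bilinear_form ::
    "('k::field_char_0 poly \<Rightarrow> 'v::ab_group_add \<Rightarrow> 'v) \<Rightarrow> 'v set \<Rightarrow> ('v \<Rightarrow> 'v \<Rightarrow> 'k poly) \<Rightarrow> bool" where
  "conformal_bilinear_form s M B \<longleftrightarrow>
     (\<forall>u\<in>M. \<forall>v\<in>M. \<forall>w\<in>M. B (u + v) w = B u w + B v w \<and> B u (v + w) = B u v + B u w) \<and>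
     (\<forall>x. \<forall>u\<in>M. \<forall>v\<in>M. B (base_scale s x u) v = smult x (B u v) \<and>
                       B u (base_scale s x v) = smult x (B u v)) \<and>
     (\<forall>u\<in>M. \<forall>v\<in>M. B (pd s u) v = - lam1 (B u v) \<and> B u (pd s v) = lam1 (B u v))"

definition skew_symmetric_form :: "'v set \<Rightarrow> ('v \<Rightarrow> 'v \<Rightarrow> 'k::field_char_0 poly) \<Rightarrow> bool" where
  "skew_symmetric_form M B \<longleftrightarrow> (\<forall>u\<in>M. \<forall>v\<in>M. B u v = - pcompose (B v u) [:0, -1:])"

definition nondegenerate_form ::
    "('k::field_char_0 poly \<Rightarrow> 'v::ab_group_add \<Rightarrow> 'v) \<Rightarrow> 'v set \<Rightarrow> ('v \<Rightarrow> 'v \<Rightarrow> 'k poly) \<Rightarrow> bool" where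
  "nondegenerate_form s M B \<longleftrightarrow>
     (let \<Phi> = (\<lambda>v w. if w \<in> M then B v w else 0) in
        kd_hom s M dual_scale (conformal_dual s M) \<Phi> \<and> bij_betw \<Phi> M (conformal_dual s M))"

definition invariant_form ::
    "('k::field_char_0 poly \<Rightarrow> 'v::ab_group_add \<Rightarrow> 'v) \<Rightarrow> 'v set \<Rightarrow> ('v \<Rightarrow> 'v \<Rightarrow> 'v poly) \<Rightarrow>
     ('v \<Rightarrow> 'v \<Rightarrow> 'k poly) \<Rightarrow> bool" where
  "invariant_form s M br B \<longleftrightarrow>
     (\<forall>a\<in>M. \<forall>b\<in>M. \<forall>c\<in>M.
        app (B a) mu (subst lam (br b c)) =
        app (\<lambda>x. B x b) (- lam) (subst mu (br a c) + subst (- mu - del s) (br c a)))"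

text \<open>\<open>(E, Q0, Q1)\<close> is a conformal Manin triple by virtue of the form \<open>B\<close>.\<close>

definition conformal_manin_triple ::
    "('k::field_char_0 poly \<Rightarrow> 'v::ab_group_add \<Rightarrow> 'v) \<Rightarrow> 'v set \<Rightarrow> ('v \<Rightarrow> 'v \<Rightarrow> 'v poly) \<Rightarrow>
     'v set \<Rightarrow> 'v set \<Rightarrow> ('v \<Rightarrow> 'v \<Rightarrow> 'k poly) \<Rightarrow> bool" where
  "conformal_manin_triple s E br Q0 Q1 B \<longleftrightarrow>
     finite_leibniz_conformal_algebra s E br \<and>
     finite_leibniz_conformal_algebra s Q0 br \<and>
     finite_leibniz_conformal_algebra s Q1 br \<and>
     conformal_bilinear_form s E B \<and> skew_symmetric_form E B \<and>
     nondegenerate_form s E B \<and> invariant_form s E br B \<and>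
     Q0 \<subseteq> E \<and> Q1 \<subseteq> E \<and> Q0 \<inter> Q1 = {0} \<and> E = {x + y | x y. x \<in> Q0 \<and> y \<in> Q1} \<and>
     (\<forall>x\<in>Q0. \<forall>y\<in>Q0. B x y = 0) \<and> (\<forall>x\<in>Q1. \<forall>y\<in>Q1. B x y = 0)"

definition standard_form ::
    "'q \<times> ('q \<Rightarrow> 'k poly) \<Rightarrow> 'q \<times> ('q \<Rightarrow> 'k poly) \<Rightarrow> 'k::field_char_0 poly" where
  "standard_form v w =
     pair_dual (snd v) (fst w) - pcompose (pair_dual (snd w) (fst v)) [:0, -1:]"


section \<open>Tensor products over the base field\<close>

text \<open>
  \<open>Q \<otimes> Q\<close> is modelled inside the linear dual of the space of bilinear forms on \<open>Q\<close>:
  \<open>x \<otimes> y\<close> is evaluation of a form at \<open>(x, y)\<close>, and \<open>Q \<otimes> Q\<close> is the set of finite sums of such elements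
  (the scalars of \<open>k\<close> are absorbed into a factor); similarly for \<open>Q \<otimes> Q \<otimes> Q\<close> and trilinear forms.
  Bilinearity and the universal property are proved at the end of this section.
\<close>

definition bilinear_form ::
    "('k::field_char_0 poly \<Rightarrow> 'q::ab_group_add \<Rightarrow> 'q) \<Rightarrow> ('q \<Rightarrow> 'q \<Rightarrow> 'k) \<Rightarrow> bool" where
  "bilinear_form s \<beta> \<longleftrightarrow>
     (\<forall>y. Vector_Spaces.linear (base_scale s) (*) (\<lambda>x. \<beta> x y)) \<and>
     (\<forall>x. Vector_Spaces.linear (base_scale s) (*) (\<lambda>y. \<beta> x y))"

definition trilinear_form ::
    "('k::field_char_0 poly \<Rightarrow> 'q::ab_group_add \<Rightarrow> 'q) \<Rightarrow> ('q \<Rightarrow> 'q \<Rightarrow> 'q \<Rightarrow> 'k) \<Rightarrow> bool" where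
  "trilinear_form s \<gamma> \<longleftrightarrow>
     (\<forall>y z. Vector_Spaces.linear (base_scale s) (*) (\<lambda>x. \<gamma> x y z)) \<and>
     (\<forall>x z. Vector_Spaces.linear (base_scale s) (*) (\<lambda>y. \<gamma> x y z)) \<and>
     (\<forall>x y. Vector_Spaces.linear (base_scale s) (*) (\<lambda>z. \<gamma> x y z))"

type_synonym ('k, 'q) tensor2 = "('q \<Rightarrow> 'q \<Rightarrow> 'k) \<Rightarrow> 'k"
type_synonym ('k, 'q) tensor3 = "('q \<Rightarrow> 'q \<Rightarrow> 'q \<Rightarrow> 'k) \<Rightarrow> 'k"

definition tens ::
    "('k::field_char_0 poly \<Rightarrow> 'q::ab_group_add \<Rightarrow> 'q) \<Rightarrow> 'q \<Rightarrow> 'q \<Rightarrow> ('k, 'q) tensor2" where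
  "tens s x y = (\<lambda>\<beta>. if bilinear_form s \<beta> then \<beta> x y else 0)"

definition tens3 ::
    "('k::field_char_0 poly \<Rightarrow> 'q::ab_group_add \<Rightarrow> 'q) \<Rightarrow> 'q \<Rightarrow> 'q \<Rightarrow> 'q \<Rightarrow> ('k, 'q) tensor3" where
  "tens3 s x y z = (\<lambda>\<gamma>. if trilinear_form s \<gamma> then \<gamma> x y z else 0)"

definition tensor_space ::
    "('k::field_char_0 poly \<Rightarrow> 'q::ab_group_add \<Rightarrow> 'q) \<Rightarrow> ('k, 'q) tensor2 set" where
  "tensor_space s = range (\<lambda>ps. \<Sum>(x, y)\<leftarrow>ps. tens s x y)"

text \<open>\<open>extend e B\<close> sends \<open>\<Sum>\<^sub>i e p\<^sub>i\<close> to \<open>\<Sum>\<^sub>i B p\<^sub>i\<close>; it is used with \<open>e\<close> the map producing pure tensors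
  and \<open>B\<close> multilinear, when it is the linear map induced by \<open>B\<close>.\<close>

definition extend :: "('i \<Rightarrow> 't::ab_group_add) \<Rightarrow> ('i \<Rightarrow> 'w::ab_group_add) \<Rightarrow> 't \<Rightarrow> 'w" where
  "extend e B t = (THE w. \<exists>ps. t = (\<Sum>p\<leftarrow>ps. e p) \<and> w = (\<Sum>p\<leftarrow>ps. B p))"

definition tensor_lift ::
    "('k::field_char_0 poly \<Rightarrow> 'q::ab_group_add \<Rightarrow> 'q) \<Rightarrow> ('q \<Rightarrow> 'q \<Rightarrow> 'w::ab_group_add) \<Rightarrow>
     ('k, 'q) tensor2 \<Rightarrow> 'w" where
  "tensor_lift s B = extend (\<lambda>(x, y). tens s x y) (\<lambda>(x, y). B x y)"

definition tensor_lift3 ::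
    "('k::field_char_0 poly \<Rightarrow> 'q::ab_group_add \<Rightarrow> 'q) \<Rightarrow> ('q \<Rightarrow> 'q \<Rightarrow> 'q \<Rightarrow> 'w::ab_group_add) \<Rightarrow>
     ('k, 'q) tensor3 \<Rightarrow> 'w" where
  "tensor_lift3 s B = extend (\<lambda>(x, y, z). tens3 s x y z) (\<lambda>(x, y, z). B x y z)"

text \<open>The operators \<open>\<partial> \<otimes> id\<close>, \<open>id \<otimes> \<partial>\<close>, \<open>\<tau>\<close> on \<open>Q \<otimes> Q\<close> and \<open>\<tau>\<^sub>1\<^sub>2\<close> on \<open>Q \<otimes> Q \<otimes> Q\<close>.\<close>

definition pdL :: "('k::field_char_0 poly \<Rightarrow> 'q::ab_group_add \<Rightarrow> 'q) \<Rightarrow> ('k, 'q) tensor2 \<Rightarrow> ('k, 'q) tensor2" where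
  "pdL s = tensor_lift s (\<lambda>x y. tens s (pd s x) y)"

definition pdR :: "('k::field_char_0 poly \<Rightarrow> 'q::ab_group_add \<Rightarrow> 'q) \<Rightarrow> ('k, 'q) tensor2 \<Rightarrow> ('k, 'q) tensor2" where
  "pdR s = tensor_lift s (\<lambda>x y. tens s x (pd s y))"

definition twist :: "('k::field_char_0 poly \<Rightarrow> 'q::ab_group_add \<Rightarrow> 'q) \<Rightarrow> ('k, 'q) tensor2 \<Rightarrow> ('k, 'q) tensor2" where
  "twist s = tensor_lift s (\<lambda>x y. tens s y x)"

definition twist12 :: "('k::field_char_0 poly \<Rightarrow> 'q::ab_group_add \<Rightarrow> 'q) \<Rightarrow> ('k, 'q) tensor3 \<Rightarrow> ('k, 'q) tensor3" where
  "twist12 s = tensor_lift3 s (\<lambda>x y z. tens3 s y x z)"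

definition tensor_scale ::
    "('k::field_char_0 poly \<Rightarrow> 'q::ab_group_add \<Rightarrow> 'q) \<Rightarrow> 'k poly \<Rightarrow> ('k, 'q) tensor2 \<Rightarrow> ('k, 'q) tensor2" where
  "tensor_scale s = kd_action (\<lambda>c t \<beta>. c * t \<beta>) (pdL s + pdR s)"

text \<open>\<open>(A\<^sub>\<nu> \<otimes> id) t\<close> and \<open>(id \<otimes> A\<^sub>\<nu>) t\<close> in \<open>(Q \<otimes> Q)[\<nu>]\<close>, for \<open>A\<^sub>\<nu> : Q \<rightarrow> Q[\<nu>]\<close>.\<close>

definition actL ::
    "('k::field_char_0 poly \<Rightarrow> 'q::ab_group_add \<Rightarrow> 'q) \<Rightarrow> ('q \<Rightarrow> 'q poly) \<Rightarrow>
     ('k, 'q) tensor2 \<Rightarrow> ('k, 'q) tensor2 poly" where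
  "actL s A = tensor_lift s (\<lambda>x y. map_poly (\<lambda>z. tens s z y) (A x))"

definition actR ::
    "('k::field_char_0 poly \<Rightarrow> 'q::ab_group_add \<Rightarrow> 'q) \<Rightarrow> ('q \<Rightarrow> 'q poly) \<Rightarrow>
     ('k, 'q) tensor2 \<Rightarrow> ('k, 'q) tensor2 poly" where
  "actR s A = tensor_lift s (\<lambda>x y. map_poly (\<lambda>z. tens s x z) (A y))"

text \<open>\<open>(\<Delta> \<otimes> id) t\<close> and \<open>(id \<otimes> \<Delta>) t\<close> in \<open>Q \<otimes> Q \<otimes> Q\<close>.\<close>

definition coL ::
    "('k::field_char_0 poly \<Rightarrow> 'q::ab_group_add \<Rightarrow> 'q) \<Rightarrow> ('q \<Rightarrow> ('k, 'q) tensor2) \<Rightarrow>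
     ('k, 'q) tensor2 \<Rightarrow> ('k, 'q) tensor3" where
  "coL s \<Delta> = tensor_lift s (\<lambda>x y. tensor_lift s (\<lambda>x1 x2. tens3 s x1 x2 y) (\<Delta> x))"

definition coR ::
    "('k::field_char_0 poly \<Rightarrow> 'q::ab_group_add \<Rightarrow> 'q) \<Rightarrow> ('q \<Rightarrow> ('k, 'q) tensor2) \<Rightarrow>
     ('k, 'q) tensor2 \<Rightarrow> ('k, 'q) tensor3" where
  "coR s \<Delta> = tensor_lift s (\<lambda>x y. tensor_lift s (\<lambda>y1 y2. tens3 s x y1 y2) (\<Delta> y))"

text \<open>\<open>\<langle>f \<otimes> g, t\<rangle>\<^sub>S\<^sub>,\<^sub>T\<close>\<close>

definition tensor_pairing ::
    "('k::field_char_0 poly \<Rightarrow> 'q::ab_group_add \<Rightarrow> 'q) \<Rightarrow> ('q \<Rightarrow> 'k poly) \<Rightarrow> ('q \<Rightarrow> 'k poly) \<Rightarrow>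
     ('k poly poly \<Rightarrow> 'k poly poly) \<Rightarrow> ('k poly poly \<Rightarrow> 'k poly poly) \<Rightarrow>
     ('k, 'q) tensor2 \<Rightarrow> 'k poly poly" where
  "tensor_pairing s f g S T =
     tensor_lift s (\<lambda>x y. subst S (pair_dual f x) * subst T (pair_dual g y))"

lemma extend_sum_list:
  assumes "\<And>ps qs. (\<Sum>p\<leftarrow>ps. e p) = (\<Sum>p\<leftarrow>qs. e p) \<Longrightarrow> (\<Sum>p\<leftarrow>ps. B p) = (\<Sum>p\<leftarrow>qs. B p)"
  shows "extend e B (\<Sum>p\<leftarrow>ps. e p) = (\<Sum>p\<leftarrow>ps. B p)"
  unfolding extend_def
proof (rule the_equality)
  fix w assume "\<exists>qs. (\<Sum>p\<leftarrow>ps. e p) = (\<Sum>p\<leftarrow>qs. e p) \<and> w = (\<Sum>p\<leftarrow>qs. B p)"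
  then show "w = (\<Sum>p\<leftarrow>ps. B p)" using assms by metis
qed blast

lemma linear_functional_separates:
  fixes k :: "'k::field \<Rightarrow> 'w::ab_group_add \<Rightarrow> 'w"
  assumes "vector_space k" and "\<And>h. Vector_Spaces.linear k (*) h \<Longrightarrow> h v = h w"
  shows "v = w"
proof (rule ccontr)
  assume "v \<noteq> w"
  interpret vector_space k by fact
  interpret vector_space_pair k "(*) :: 'k \<Rightarrow> 'k \<Rightarrow> 'k"
    by unfold_locales (simp_all add: algebra_simps)
  have "independent {v - w}" using \<open>v \<noteq> w\<close> by simp
  then obtain g where g: "Vector_Spaces.linear k (*) g" "g (v - w) = 1"
    using linear_independent_extend[of "{v - w}" "\<lambda>_. 1"] by auto
  have "g (v - w) = g v - g w" using g(1) by (rule linear_diff)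
  with assms(2)[OF g(1)] g(2) show False by simp
qed

lemma linear_sum_list:
  assumes "Vector_Spaces.linear k k' h"
  shows "h (\<Sum>p\<leftarrow>ps. B p) = (\<Sum>p\<leftarrow>ps. h (B p))"
proof -
  interpret Vector_Spaces.linear k k' h by fact
  show ?thesis by (induction ps) (simp_all add: zero add)
qed

lemma sum_list_fun_apply: "(\<Sum>p\<leftarrow>ps. F p) x = (\<Sum>p\<leftarrow>ps. F p x)"
  for F :: "'i \<Rightarrow> 'a \<Rightarrow> 'b::ab_group_add"
  by (induction ps) simp_all

theorem tensor_lift_sum_list:
  fixes k :: "'k::field_char_0 \<Rightarrow> 'w::ab_group_add \<Rightarrow> 'w"
  assumes "\<And>y. Vector_Spaces.linear (base_scale s) k (\<lambda>x. B x y)"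
    and "\<And>x. Vector_Spaces.linear (base_scale s) k (B x)"
  shows "tensor_lift s B (\<Sum>(x, y)\<leftarrow>ps. tens s x y) = (\<Sum>(x, y)\<leftarrow>ps. B x y)"
  unfolding tensor_lift_def
proof (rule extend_sum_list)
  fix ps qs
  assume eq: "(\<Sum>(x, y)\<leftarrow>ps. tens s x y) = (\<Sum>(x, y)\<leftarrow>qs. tens s x y)"
  show "(\<Sum>(x, y)\<leftarrow>ps. B x y) = (\<Sum>(x, y)\<leftarrow>qs. B x y)"
  proof (rule linear_functional_separates)
    show "vector_space k" using assms(2)[of undefined] by (simp add: Vector_Spaces.linear_def)
    fix h assume h: "Vector_Spaces.linear k (*) h"
    have "bilinear_form s (\<lambda>x y. h (B x y))"
      unfolding bilinear_form_def
      using Vector_Spaces.linear_compose[OF assms(1) h] Vector_Spaces.linear_compose[OF assms(2) h]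
      by (simp add: o_def)
    then have "h (\<Sum>(x, y)\<leftarrow>rs. B x y) = (\<Sum>(x, y)\<leftarrow>rs. tens s x y) (\<lambda>x y. h (B x y))" for rs
      by (simp add: linear_sum_list[OF h] sum_list_fun_apply tens_def case_prod_beta)
    then show "h (\<Sum>(x, y)\<leftarrow>ps. B x y) = h (\<Sum>(x, y)\<leftarrow>qs. B x y)" using eq by simp
  qed
qed

theorem tensor_lift3_sum_list:
  fixes k :: "'k::field_char_0 \<Rightarrow> 'w::ab_group_add \<Rightarrow> 'w"
  assumes "\<And>y z. Vector_Spaces.linear (base_scale s) k (\<lambda>x. B x y z)"
    and "\<And>x z. Vector_Spaces.linear (base_scale s) k (\<lambda>y. B x y z)"
    and "\<And>x y. Vector_Spaces.linear (base_scale s) k (B x y)"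
  shows "tensor_lift3 s B (\<Sum>(x, y, z)\<leftarrow>ps. tens3 s x y z) = (\<Sum>(x, y, z)\<leftarrow>ps. B x y z)"
  unfolding tensor_lift3_def
proof (rule extend_sum_list)
  fix ps qs
  assume eq: "(\<Sum>(x, y, z)\<leftarrow>ps. tens3 s x y z) = (\<Sum>(x, y, z)\<leftarrow>qs. tens3 s x y z)"
  show "(\<Sum>(x, y, z)\<leftarrow>ps. B x y z) = (\<Sum>(x, y, z)\<leftarrow>qs. B x y z)"
  proof (rule linear_functional_separates)
    show "vector_space k" using assms(3)[of undefined] by (simp add: Vector_Spaces.linear_def)
    fix h assume h: "Vector_Spaces.linear k (*) h"
    have "trilinear_form s (\<lambda>x y z. h (B x y z))"
      unfolding trilinear_form_def
      using Vector_Spaces.linear_compose[OF assms(1) h] Vector_Spaces.linear_compose[OF assms(2) h]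
        Vector_Spaces.linear_compose[OF assms(3) h]
      by (simp add: o_def)
    then have "h (\<Sum>(x, y, z)\<leftarrow>rs. B x y z) =
        (\<Sum>(x, y, z)\<leftarrow>rs. tens3 s x y z) (\<lambda>x y z. h (B x y z))" for rs
      by (simp add: linear_sum_list[OF h] sum_list_fun_apply tens3_def case_prod_beta)
    then show "h (\<Sum>(x, y, z)\<leftarrow>ps. B x y z) = h (\<Sum>(x, y, z)\<leftarrow>qs. B x y z)" using eq by simp
  qed
qed

lemma tens_bilinear:
  assumes "module s"
  shows "tens s (x + x') y = tens s x y + tens s x' y" "tens s x (y + y') = tens s x y + tens s x y'"
    "tens s (base_scale s c x) y = (\<lambda>\<beta>. c * tens s x y \<beta>)"
    "tens s x (base_scale s c y) = (\<lambda>\<beta>. c * tens s x y \<beta>)"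
  by (auto simp: fun_eq_iff tens_def bilinear_form_def Vector_Spaces.linear_iff)

section \<open>Coalgebras and bialgebras\<close>

definition leibniz_conformal_coalgebra ::
    "('k::field_char_0 poly \<Rightarrow> 'q::ab_group_add \<Rightarrow> 'q) \<Rightarrow> ('q \<Rightarrow> ('k, 'q) tensor2) \<Rightarrow> bool" where
  "leibniz_conformal_coalgebra s \<Delta> \<longleftrightarrow>
     kd_module s UNIV \<and> kd_hom s UNIV (tensor_scale s) (tensor_space s) \<Delta> \<and>
     (\<forall>a. coR s \<Delta> (\<Delta> a) = coL s \<Delta> (\<Delta> a) + twist12 s (coR s \<Delta> (\<Delta> a)))"

definition leibniz_conformal_bialgebra ::
    "('k::field_char_0 poly \<Rightarrow> 'q::ab_group_add \<Rightarrow> 'q) \<Rightarrow> ('q \<Rightarrow> 'q \<Rightarrow> 'q poly) \<Rightarrow>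
     ('q \<Rightarrow> ('k, 'q) tensor2) \<Rightarrow> bool" where
  "leibniz_conformal_bialgebra s br \<Delta> \<longleftrightarrow>
     leibniz_conformal_algebra s UNIV br \<and> leibniz_conformal_coalgebra s \<Delta> \<and>
     (\<forall>a b.
        subst1 (lam1 - map_poly (pdL s)) (actL s (Rop s br a) (\<Delta> b)) =
        map_poly (twist s) (subst1 (- lam1 - map_poly (pdL s)) (actL s (Rop s br b) (\<Delta> a)))) \<and>
     (\<forall>a b.
        let N = - lam1 - map_poly (pdL s + pdR s); t = twist s (\<Delta> a) + \<Delta> a in
        map_poly \<Delta> (br a b) =
          subst1 N (actR s (Rop s br b) t) - subst1 N (actL s (Lop br b) t) -
          subst1 N (actL s (Rop s br b) t) +
          (subst1 lam1 (actR s (Lop br a) (\<Delta> b)) + subst1 lam1 (actL s (Lop br a) (\<Delta> b))))"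

end

theory Submission
  imports Defs
begin

text \<open>
  All identities are evaluated at scalars.  Since \<open>k\<close> is infinite, an identity in \<open>V[\<lambda>,\<mu>]\<close> holds as soon as it
  holds for all values of \<open>\<lambda>\<close> and \<open>\<mu>\<close> in \<open>k\<close> (\<open>poly_poly_eq_iff\<close>), and then every substitution such as
  \<open>- \<lambda> - \<mu> - \<partial>\<close> is multiplication by an element of \<open>k[\<partial>]\<close> (\<open>peval2_app\<close>).  Functionals on which \<open>\<partial>\<close> acts
  as a scalar remove \<open>\<partial>\<close> as well.  What is left resembles the theory of ordinary Leibniz algebras, except
  that every element carries a momentum, the scalar by which \<open>- \<partial>\<close> acts, and that the momenta of the arguments of
  a form add up to zero.

  As \<open>Q\<close> is free of finite rank, it is paired perfectly with \<open>Q\<^sup>*\<^sup>c\<close> from both sides, so the adjoints in the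
  statement exist (\<open>star_property\<close>).  The data of a matched pair define a bracket on \<open>E = Q \<oplus> Q\<^sup>*\<^sup>c\<close>, and the
  conditions on a matched pair are the components of its Jacobi identity on mixed triples
  (\<open>matched_pair_iff_leibniz\<close>).  Thus (a) says that \<open>E\<close> is a Leibniz conformal algebra, and (b) and (c) are compared
  with this.

  For (b), the trilinear form \<open>B(w, [x, z])\<close> of an invariant bracket is symmetric in \<open>w\<close> and \<open>z\<close> and satisfies
  \<open>B(w, [x, z]) + B(x, [w, z]) + B(x, [z, w]) = 0\<close>.  With the isotropy of both summands this determines the
  form from the brackets of \<open>Q\<close> and \<open>Q\<^sup>*\<^sup>c\<close> (\<open>invariant_extension_unique\<close>), and the bracket of \<open>E\<close> is invariant
  (\<open>triple_bE\<close>, \<open>invariant_brE\<close>).  A Manin triple therefore has to carry this bracket.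

  For (c), let \<open>J(x, y | w, z)\<close> be the pairing with \<open>w\<close> of \<open>[x, [y, z]] - [[x, y], z] - [y, [x, z]]\<close>.  Invariance
  writes it through pairings of two brackets, whence
  \<open>J(x, y | w, z) = J(x, y | z, w)\<close>, \<open>J(x, y | w, z) + J(x, w | y, z) + J(x, z | y, w) = 0\<close> and
  \<open>J(x, y | w, z) + J(y, x | w, z) = B(x \<circ> y, w \<circ> z)\<close> with \<open>x \<circ> y = [x, y] + [y, x]\<close>.  Since \<open>Q\<close> and \<open>Q\<^sup>*\<^sup>c\<close> are Leibniz
  algebras, these relations reduce the Jacobi identity of \<open>E\<close> to \<open>J(a, f | g, b) = 0\<close> and \<open>B(a \<circ> f, g \<circ> b) = 0\<close> for
  \<open>a, b \<in> Q\<close> and \<open>f, g \<in> Q\<^sup>*\<^sup>c\<close> (\<open>leibniz_iff_four_point\<close>).  Tensors are determined by their values at products of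
  functionals \<open>f\<^sub>p \<otimes> g\<^sub>q\<close> (\<open>tensor_eq_0I\<close>), where \<open>f\<^sub>p(u)\<close> is the value of \<open>f(u)\<close> at \<open>p\<close>.  At these the compatibility
  of \<open>\<Delta>\<close> with the bracket becomes \<open>J(a, f | g, b) = 0\<close> (\<open>second_condition_iff\<close>), the other bialgebra condition becomes
  \<open>B(a \<circ> f, g \<circ> b) = 0\<close> (\<open>first_condition_iff\<close>), and the coalgebra identity is the Jacobi identity of
  \<open>Q\<^sup>*\<^sup>c\<close> (\<open>coalgebra\<close>).
\<close>

section \<open>Evaluation of polynomials with module coefficients\<close>

text \<open>
  A constant \<open>q\<close> substitutes a scalar for the variable; \<open>q = - l - \<partial>\<close> gives the value at \<open>\<lambda> =
  l\<close> of the polynomial into which \<open>- \<lambda> - \<partial>\<close> has been substituted.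
\<close>

definition peval :: "('k::field_char_0 poly \<Rightarrow> 'v::ab_group_add \<Rightarrow> 'v) \<Rightarrow> 'v poly \<Rightarrow> 'k poly \<Rightarrow> 'v" where
  "peval s p q = (\<Sum>n\<le>degree p. s (q ^ n) (coeff p n))"

definition peval2 :: "('k::field_char_0 poly \<Rightarrow> 'v::ab_group_add \<Rightarrow> 'v) \<Rightarrow> 'v poly poly \<Rightarrow> 'k \<Rightarrow> 'k \<Rightarrow> 'v" where
  "peval2 s P l m = peval s (map_poly (\<lambda>p. peval s p [:l:]) P) [:m:]"

lemma const_poly_power: "[:c:] ^ n = [:c ^ n:]" for c :: "'k::comm_semiring_1"
  by (induction n) (simp_all add: mult.commute)

lemma poly_over_0 [simp]: "0 \<in> V \<Longrightarrow> 0 \<in> poly_over V"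
  by (simp add: poly_over_def)

lemma poly_over_pCons: "pCons c p \<in> poly_over V \<longleftrightarrow> c \<in> V \<and> p \<in> poly_over V"
  unfolding poly_over_def by (auto simp: coeff_pCons split: nat.splits)

lemma poly_over_coeff: "p \<in> poly_over V \<Longrightarrow> coeff p n \<in> V"
  by (simp add: poly_over_def)

lemma poly_over_UNIV_eq [simp]: "poly_over UNIV = UNIV"
  by (simp add: poly_over_def)

lemma poly_over_map: "f 0 = 0 \<Longrightarrow> (\<And>v. v \<in> V \<Longrightarrow> f v \<in> W) \<Longrightarrow> p \<in> poly_over V \<Longrightarrow> map_poly f p \<in> poly_over W"
  by (simp add: poly_over_def coeff_map_poly)

locale kd_space = module s
  for s :: "'k::field_char_0 poly \<Rightarrow> 'v::ab_group_add \<Rightarrow> 'v"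
begin

lemma peval_bound: "degree p \<le> N \<Longrightarrow> peval s p q = (\<Sum>n\<le>N. s (q ^ n) (coeff p n))"
  unfolding peval_def by (rule sum.mono_neutral_left) (auto simp: coeff_eq_0)

lemma peval_0 [simp]: "peval s 0 q = 0"
  by (simp add: peval_def)

lemma peval_pCons [simp]: "peval s (pCons c p) q = c + s q (peval s p q)"
proof -
  have "peval s (pCons c p) q = (\<Sum>n\<le>Suc (degree p). s (q ^ n) (coeff (pCons c p) n))"
    by (rule peval_bound) (simp add: degree_pCons_le)
  also have "\<dots> = c + s q (peval s p q)"
    by (simp add: sum.atMost_Suc_shift peval_def scale_sum_right del: sum.atMost_Suc)
  finally show ?thesis .
qed

lemma peval_add [simp]: "peval s (p + p') q = peval s p q + peval s p' q"
proof -
  let ?N = "max (degree p) (degree p')"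
  have "degree (p + p') \<le> ?N" by (rule degree_add_le_max)
  then show ?thesis
    by (simp add: peval_bound[of _ ?N] scale_right_distrib sum.distrib)
qed

lemma peval_uminus [simp]: "peval s (- p) q = - peval s p q"
  by (simp add: peval_def sum_negf)

lemma peval_diff [simp]: "peval s (p - p') q = peval s p q - peval s p' q"
  using peval_add[of p "- p'" q] by simp

lemma peval_sum: "peval s (sum f A) q = (\<Sum>i\<in>A. peval s (f i) q)"
  by (induction A rule: infinite_finite_induct) simp_all

lemma peval_lam1 [simp]: "peval s (lam1 p) q = s q (peval s p q)"
  by (simp add: lam1_def)

lemma peval_map:
  assumes "kd_space s'" "subspace V" "p \<in> poly_over V"
    and "f 0 = 0" "\<And>u v. u \<in> V \<Longrightarrow> v \<in> V \<Longrightarrow> f (u + v) = f u + f v"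
    and "\<And>v. v \<in> V \<Longrightarrow> f (s q v) = s' q' (f v)"
  shows "peval s' (map_poly f p) q' = f (peval s p q) \<and> peval s p q \<in> V"
  using assms(3)
proof (induction p)
  case 0
  interpret S': kd_space s' by fact
  show ?case by (simp add: assms(4) subspace_0[OF assms(2)])
next
  case (pCons c p)
  interpret S': kd_space s' by fact
  have c: "c \<in> V" and p: "p \<in> poly_over V" using pCons.prems by (simp_all add: poly_over_pCons)
  from pCons.IH[OF p] have *: "peval s' (map_poly f p) q' = f (peval s p q)" "peval s p q \<in> V" by auto
  have "s q (peval s p q) \<in> V" using *(2) by (rule subspace_scale[OF assms(2)])
  then show ?case using *
    by (simp add: map_poly_pCons assms c subspace_add)
qed

lemma peval_in: "subspace V \<Longrightarrow> p \<in> poly_over V \<Longrightarrow> peval s p q \<in> V"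
  using peval_map[OF kd_space_axioms, of V p "\<lambda>x. x" q q] by simp

lemma peval_scale [simp]: "peval s (map_poly (s r) p) q = s r (peval s p q)"
  using peval_map[OF kd_space_axioms, of UNIV p "s r" q q]
  by (simp add: scale_right_distrib mult.commute)

lemma peval_del1 [simp]: "peval s (del1 s p) q = s [:0, 1:] (peval s p q)"
  by (simp add: del1_def)

lemma vector_space_base: "vector_space (base_scale s)"
proof
  fix a b :: 'k and x y
  have "[:1::'k:] = 1" by (simp add: one_pCons)
  then show "base_scale s 1 x = x" by (simp only: scale_one)
  have "[:a + b:] = [:a:] + [:b:]" by simp
  then show "base_scale s (a + b) x = base_scale s a x + base_scale s b x"
    by (simp only: scale_left_distrib)
qed (simp_all add: scale_right_distrib mult.commute)

lemma peval_linear: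
  assumes "Vector_Spaces.linear (base_scale s) (*) h"
  shows "h (peval s p [:l:]) = poly (map_poly h p) l"
proof -
  interpret Vector_Spaces.linear "base_scale s" "(*)" h by fact
  show ?thesis
    by (induction p) (simp_all add: map_poly_pCons add scale zero)
qed

text \<open>
  A \<open>k\<close>-linear functional turns a polynomial over \<open>V\<close> into one over the infinite field \<open>k\<close>,
  which is determined by its values, and the functionals separate the coefficients.
\<close>

lemma poly_eqI_peval:
  assumes "\<And>l. peval s p [:l:] = peval s p' [:l:]"
  shows "p = p'"
proof (rule poly_eqI, rule linear_functional_separates[OF vector_space_base])
  fix n h assume h: "Vector_Spaces.linear (base_scale s) (*) h"
  interpret Vector_Spaces.linear "base_scale s" "(*)" h by fact
  have "poly (map_poly h p) = poly (map_poly h p')"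
    using assms by (auto simp: fun_eq_iff simp flip: peval_linear[OF h])
  then have "map_poly h p = map_poly h p'" by (simp add: poly_eq_poly_eq_iff)
  then have "coeff (map_poly h p) n = coeff (map_poly h p') n" by simp
  then show "h (coeff p n) = h (coeff p' n)" by (simp add: coeff_map_poly zero)
qed

lemma peval_subst1:
  assumes "\<And>P. peval s (T P) [:l:] = s q (peval s P [:l:])"
  shows "peval s (subst1 T p) [:l:] = peval s p q"
proof -
  have "peval s ((T ^^ n) P) [:l:] = s (q ^ n) (peval s P [:l:])" for n P
    by (induction n) (simp_all add: assms)
  then have "peval s (subst1 T p) [:l:] = (\<Sum>n\<le>degree p. s (q ^ n) (peval s [:coeff p n:] [:l:]))"
    by (simp only: subst1_def peval_sum)
  then show ?thesis by (simp add: peval_def[of s p])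
qed

lemma peval_subst1_neg: "peval s (subst1 (- lam1 - del1 s) p) [:l:] = peval s p [:- l, - 1:]"
proof (rule peval_subst1)
  fix P
  have "[:- l, - 1:] = - [:l:] - [:0, 1:]" by simp
  then show "peval s ((- lam1 - del1 s) P) [:l:] = s [:- l, - 1:] (peval s P [:l:])"
    by (simp only: minus_apply uminus_apply peval_diff peval_uminus peval_lam1 peval_del1
        scale_left_diff_distrib scale_minus_left)
qed

lemma poly_over_subst1_neg:
  assumes "subspace V" "p \<in> poly_over V"
  shows "subst1 (- lam1 - del1 s) p \<in> poly_over V"
proof -
  have N: "(- lam1 - del1 s) P \<in> poly_over V" if "P \<in> poly_over V" for P
    using that assms(1) unfolding poly_over_def
    by (auto simp: lam1_def del1_def coeff_map_poly coeff_pCons split: nat.splits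
        intro!: subspace_diff subspace_neg subspace_scale subspace_0)
  have "((- lam1 - del1 s) ^^ n) P \<in> poly_over V" if "P \<in> poly_over V" for n P
    by (induction n) (simp_all only: funpow.simps comp_apply id_apply that N)
  moreover have "[:coeff p n:] \<in> poly_over V" for n
    using assms by (simp add: poly_over_pCons poly_over_coeff subspace_0)
  ultimately have *: "((- lam1 - del1 s) ^^ n) [:coeff p n:] \<in> poly_over V" for n by blast
  then show ?thesis
    unfolding subst1_def poly_over_def coeff_sum mem_Collect_eq
    by (intro allI subspace_sum[OF assms(1)]) auto
qed

subsection \<open>Two variables\<close>

lemma peval2_0 [simp]: "peval2 s 0 l m = 0"
  by (simp add: peval2_def)

lemma peval2_pCons [simp]: "peval2 s (pCons p P) l m = peval s p [:l:] + s [:m:] (peval2 s P l m)"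
  by (simp add: peval2_def map_poly_pCons)

lemma peval2_add [simp]: "peval2 s (P + P') l m = peval2 s P l m + peval2 s P' l m"
proof -
  have "map_poly (\<lambda>p. peval s p [:l:]) (P + P') =
      map_poly (\<lambda>p. peval s p [:l:]) P + map_poly (\<lambda>p. peval s p [:l:]) P'"
    by (rule poly_eqI) (simp add: coeff_map_poly)
  then show ?thesis by (simp add: peval2_def)
qed

lemma peval2_uminus [simp]: "peval2 s (- P) l m = - peval2 s P l m"
  using peval2_add[of P "- P" l m] by (simp add: eq_neg_iff_add_eq_0 add.commute)

lemma peval2_diff [simp]: "peval2 s (P - P') l m = peval2 s P l m - peval2 s P' l m"
  using peval2_add[of P "- P'" l m] by simp

lemma peval2_sum: "peval2 s (sum f A) l m = (\<Sum>i\<in>A. peval2 s (f i) l m)"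
  by (induction A rule: infinite_finite_induct) simp_all

lemma poly_poly_eqI:
  assumes "\<And>l m. peval2 s P l m = peval2 s P' l m"
  shows "P = P'"
proof (rule poly_eqI)
  fix n
  have "map_poly (\<lambda>p. peval s p [:l:]) P = map_poly (\<lambda>p. peval s p [:l:]) P'" for l
    by (rule poly_eqI_peval) (use assms in \<open>simp add: peval2_def\<close>)
  then have "coeff (map_poly (\<lambda>p. peval s p [:l:]) P) n = coeff (map_poly (\<lambda>p. peval s p [:l:]) P') n" for l
    by simp
  then show "coeff P n = coeff P' n"
    by (intro poly_eqI_peval) (simp add: coeff_map_poly)
qed

text \<open>Every identity in \<open>V[\<lambda>,\<mu>]\<close> is thereby replaced by its instances at scalars.\<close>

lemma poly_poly_eq_iff: "P = P' \<longleftrightarrow> (\<forall>l m. peval2 s P l m = peval2 s P' l m)"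
  using poly_poly_eqI by blast

text \<open>
  The operators \<open>\<lambda>\<close>, \<open>\<mu>\<close>, \<open>\<partial>\<close> and their combinations all descend to multiplication by some
  \<open>q \<in> k[\<partial>]\<close> when \<open>\<lambda> = l\<close> and \<open>\<mu> = m\<close>.
\<close>

definition acts :: "('v poly poly \<Rightarrow> 'v poly poly) \<Rightarrow> 'k \<Rightarrow> 'k \<Rightarrow> 'k poly \<Rightarrow> bool" where
  "acts T l m q \<longleftrightarrow> (\<forall>P. peval2 s (T P) l m = s q (peval2 s P l m))"

lemma acts_power: "acts T l m q \<Longrightarrow> acts (T ^^ n) l m (q ^ n)"
  unfolding acts_def by (induction n) simp_all

lemma acts_lam: "acts lam l m [:l:]"
  unfolding acts_def
proof
  fix P :: "'v poly poly"
  show "peval2 s (lam P) l m = s [:l:] (peval2 s P l m)"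
    by (induction P) (simp_all add: lam_def map_poly_pCons scale_right_distrib mult.commute)
qed

lemma acts_mu: "acts mu l m [:m:]"
  by (simp add: acts_def mu_def)

lemma acts_del: "acts (del s) l m [:0, 1:]"
  unfolding acts_def
proof
  fix P :: "'v poly poly"
  show "peval2 s (del s P) l m = s [:0, 1:] (peval2 s P l m)"
    by (induction P) (simp_all add: del_def map_poly_pCons scale_right_distrib mult.commute)
qed

lemma acts_plus: "acts T l m q \<Longrightarrow> acts T' l m q' \<Longrightarrow> acts (T + T') l m (q + q')"
  by (simp add: acts_def scale_left_distrib)

lemma acts_minus: "acts T l m q \<Longrightarrow> acts T' l m q' \<Longrightarrow> acts (T - T') l m (q - q')"
  by (simp add: acts_def scale_left_diff_distrib)

lemma acts_uminus: "acts T l m q \<Longrightarrow> acts (- T) l m (- q)"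
  by (simp add: acts_def)

lemma acts_lam_plus_mu: "acts (lam + mu) l m [:l + m:]"
  using acts_plus[OF acts_lam acts_mu] by simp

lemma acts_mu_minus_lam: "acts (mu - lam) l m [:m - l:]"
  using acts_minus[OF acts_mu acts_lam] by simp

lemma acts_neg_lam: "acts (- lam) l m [:- l:]"
  using acts_uminus[OF acts_lam] by simp

lemma acts_neg_lam_del: "acts (- lam - del s) l m [:- l, - 1:]"
  using acts_minus[OF acts_uminus[OF acts_lam] acts_del] by simp

lemma acts_neg_mu_del: "acts (- mu - del s) l m [:- m, - 1:]"
  using acts_minus[OF acts_uminus[OF acts_mu] acts_del] by simp

lemma acts_neg_lam_mu_del: "acts (- lam - mu - del s) l m [:- (l + m), - 1:]"
  using acts_minus[OF acts_minus[OF acts_uminus[OF acts_lam] acts_mu] acts_del] by simp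

lemmas acts_rules = acts_lam acts_mu acts_lam_plus_mu acts_mu_minus_lam acts_neg_lam
  acts_neg_lam_del acts_neg_mu_del acts_neg_lam_mu_del

lemma peval2_subst: "acts T l m q \<Longrightarrow> peval2 s (subst T p) l m = peval s p q"
  using acts_power[of T l m q] by (simp add: subst_def peval2_sum peval_def acts_def)

lemmas peval2_substs = acts_rules[THEN peval2_subst]

text \<open>
  The inner substitutions have to keep their coefficients in the carrier, because an outer
  map is linear only there.
\<close>

definition stable :: "'v set \<Rightarrow> ('v poly poly \<Rightarrow> 'v poly poly) \<Rightarrow> bool" where
  "stable V T \<longleftrightarrow> (\<forall>P \<in> poly_over (poly_over V). T P \<in> poly_over (poly_over V))"

lemma stable_lam: "subspace V \<Longrightarrow> stable V lam"
  by (auto simp: stable_def lam_def poly_over_pCons subspace_0 intro!: poly_over_map[of _ "poly_over V"])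

lemma stable_mu: "subspace V \<Longrightarrow> stable V mu"
  by (auto simp: stable_def mu_def poly_over_pCons subspace_0)

lemma stable_del: "subspace V \<Longrightarrow> stable V (del s)"
  by (auto simp: stable_def del_def subspace_0 subspace_scale
      intro!: poly_over_map[of _ "poly_over V"] poly_over_map[of _ V])

lemma stable_minus: "subspace V \<Longrightarrow> stable V T \<Longrightarrow> stable V T' \<Longrightarrow> stable V (T - T')"
  by (auto simp: stable_def poly_over_def subspace_diff)

lemma stable_uminus: "subspace V \<Longrightarrow> stable V T \<Longrightarrow> stable V (- T)"
  by (auto simp: stable_def poly_over_def subspace_neg)

lemma subst_over:
  assumes V: "subspace V" and T: "stable V T" and p: "p \<in> poly_over V"
  shows "subst T p \<in> poly_over (poly_over V)"
proof -
  have "(T ^^ n) P \<in> poly_over (poly_over V)" if "P \<in> poly_over (poly_over V)" for n P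
    using T by (induction n) (simp_all add: that stable_def)
  moreover have "[:[:coeff p n:]:] \<in> poly_over (poly_over V)" for n
    using V p by (simp add: poly_over_pCons poly_over_coeff subspace_0)
  ultimately have "(T ^^ n) [:[:coeff p n:]:] \<in> poly_over (poly_over V)" for n by blast
  then show ?thesis
    unfolding subst_def poly_over_def coeff_sum mem_Collect_eq
    by (intro allI subspace_sum[OF V]) auto
qed

lemma subst_overs:
  assumes "subspace V" "p \<in> poly_over V"
  shows "subst lam p \<in> poly_over (poly_over V)" "subst mu p \<in> poly_over (poly_over V)"
    "subst (- lam - del s) p \<in> poly_over (poly_over V)"
    "subst (- mu - del s) p \<in> poly_over (poly_over V)"
  using assms by (auto intro!: subst_over stable_lam stable_mu stable_del stable_minus stable_uminus)

lemma peval2_expand: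
  "peval2 s P l m = (\<Sum>i\<le>degree P. \<Sum>j\<le>degree (coeff P i). s [:m ^ i * l ^ j:] (coeff (coeff P i) j))"
proof -
  have "degree (map_poly (\<lambda>p. peval s p [:l:]) P) \<le> degree P"
    by (rule degree_le) (simp add: coeff_map_poly coeff_eq_0)
  then have "peval2 s P l m = (\<Sum>i\<le>degree P. s ([:m:] ^ i) (peval s (coeff P i) [:l:]))"
    by (simp add: peval2_def peval_bound coeff_map_poly)
  also have "\<dots> = (\<Sum>i\<le>degree P. \<Sum>j\<le>degree (coeff P i). s [:m ^ i * l ^ j:] (coeff (coeff P i) j))"
    by (simp add: peval_def scale_sum_right const_poly_power mult.commute)
  finally show ?thesis .
qed

end

definition linear_on ::
    "('k::field_char_0 poly \<Rightarrow> 'u::ab_group_add \<Rightarrow> 'u) \<Rightarrow> 'u set \<Rightarrow>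
     ('k poly \<Rightarrow> 'v::ab_group_add \<Rightarrow> 'v) \<Rightarrow> ('u \<Rightarrow> 'v poly) \<Rightarrow> bool" where
  "linear_on sU U sV f \<longleftrightarrow>
     (\<forall>u\<in>U. \<forall>v\<in>U. f (u + v) = f u + f v) \<and>
     (\<forall>c. \<forall>u\<in>U. f (base_scale sU c u) = map_poly (base_scale sV c) (f u))"

text \<open>
  Nested substitutions become compositions. The left-hand side sums over the coefficients of
  \<open>P\<close>, and linearity of \<open>f\<close> collects them into the single argument \<open>peval2 sU P l m\<close>.
\<close>

lemma peval2_app:
  assumes "kd_space sU" "kd_space sV" "module.subspace sU U"
    and f: "linear_on sU U sV f" and P: "P \<in> poly_over (poly_over U)"
    and T: "kd_space.acts sV T l m q"
  shows "peval2 sV (app f T P) l m = peval sV (f (peval2 sU P l m)) q"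
proof -
  interpret SU: kd_space sU by fact
  interpret SV: kd_space sV by fact
  let ?\<theta> = "\<lambda>u. peval sV (f u) q"
  have \<theta>_add: "?\<theta> (u + v) = ?\<theta> u + ?\<theta> v" if "u \<in> U" "v \<in> U" for u v
    using f that by (simp add: linear_on_def)
  have \<theta>_scale: "?\<theta> (sU [:c:] u) = sV [:c:] (?\<theta> u)" if "u \<in> U" for u c
    using f that by (simp add: linear_on_def)
  have U0: "0 \<in> U" by (rule SU.subspace_0) fact
  have \<theta>_0: "?\<theta> 0 = 0" using \<theta>_add[OF U0 U0] by simp
  have \<theta>_sum: "?\<theta> (sum g A) = (\<Sum>i\<in>A. ?\<theta> (g i))" if "\<And>i. i \<in> A \<Longrightarrow> g i \<in> U" for g and A :: "nat set"
    using that
  proof (induction A rule: infinite_finite_induct)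
    case (insert x F)
    have "sum g F \<in> U" using insert by (intro SU.subspace_sum[OF assms(3)]) auto
    then show ?case using insert by (simp add: \<theta>_add)
  qed (simp_all add: \<theta>_0)
  have u: "coeff (coeff P i) j \<in> U" for i j using P by (simp add: poly_over_coeff)
  have su: "sU c (coeff (coeff P i) j) \<in> U" for i j c
    by (intro SU.subspace_scale[OF assms(3)] u)
  have "peval2 sV (app f T P) l m =
      (\<Sum>i\<le>degree P. \<Sum>j\<le>degree (coeff P i). sV [:m ^ i * l ^ j:] (?\<theta> (coeff (coeff P i) j)))"
    unfolding app_def SV.peval2_sum
    using SV.acts_power[OF SV.acts_lam[of l m]] SV.acts_power[OF SV.acts_mu[of l m]]
    by (simp add: SV.acts_def SV.peval2_subst[OF T] const_poly_power mult.commute)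
  also have "\<dots> = ?\<theta> (peval2 sU P l m)"
    unfolding SU.peval2_expand
    by (subst \<theta>_sum, intro SU.subspace_sum[OF assms(3)] su)+ (auto simp: \<theta>_sum su \<theta>_scale u)
  finally show ?thesis .
qed

section \<open>Evaluated brackets and conformal linear maps\<close>

lemma sum_fun_apply: "(sum F A) x = (\<Sum>i\<in>A. F i x)" for F :: "'i \<Rightarrow> 'a \<Rightarrow> 'b::ab_group_add"
  by (induction A rule: infinite_finite_induct) simp_all

lemma poly_ext: "(\<And>x. poly p x = poly q x) \<Longrightarrow> p = q" for p q :: "'k::field_char_0 poly"
  by (simp add: fun_eq_iff flip: poly_eq_poly_eq_iff)

lemma kd_space_triv: "kd_space (triv_scale :: 'k::field_char_0 poly \<Rightarrow> 'k \<Rightarrow> 'k)"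
  by unfold_locales (simp_all add: triv_scale_def algebra_simps)

interpretation K: kd_space "triv_scale :: 'k::field_char_0 poly \<Rightarrow> 'k \<Rightarrow> 'k"
  by (rule kd_space_triv)

lemma peval_triv [simp]: "peval triv_scale p [:x:] = poly p x"
  by (induction p) (simp, simp only: K.peval_pCons, simp add: triv_scale_def)

lemma peval2_triv: "peval2 triv_scale P l m = poly (poly P [:m:]) l"
  by (induction P) (simp, simp only: K.peval2_pCons, simp add: triv_scale_def)

lemma map_poly_triv [simp]: "map_poly (base_scale triv_scale c) p = smult c p"
  by (rule poly_eqI) (simp add: coeff_map_poly triv_scale_def)

lemma del1_triv [simp]: "del1 triv_scale p = 0"
  by (rule poly_eqI) (simp add: coeff_map_poly triv_scale_def del1_def)

lemma pcompose_const: "pcompose p [:c:] = [:poly p c:]" for p :: "'k::field_char_0 poly"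
  by (rule poly_ext) (simp add: poly_pcompose)

text \<open>
  Compatibility with scalars and with \<open>\<partial>\<close> gives compatibility with all of \<open>k[\<partial>]\<close>, where \<open>\<partial>\<close> may act
  on the target by another polynomial \<open>r\<close>.
\<close>

lemma scale_from_generators:
  assumes "kd_space s" "module.subspace s V" "module s'"
    and "\<And>u v. u \<in> V \<Longrightarrow> v \<in> V \<Longrightarrow> h (u + v) = h u + h v"
    and "\<And>c v. v \<in> V \<Longrightarrow> h (base_scale s c v) = s' [:c:] (h v)"
    and "\<And>v. v \<in> V \<Longrightarrow> h (pd s v) = s' r (h v)"
    and "v \<in> V"
  shows "h (s p v) = s' (pcompose p r) (h v)"
proof (induction p)
  case 0
  interpret S: kd_space s by fact
  interpret S': module s' by fact
  have "h 0 = h 0 + h 0" using assms(4)[of 0 0] S.subspace_0[OF assms(2)] by simp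
  then show ?case by simp
next
  case (pCons c p)
  interpret S: kd_space s by fact
  interpret S': module s' by fact
  have "pCons c p = [:c:] + [:0, 1:] * p" by simp
  then have "s (pCons c p) v = base_scale s c v + pd s (s p v)"
    by (simp only: S.scale_left_distrib S.scale_scale)
  moreover have "base_scale s c v \<in> V" "s p v \<in> V" "pd s (s p v) \<in> V"
    using assms(7) by (simp_all add: S.subspace_scale[OF assms(2)] del: S.scale_scale)
  ultimately have "h (s (pCons c p) v) = s' [:c:] (h v) + s' r (h (s p v))"
    by (simp add: assms(4-7) del: S.scale_scale)
  then show ?case by (simp add: pCons.IH pcompose_pCons S'.scale_left_distrib)
qed

lemma kd_module_iff: "kd_module s V \<longleftrightarrow> kd_space s \<and> module.subspace s V"
  by (simp add: kd_module_def kd_space_def)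

subsection \<open>The conformal dual\<close>

lemma peval_chom_scale:
  assumes "kd_space sM"
  shows "peval sM (chom_scale sM p g v) q = sM (pcompose p (- q)) (peval sM (g v) q)"
proof -
  interpret M: kd_space sM by fact
  have *: "peval sM (((\<lambda>f u. - lam1 (f u)) ^^ n) g v) q = sM ((- q) ^ n) (peval sM (g v) q)" for n
    by (induction n) (simp_all flip: M.scale_minus_left)
  have "peval sM (chom_scale sM p g v) q =
      (\<Sum>n\<le>degree p. sM ([:coeff p n:] * (- q) ^ n) (peval sM (g v) q))"
    by (simp add: chom_scale_def kd_action_def sum_fun_apply M.peval_sum * del: mult_pCons_left)
  also have "\<dots> = sM (\<Sum>n\<le>degree p. [:coeff p n:] * (- q) ^ n) (peval sM (g v) q)"
    by (simp only: M.scale_sum_left)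
  also have "(\<Sum>n\<le>degree p. [:coeff p n:] * (- q) ^ n) = pcompose p (- q)"
    by (rule poly_ext) (simp add: poly_sum poly_altdef[of p] poly_pcompose)
  finally show ?thesis .
qed

lemma poly_dual_scale: "poly (dual_scale p f u) x = poly p (- x) * poly (f u) x"
  using peval_chom_scale[OF kd_space_triv, of p f u "[:x:]"]
  by (simp add: triv_scale_def pcompose_const)

lemma dual_scale_eq: "dual_scale p f u = pcompose p [:0, - 1:] * f u"
  by (rule poly_ext) (simp add: poly_dual_scale poly_pcompose)

lemma kd_space_dual: "kd_space (dual_scale :: 'k::field_char_0 poly \<Rightarrow> ('u \<Rightarrow> 'k poly) \<Rightarrow> _)"
  by unfold_locales
    (simp_all add: fun_eq_iff dual_scale_eq pcompose_add pcompose_mult pcompose_1 algebra_simps)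

text \<open>
  As \<open>\<partial>\<close> acts by zero on \<open>k\<close>, the rule \<open>f\<^sub>\<lambda>(\<partial> u) = \<lambda> f\<^sub>\<lambda>(u)\<close> identifies the conformal dual
  with the \<open>k[\<partial>]\<close>-linear maps from \<open>U\<close> to \<open>k[\<lambda>]\<close>, where \<open>\<partial>\<close> acts on the target as \<open>\<lambda>\<close>.
\<close>

lemma conformal_dual_iff:
  assumes "kd_space s" "module.subspace s U"
  shows "f \<in> conformal_dual s U \<longleftrightarrow>
    (\<forall>u\<in>U. \<forall>v\<in>U. f (u + v) = f u + f v) \<and> (\<forall>p. \<forall>u\<in>U. f (s p u) = p * f u) \<and> (\<forall>u. u \<notin> U \<longrightarrow> f u = 0)"
proof -
  interpret S: kd_space s by fact
  have mult: "module ((*) :: 'a poly \<Rightarrow> 'a poly \<Rightarrow> 'a poly)"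
    by unfold_locales (simp_all add: algebra_simps)
  have "f (s p u) = p * f u"
    if "\<forall>u\<in>U. \<forall>v\<in>U. f (u + v) = f u + f v" "\<forall>x. \<forall>u\<in>U. f (base_scale s x u) = smult x (f u)"
      "\<forall>u\<in>U. f (pd s u) = pCons 0 (f u)" "u \<in> U" for p u
    using scale_from_generators[OF assms mult, of f "[:0, 1:]" u p] that by simp
  moreover have "f (base_scale s x u) = smult x (f u)" "f (pd s u) = pCons 0 (f u)"
    if "\<forall>p. \<forall>u\<in>U. f (s p u) = p * f u" "u \<in> U" for x u using that by simp_all
  ultimately show ?thesis
    unfolding conformal_dual_def conformal_linear_def by (auto simp: lam1_def)
qed

text \<open>
  These are the functionals that factor through the fibre \<open>V / (\<partial> - \<nu>) V\<close>.  They turn an operator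
  such as \<open>- \<lambda> - \<partial>\<close> into the scalar \<open>- \<lambda> - \<nu>\<close>.
\<close>

definition fibre :: "('k::field_char_0 poly \<Rightarrow> 'v::ab_group_add \<Rightarrow> 'v) \<Rightarrow> 'v set \<Rightarrow> 'k \<Rightarrow> ('v \<Rightarrow> 'k) \<Rightarrow> bool" where
  "fibre s V \<nu> \<chi> \<longleftrightarrow>
     (\<forall>u\<in>V. \<forall>v\<in>V. \<chi> (u + v) = \<chi> u + \<chi> v) \<and> (\<forall>p. \<forall>u\<in>V. \<chi> (s p u) = poly p \<nu> * \<chi> u)"

lemma fibre_peval:
  assumes "kd_space s" "module.subspace s V" "fibre s V \<nu> \<chi>" "p \<in> poly_over V"
  shows "\<chi> (peval s p q) = \<chi> (peval s p [:poly q \<nu>:])"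
proof -
  interpret S: kd_space s by fact
  from assms(4) show ?thesis
  proof (induction p)
    case (pCons c p)
    then have "c \<in> V" "p \<in> poly_over V" by (simp_all add: poly_over_pCons)
    moreover from this have "peval s p q \<in> V" "peval s p [:poly q \<nu>:] \<in> V"
      by (simp_all add: S.peval_in[OF assms(2)])
    ultimately show ?case
      using assms(3) pCons.IH by (simp add: fibre_def S.subspace_scale[OF assms(2)])
  qed simp
qed

subsection \<open>Brackets\<close>

definition conformal_bracket ::
    "('k::field_char_0 poly \<Rightarrow> 'v::ab_group_add \<Rightarrow> 'v) \<Rightarrow> 'v set \<Rightarrow> ('v \<Rightarrow> 'v \<Rightarrow> 'v poly) \<Rightarrow> bool" where
  "conformal_bracket s V br \<longleftrightarrow>
     kd_module s V \<and>
     (\<forall>a\<in>V. \<forall>b\<in>V. br a b \<in> poly_over V) \<and>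
     (\<forall>a\<in>V. \<forall>b\<in>V. \<forall>c\<in>V. br (a + b) c = br a c + br b c \<and> br a (b + c) = br a b + br a c) \<and>
     (\<forall>x. \<forall>a\<in>V. \<forall>b\<in>V. br (base_scale s x a) b = map_poly (base_scale s x) (br a b) \<and>
                       br a (base_scale s x b) = map_poly (base_scale s x) (br a b)) \<and>
     (\<forall>a\<in>V. \<forall>b\<in>V. br (pd s a) b = - lam1 (br a b) \<and>
                   br a (pd s b) = (lam1 + del1 s) (br a b))"

definition bval ::
    "('k::field_char_0 poly \<Rightarrow> 'v::ab_group_add \<Rightarrow> 'v) \<Rightarrow> ('v \<Rightarrow> 'v \<Rightarrow> 'v poly) \<Rightarrow> 'k \<Rightarrow> 'v \<Rightarrow> 'v \<Rightarrow> 'v" where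
  "bval s br l a b = peval s (br a b) [:l:]"

lemma conformal_bracketI:
  assumes "kd_space s" "module.subspace s V" "\<And>a b. a \<in> V \<Longrightarrow> b \<in> V \<Longrightarrow> br a b \<in> poly_over V"
    and "\<And>l a b c. a \<in> V \<Longrightarrow> b \<in> V \<Longrightarrow> c \<in> V \<Longrightarrow> bval s br l (a + b) c = bval s br l a c + bval s br l b c"
    and "\<And>l a b c. a \<in> V \<Longrightarrow> b \<in> V \<Longrightarrow> c \<in> V \<Longrightarrow> bval s br l a (b + c) = bval s br l a b + bval s br l a c"
    and "\<And>l p a b. a \<in> V \<Longrightarrow> b \<in> V \<Longrightarrow> bval s br l (s p a) b = s [:poly p (- l):] (bval s br l a b)"
    and "\<And>l p a b. a \<in> V \<Longrightarrow> b \<in> V \<Longrightarrow> bval s br l a (s p b) = s (pcompose p [:l, 1:]) (bval s br l a b)"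
  shows "conformal_bracket s V br"
proof -
  interpret S: kd_space s by fact
  have pd: "s [:l:] v + pd s v = s [:l, 1:] v" for l v
    by (simp flip: S.scale_left_distrib)
  have neg: "- s [:l:] v = s [:- l:] v" for l v
    by (simp flip: S.scale_minus_left)
  show ?thesis
    unfolding conformal_bracket_def kd_module_iff
    using assms by (auto intro!: S.poly_eqI_peval simp: bval_def pcompose_pCons pd neg)
qed

locale conformal_bracket_space = kd_space s
  for s :: "'k::field_char_0 poly \<Rightarrow> 'v::ab_group_add \<Rightarrow> 'v" +
  fixes V br
  assumes cbr: "conformal_bracket s V br"
begin

lemma subV: "subspace V"
  using cbr by (simp add: conformal_bracket_def kd_module_def)

lemma br_over: "a \<in> V \<Longrightarrow> b \<in> V \<Longrightarrow> br a b \<in> poly_over V"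
  using cbr by (simp add: conformal_bracket_def)

lemma bval_in: "a \<in> V \<Longrightarrow> b \<in> V \<Longrightarrow> bval s br l a b \<in> V"
  unfolding bval_def by (rule peval_in[OF subV br_over])

lemma bval_addL: "a \<in> V \<Longrightarrow> b \<in> V \<Longrightarrow> c \<in> V \<Longrightarrow> bval s br l (a + b) c = bval s br l a c + bval s br l b c"
  and bval_addR: "a \<in> V \<Longrightarrow> b \<in> V \<Longrightarrow> c \<in> V \<Longrightarrow> bval s br l a (b + c) = bval s br l a b + bval s br l a c"
  using cbr by (simp_all add: conformal_bracket_def bval_def)

lemma bval_scaleL: "a \<in> V \<Longrightarrow> b \<in> V \<Longrightarrow> bval s br l (s p a) b = s [:poly p (- l):] (bval s br l a b)"
  using scale_from_generators[OF kd_space_axioms subV module_axioms, of "\<lambda>a. bval s br l a b" "[:- l:]" a p] cbr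
  by (simp add: conformal_bracket_def bval_def pcompose_const flip: scale_minus_left)

lemma bval_scaleR: "a \<in> V \<Longrightarrow> b \<in> V \<Longrightarrow> bval s br l a (s p b) = s (pcompose p [:l, 1:]) (bval s br l a b)"
proof -
  assume "a \<in> V" "b \<in> V"
  moreover have "s [:l:] v + pd s v = s [:l, 1:] v" for v
    by (simp flip: scale_left_distrib)
  ultimately show ?thesis
    using scale_from_generators[OF kd_space_axioms subV module_axioms, of "\<lambda>b. bval s br l a b" "[:l, 1:]" b p] cbr
    by (simp add: conformal_bracket_def bval_def)
qed

lemma bval_0L: "b \<in> V \<Longrightarrow> bval s br l 0 b = 0" and bval_0R: "a \<in> V \<Longrightarrow> bval s br l a 0 = 0"
  using bval_addL[of 0 0 b l] bval_addR[of a 0 0 l] subspace_0[OF subV] by auto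

text \<open>
  As a difference the Jacobi identity becomes additive in each argument and may be tested on
  summands and against functionals.
\<close>

definition jac :: "'k \<Rightarrow> 'k \<Rightarrow> 'v \<Rightarrow> 'v \<Rightarrow> 'v \<Rightarrow> 'v" where
  "jac l m a b c = bval s br l a (bval s br m b c) - bval s br (l + m) (bval s br l a b) c
     - bval s br m b (bval s br l a c)"

lemma jac_add:
  assumes "a \<in> V" "b \<in> V" "c \<in> V" "d \<in> V"
  shows "jac l m (a + d) b c = jac l m a b c + jac l m d b c"
    and "jac l m a (b + d) c = jac l m a b c + jac l m a d c"
    and "jac l m a b (c + d) = jac l m a b c + jac l m a b d"
  using assms by (simp_all add: jac_def bval_addL bval_addR bval_in subspace_add[OF subV])

lemma jac_in: "a \<in> V \<Longrightarrow> b \<in> V \<Longrightarrow> c \<in> V \<Longrightarrow> jac l m a b c \<in> V"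
  unfolding jac_def by (intro subspace_diff[OF subV] bval_in)

lemma linear_on_left: "c \<in> V \<Longrightarrow> linear_on s V s (\<lambda>x. br x c)"
  and linear_on_right: "c \<in> V \<Longrightarrow> linear_on s V s (br c)"
  using cbr by (simp_all add: linear_on_def conformal_bracket_def)

end

lemma leibniz_iff:
  "leibniz_conformal_algebra s V br \<longleftrightarrow> conformal_bracket s V br \<and>
     (\<forall>a\<in>V. \<forall>b\<in>V. \<forall>c\<in>V. \<forall>l m. conformal_bracket_space.jac s br l m a b c = 0)"
proof (cases "conformal_bracket s V br")
  case False
  then show ?thesis by (auto simp: leibniz_conformal_algebra_def conformal_bracket_def)
next
  case True
  then interpret S: kd_space s by (simp add: conformal_bracket_def kd_module_iff)
  interpret C: conformal_bracket_space s V br by unfold_locales fact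
  have "app (br a) lam (subst mu (br b c)) =
        app (\<lambda>x. br x c) (lam + mu) (subst lam (br a b)) + app (br b) mu (subst lam (br a c)) \<longleftrightarrow>
      (\<forall>l m. C.jac l m a b c = 0)"
    if "a \<in> V" "b \<in> V" "c \<in> V" for a b c
    using that
    by (simp add: S.poly_poly_eq_iff C.jac_def diff_diff_eq bval_def C.subV C.br_over S.subst_overs S.peval2_substs
        peval2_app[OF S.kd_space_axioms S.kd_space_axioms C.subV C.linear_on_right _ S.acts_lam]
        peval2_app[OF S.kd_space_axioms S.kd_space_axioms C.subV C.linear_on_right _ S.acts_mu]
        peval2_app[OF S.kd_space_axioms S.kd_space_axioms C.subV C.linear_on_left _ S.acts_lam_plus_mu])
  then show ?thesis
    using True by (auto simp: leibniz_conformal_algebra_def conformal_bracket_def)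
qed

subsection \<open>Conformal linear maps\<close>

lemma conformal_linear_iff:
  assumes "kd_space s" "module.subspace s U" "kd_space s'" "module.subspace s' V"
  shows "conformal_linear s U s' V f \<longleftrightarrow>
    (\<forall>u\<in>U. f u \<in> poly_over V) \<and>
    (\<forall>u\<in>U. \<forall>v\<in>U. \<forall>l. peval s' (f (u + v)) [:l:] = peval s' (f u) [:l:] + peval s' (f v) [:l:]) \<and>
    (\<forall>p. \<forall>u\<in>U. \<forall>l. peval s' (f (s p u)) [:l:] = s' (pcompose p [:l, 1:]) (peval s' (f u) [:l:]))"
    (is "_ \<longleftrightarrow> ?R")
proof -
  interpret S: kd_space s by fact
  interpret S': kd_space s' by fact
  have *: "s' [:l:] v + pd s' v = s' [:l, 1:] v" for l v
    by (simp flip: S'.scale_left_distrib)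
  show ?thesis
  proof
    assume L: "conformal_linear s U s' V f"
    have "peval s' (f (s p u)) [:l:] = s' (pcompose p [:l, 1:]) (peval s' (f u) [:l:])" if "u \<in> U" for p u l
      using scale_from_generators[OF assms(1,2) S'.module_axioms, of "\<lambda>u. peval s' (f u) [:l:]" "[:l, 1:]" u p]
        L that by (simp add: conformal_linear_def *)
    with L show ?R by (simp add: conformal_linear_def)
  next
    assume ?R
    then show "conformal_linear s U s' V f"
      unfolding conformal_linear_def
      by (auto intro!: S'.poly_eqI_peval simp: * pcompose_pCons)
  qed
qed

lemma chom_scale_eqI:
  assumes "kd_space sM" "\<And>l. peval sM P [:l:] = sM [:poly p (- l):] (peval sM (g v) [:l:])"
  shows "P = chom_scale sM p g v"
  by (rule kd_space.poly_eqI_peval[OF assms(1)]) (simp add: assms peval_chom_scale pcompose_const)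

lemma conformal_linear_peval:
  assumes "kd_space s" "module.subspace s U" "kd_space s'" "conformal_linear s U s' V f" "u \<in> U"
  shows "peval s' (f (s p u)) q = s' (pcompose p (q + [:0, 1:])) (peval s' (f u) q)"
proof -
  interpret S': kd_space s' by fact
  show ?thesis
    using scale_from_generators[OF assms(1,2) S'.module_axioms, of "\<lambda>u. peval s' (f u) q" "q + [:0, 1:]" u p]
      assms(4,5) by (simp add: conformal_linear_def S'.scale_left_distrib)
qed

section \<open>Perfect pairings and adjoint operators\<close>

lemma coeff_slice_mult:
  "map_poly (\<lambda>c. coeff c j) (map_poly (\<lambda>c. [:c:]) p * Y) = p * map_poly (\<lambda>c. coeff c j) Y"
  by (rule poly_eqI) (simp add: coeff_map_poly coeff_mult coeff_sum)

text \<open>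
  The slices are the coefficients of the powers of the inner variable, as polynomials in the
  outer one.
\<close>

lemma sum_slices:
  fixes Y :: "'k::field_char_0 poly poly"
  assumes "\<And>j. j \<ge> N \<Longrightarrow> map_poly (\<lambda>c. coeff c j) Y = 0"
  shows "(\<Sum>j<N. l ^ j * poly (map_poly (\<lambda>c. coeff c j) Y) m) = poly (poly Y [:m:]) l"
proof -
  have 0: "coeff (coeff Y i) j = 0" if "j \<ge> N" for i j
  proof -
    have "coeff (map_poly (\<lambda>c. coeff c j) Y) i = 0" using assms[OF that] by simp
    then show ?thesis by (simp add: coeff_map_poly)
  qed
  have inner: "(\<Sum>j<N. l ^ j * coeff (coeff Y i) j) = poly (coeff Y i) l" for i
  proof -
    have "(\<Sum>j<N. l ^ j * coeff (coeff Y i) j) = (\<Sum>j\<le>max N (degree (coeff Y i)). l ^ j * coeff (coeff Y i) j)"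
      by (rule sum.mono_neutral_left) (auto simp: 0)
    also have "\<dots> = (\<Sum>j\<le>degree (coeff Y i). l ^ j * coeff (coeff Y i) j)"
      by (rule sum.mono_neutral_right) (auto simp: coeff_eq_0)
    finally show ?thesis by (simp add: poly_altdef mult.commute)
  qed
  have "(\<Sum>j<N. l ^ j * poly (map_poly (\<lambda>c. coeff c j) Y) m) =
      (\<Sum>j<N. \<Sum>i\<le>degree Y. l ^ j * (coeff (coeff Y i) j * m ^ i))"
  proof (rule sum.cong[OF refl])
    fix j
    have "degree (map_poly (\<lambda>c. coeff c j) Y) \<le> degree Y"
      by (rule degree_le) (simp add: coeff_map_poly coeff_eq_0)
    then have "poly (map_poly (\<lambda>c. coeff c j) Y) m = (\<Sum>i\<le>degree Y. coeff (coeff Y i) j * m ^ i)"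
      unfolding poly_altdef
      by (intro sum.mono_neutral_cong_left) (auto simp: coeff_map_poly coeff_eq_0 intro: le_degree)
    then show "l ^ j * poly (map_poly (\<lambda>c. coeff c j) Y) m = (\<Sum>i\<le>degree Y. l ^ j * (coeff (coeff Y i) j * m ^ i))"
      by (simp add: sum_distrib_left)
  qed
  also have "\<dots> = (\<Sum>i\<le>degree Y. (\<Sum>j<N. l ^ j * coeff (coeff Y i) j) * m ^ i)"
    by (subst sum.swap) (simp add: sum_distrib_right mult.assoc)
  also have "\<dots> = poly (poly Y [:m:]) l"
    by (simp add: inner poly_altdef[of Y] poly_sum const_poly_power mult.commute)
  finally show ?thesis .
qed

text \<open>
  By \<open>pr_inj\<close> and \<open>pr_surj\<close> the pairing identifies \<open>V\<close> with the conformal dual of \<open>W\<close>. The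
  two instances below, \<open>(Q\<^sup>*\<^sup>c, Q)\<close> and \<open>(Q, Q\<^sup>*\<^sup>c)\<close>, give the adjoints on \<open>Q\<^sup>*\<^sup>c\<close> and on \<open>Q\<close>.
\<close>

locale perfect_pairing = V: kd_space sV + W: kd_space sW
  for sV :: "'k::field_char_0 poly \<Rightarrow> 'v::ab_group_add \<Rightarrow> 'v"
    and sW :: "'k poly \<Rightarrow> 'w::ab_group_add \<Rightarrow> 'w" +
  fixes V :: "'v set" and W :: "'w set" and pr :: "'v \<Rightarrow> 'w \<Rightarrow> 'k poly"
  assumes subV: "V.subspace V" and subW: "W.subspace W"
    and pr_addL: "v \<in> V \<Longrightarrow> v' \<in> V \<Longrightarrow> w \<in> W \<Longrightarrow> pr (v + v') w = pr v w + pr v' w"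
    and pr_addR: "v \<in> V \<Longrightarrow> w \<in> W \<Longrightarrow> w' \<in> W \<Longrightarrow> pr v (w + w') = pr v w + pr v w'"
    and pr_scaleL: "v \<in> V \<Longrightarrow> w \<in> W \<Longrightarrow> pr (sV p v) w = pcompose p [:0, - 1:] * pr v w"
    and pr_scaleR: "v \<in> V \<Longrightarrow> w \<in> W \<Longrightarrow> pr v (sW p w) = p * pr v w"
    and pr_inj: "v \<in> V \<Longrightarrow> (\<And>w. w \<in> W \<Longrightarrow> pr v w = 0) \<Longrightarrow> v = 0"
    and pr_surj: "(\<And>w w'. w \<in> W \<Longrightarrow> w' \<in> W \<Longrightarrow> \<theta> (w + w') = \<theta> w + \<theta> w') \<Longrightarrow>
      (\<And>p w. w \<in> W \<Longrightarrow> \<theta> (sW p w) = p * \<theta> w) \<Longrightarrow> \<exists>v\<in>V. \<forall>w\<in>W. pr v w = \<theta> w"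
    and W_fg: "finitely_generated sW W"
begin

lemma pr_diffL: "v \<in> V \<Longrightarrow> v' \<in> V \<Longrightarrow> w \<in> W \<Longrightarrow> pr (v - v') w = pr v w - pr v' w"
  using pr_addL[of "v - v'" v' w] V.subspace_diff[OF subV, of v v'] by simp

text \<open>
  The prescribed value \<open>- \<langle>v, A\<^sub>\<lambda> w\<rangle>\<^sub>\<mu>\<^sub>-\<^sub>\<lambda>\<close> is linear in \<open>w\<close> over \<open>k[\<partial>]\<close>, with \<open>\<partial>\<close> acting as
  \<open>\<mu>\<close>: applying \<open>A\<^sub>\<lambda>\<close> to \<open>\<partial> w\<close> produces \<open>\<lambda> + \<partial>\<close>, and \<open>\<partial>\<close> becomes \<open>\<mu> - \<lambda>\<close> in the pairing. So
  its coefficient at each power of \<open>\<lambda>\<close> is represented by an element of \<open>V\<close>. The powers that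
  occur are bounded on finitely many generators of \<open>W\<close>, hence on all of \<open>W\<close>, so that these
  elements are the coefficients of a polynomial.
\<close>

lemma adjoint_exists:
  assumes A: "conformal_linear sW W sW W A" and v: "v \<in> V"
  shows "\<exists>p\<in>poly_over V. \<forall>w\<in>W. \<forall>l m. poly (pr (peval sV p [:l:]) w) m = - poly (pr v (peval sW (A w) [:l:])) (m - l)"
proof -
  define H where "H w = app (pr v) (mu - lam) (subst lam (A w))" for w
  note A' = A[unfolded conformal_linear_iff[OF W.kd_space_axioms subW W.kd_space_axioms subW]]
  have Ain: "peval sW (A w) [:l:] \<in> W" if "w \<in> W" for w l
    using A' that by (simp add: W.peval_in[OF subW])
  have lin: "linear_on sW W triv_scale (pr v)"
    using v by (simp add: linear_on_def pr_addR pr_scaleR)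
  have H: "poly (poly (H w) [:m:]) l = poly (pr v (peval sW (A w) [:l:])) (m - l)" if "w \<in> W" for w l m
    using A' that peval2_app[OF W.kd_space_axioms kd_space_triv subW lin _ K.acts_mu_minus_lam, of "subst lam (A w)" l m]
    by (simp add: H_def peval2_triv W.subst_overs[OF subW] W.peval2_substs)
  have eqI: "X = Y" if "\<And>l m. poly (poly X [:m:]) l = poly (poly Y [:m:]) l" for X Y :: "'k poly poly"
    by (rule K.poly_poly_eqI) (simp add: peval2_triv that)
  have H_add: "H (w + w') = H w + H w'" if "w \<in> W" "w' \<in> W" for w w'
    by (rule eqI) (use A' v that Ain in \<open>simp add: H W.subspace_add[OF subW] pr_addR\<close>)
  have H_scale: "H (sW p w) = map_poly (\<lambda>c. [:c:]) p * H w" if "w \<in> W" for p w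
  proof (rule eqI)
    fix l m
    have "poly (poly (map_poly (\<lambda>c. [:c:]) p) [:m:]) l = poly p m"
      by (simp flip: pcompose_altdef add: poly_pcompose)
    then show "poly (poly (H (sW p w)) [:m:]) l = poly (poly (map_poly (\<lambda>c. [:c:]) p * H w) [:m:]) l"
      using A' v that Ain by (simp add: H W.subspace_scale[OF subW] pr_scaleR poly_pcompose)
  qed
  \<comment> \<open>The coefficient at \<open>\<lambda>\<^sup>j\<close> of the prescribed value.\<close>
  define \<theta> where "\<theta> j w = - map_poly (\<lambda>c. coeff c j) (H w)" for j w
  have \<theta>_add: "\<theta> j (w + w') = \<theta> j w + \<theta> j w'" if "w \<in> W" "w' \<in> W" for j w w'
    by (rule poly_eqI) (simp add: \<theta>_def H_add that coeff_map_poly)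
  have \<theta>_scale: "\<theta> j (sW p w) = p * \<theta> j w" if "w \<in> W" for j p w
    by (simp add: \<theta>_def H_scale that coeff_slice_mult)
  have "\<exists>v'\<in>V. \<forall>w\<in>W. pr v' w = \<theta> j w" for j
    by (rule pr_surj) (simp_all add: \<theta>_add \<theta>_scale)
  then obtain vs where vs: "vs j \<in> V" "\<And>w. w \<in> W \<Longrightarrow> pr (vs j) w = \<theta> j w" for j by metis
  obtain S where S: "finite S" "W.span S = W" using W_fg by (auto simp: finitely_generated_def)
  have "\<exists>N. \<forall>j\<ge>N. \<theta> j w = 0" for w
  proof -
    have "\<theta> j w = 0" if "j > (\<Sum>i\<le>degree (H w). degree (coeff (H w) i))" for j
    proof -
      have "coeff (coeff (H w) i) j = 0" for i
      proof (cases "i \<le> degree (H w)")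
        case True
        then have "degree (coeff (H w) i) \<le> (\<Sum>i\<le>degree (H w). degree (coeff (H w) i))"
          by (intro member_le_sum) auto
        then show ?thesis using that by (intro coeff_eq_0) simp
      qed (simp add: coeff_eq_0)
      then show ?thesis by (auto simp: \<theta>_def intro!: poly_eqI simp: coeff_map_poly)
    qed
    then show ?thesis by (metis Suc_le_eq)
  qed
  then obtain N0 where N0: "\<And>w j. j \<ge> N0 w \<Longrightarrow> \<theta> j w = 0" by metis
  \<comment> \<open>A bound for the generators; the sum stands in for the maximum.\<close>
  define N where "N = (\<Sum>w\<in>S. N0 w)"
  have NS: "\<theta> j w = 0" if "w \<in> S" "j \<ge> N" for w j
    using that S(1) member_le_sum[of w S N0] by (intro N0) (simp add: N_def)
  have N: "\<theta> j w = 0" if "w \<in> W" "j \<ge> N" for w j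
  proof -
    have "W.subspace {w \<in> W. \<theta> j w = 0}"
      using subW \<theta>_add[of 0 0 j] by (auto intro!: W.subspaceI simp: W.subspace_0 W.subspace_add W.subspace_scale \<theta>_add \<theta>_scale)
    moreover have "S \<subseteq> {w \<in> W. \<theta> j w = 0}" using S(2) NS that(2) W.span_superset[of S] by auto
    ultimately have "W.span S \<subseteq> {w \<in> W. \<theta> j w = 0}" by (intro W.span_minimal)
    then show ?thesis using S(2) that(1) by auto
  qed
  define p where "p = (\<Sum>j<N. monom (vs j) j)"
  have p: "p \<in> poly_over V"
    using subV by (auto simp: p_def poly_over_def coeff_sum V.subspace_0 vs intro!: V.subspace_sum)
  have peval_monom: "peval sV (monom u j) q = sV (q ^ j) u" for u j q
    by (induction j) (simp_all add: monom_0 monom_Suc)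
  have sum_pr: "pr (\<Sum>j\<in>J. sV ([:l:] ^ j) (vs j)) w = (\<Sum>j\<in>J. smult (l ^ j) (\<theta> j w))" if "w \<in> W" "finite J" for w l J
    using that(2)
  proof induction
    case empty
    have "pr 0 w + pr 0 w = pr 0 w" using pr_addL[of 0 0 w] V.subspace_0[OF subV] that by simp
    then show ?case by simp
  next
    case (insert j F)
    have "(\<Sum>j\<in>F. sV ([:l:] ^ j) (vs j)) \<in> V" "sV ([:l:] ^ j) (vs j) \<in> V"
      using subV vs by (auto intro!: V.subspace_sum V.subspace_scale)
    then show ?case using insert that(1)
      by (simp add: pr_addL pr_scaleL vs const_poly_power pcompose_const)
  qed
  have "poly (pr (peval sV p [:l:]) w) m = - poly (pr v (peval sW (A w) [:l:])) (m - l)" if "w \<in> W" for w l m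
  proof -
    have "poly (pr (peval sV p [:l:]) w) m = (\<Sum>j<N. l ^ j * poly (\<theta> j w) m)"
      by (simp add: p_def V.peval_sum peval_monom sum_pr that poly_sum)
    also have "\<dots> = - (\<Sum>j<N. l ^ j * poly (map_poly (\<lambda>c. coeff c j) (H w)) m)"
      by (simp add: \<theta>_def sum_negf)
    also have "\<dots> = - poly (poly (H w) [:m:]) l"
      using N[OF that] by (subst sum_slices) (auto simp: \<theta>_def)
    finally show ?thesis by (simp add: H that)
  qed
  with p show ?thesis by blast
qed

lemma star_property:
  assumes A: "conformal_linear sW W sW W A" and v: "v \<in> V"
  shows "star pr V W A v \<in> poly_over V"
    and "w \<in> W \<Longrightarrow> poly (pr (peval sV (star pr V W A v) [:l:]) w) m = - poly (pr v (peval sW (A w) [:l:])) (m - l)" (is "PROP ?A")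
proof -
  note A' = A[unfolded conformal_linear_iff[OF W.kd_space_axioms subW W.kd_space_axioms subW]]
  have lin: "linear_on sW W triv_scale (pr v)"
    using v by (simp add: linear_on_def pr_addR pr_scaleR)
  have lin': "linear_on sV V triv_scale (\<lambda>x. pr x w)" if "w \<in> W" for w
    using that by (simp add: linear_on_def pr_addL pr_scaleL pcompose_const)
  let ?\<Phi> = "\<lambda>p. p \<in> poly_over V \<and> (\<forall>w\<in>W. \<forall>l m.
      poly (pr (peval sV p [:l:]) w) m = - poly (pr v (peval sW (A w) [:l:])) (m - l))"
  have \<Phi>: "p \<in> poly_over V \<and>
     (\<forall>w\<in>W. app (\<lambda>x. pr x w) mu (subst lam p) = - app (pr v) (mu - lam) (subst lam (A w))) \<longleftrightarrow> ?\<Phi> p" for p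
    using A' peval2_app[OF W.kd_space_axioms kd_space_triv subW lin _ K.acts_mu_minus_lam]
      peval2_app[OF V.kd_space_axioms kd_space_triv subV lin' _ K.acts_mu]
    by (simp add: K.poly_poly_eq_iff W.subst_overs[OF subW] V.subst_overs[OF subV] W.peval2_substs V.peval2_substs
        cong: conj_cong)
  have "\<exists>!p. ?\<Phi> p"
  proof (rule ex_ex1I)
    show "\<exists>p. ?\<Phi> p" using adjoint_exists[OF A v] by auto
    fix p p' assume p: "?\<Phi> p" and p': "?\<Phi> p'"
    show "p = p'"
    proof (rule V.poly_eqI_peval)
      fix l
      have in': "peval sV p [:l:] \<in> V" "peval sV p' [:l:] \<in> V"
        using p p' by (simp_all add: V.peval_in[OF subV])
      have "peval sV p [:l:] - peval sV p' [:l:] = 0"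
        by (rule pr_inj, use in' in \<open>simp add: V.subspace_diff[OF subV]\<close>, rule poly_ext)
          (use p p' in' in \<open>simp add: pr_diffL\<close>)
      then show "peval sV p [:l:] = peval sV p' [:l:]" by simp
    qed
  qed
  then have "?\<Phi> (star pr V W A v)" unfolding star_def \<Phi> by (rule theI')
  then show "star pr V W A v \<in> poly_over V"
    and "PROP ?A"
    by auto
qed

end

section \<open>Matched pairs as Leibniz structures on the direct sum\<close>

lemma kd_space_prod:
  assumes "kd_space s" "kd_space s'"
  shows "kd_space (prod_scale s s')"
proof -
  interpret S: kd_space s by fact
  interpret S': kd_space s' by fact
  show ?thesis
    by unfold_locales (simp_all add: prod_scale_def S.scale_right_distrib S'.scale_right_distrib
        S.scale_left_distrib S'.scale_left_distrib prod_eq_iff)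
qed

lemma subspace_prod:
  assumes "kd_space s" "kd_space s'" "module.subspace s U" "module.subspace s' V"
  shows "module.subspace (prod_scale s s') (U \<times> V)"
proof -
  interpret S: kd_space s by fact
  interpret S': kd_space s' by fact
  interpret P: kd_space "prod_scale s s'" by (rule kd_space_prod) fact+
  show ?thesis
    using assms(3,4) by (intro P.subspaceI)
      (auto simp: prod_scale_def zero_prod_def S.subspace_0 S'.subspace_0 S.subspace_add S'.subspace_add
        S.subspace_scale S'.subspace_scale)
qed

lemma peval_embed:
  assumes "kd_space s" "kd_space s'"
  shows "peval (prod_scale s s') (map_poly (\<lambda>x. (x, 0)) p) q = (peval s p q, 0)" (is ?A)
    and "peval (prod_scale s s') (map_poly (\<lambda>x. (0, x)) p') q = (0, peval s' p' q)" (is ?B)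
proof -
  interpret S: kd_space s by fact
  interpret S': kd_space s' by fact
  have P: "kd_space (prod_scale s s')" by (rule kd_space_prod) fact+
  show ?A
    using S.peval_map[OF P S.subspace_UNIV, of p "\<lambda>x. (x, 0)" q q]
    by (simp add: prod_scale_def zero_prod_def)
  show ?B
    using S'.peval_map[OF P S'.subspace_UNIV, of p' "\<lambda>x. (0, x)" q q]
    by (simp add: prod_scale_def zero_prod_def)
qed

text \<open>
  The bracket \<open>[a + x \<^sub>\<lambda> b + y] = [a \<^sub>\<lambda> b] + \<phi>(x)\<^sub>\<lambda> b + \<psi>(y)\<^sub>-\<^sub>\<lambda>\<^sub>-\<^sub>\<partial> a + [x \<^sub>\<lambda> y] + l(a)\<^sub>\<lambda> y
  + r(b)\<^sub>-\<^sub>\<lambda>\<^sub>-\<^sub>\<partial> x\<close> on the direct sum.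
\<close>

definition double_bracket ::
    "('k::field_char_0 poly \<Rightarrow> 'a::ab_group_add \<Rightarrow> 'a) \<Rightarrow> ('a \<Rightarrow> 'a \<Rightarrow> 'a poly) \<Rightarrow>
     ('k poly \<Rightarrow> 'b::ab_group_add \<Rightarrow> 'b) \<Rightarrow> ('b \<Rightarrow> 'b \<Rightarrow> 'b poly) \<Rightarrow>
     ('a \<Rightarrow> 'b \<Rightarrow> 'b poly) \<Rightarrow> ('a \<Rightarrow> 'b \<Rightarrow> 'b poly) \<Rightarrow>
     ('b \<Rightarrow> 'a \<Rightarrow> 'a poly) \<Rightarrow> ('b \<Rightarrow> 'a \<Rightarrow> 'a poly) \<Rightarrow> 'a \<times> 'b \<Rightarrow> 'a \<times> 'b \<Rightarrow> ('a \<times> 'b) poly" where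
  "double_bracket s1 br1 s2 br2 l r \<phi> \<psi> u v =
     map_poly (\<lambda>x. (x, 0)) (br1 (fst u) (fst v) + \<phi> (snd u) (fst v) +
       subst1 (- lam1 - del1 s1) (\<psi> (snd v) (fst u))) +
     map_poly (\<lambda>y. (0, y)) (br2 (snd u) (snd v) + l (fst u) (snd v) +
       subst1 (- lam1 - del1 s2) (r (fst v) (snd u)))"

text \<open>
  The two shapes in which a condition on a matched pair differs from a component of a Jacobi
  identity, given another component.
\<close>

lemma group_rearrange:
  fixes P :: "'g::ab_group_add"
  shows "P + Q = S + T + U \<Longrightarrow> U = A + B + P + Q \<longleftrightarrow> A + B + S + T = 0"
    and "P = S + U \<Longrightarrow> U = T + P \<longleftrightarrow> T = - S"
proof -
  assume "P + Q = S + T + U"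
  then have "A + B + P + Q = (A + B + S + T) + U" by (simp add: add.assoc)
  then show "U = A + B + P + Q \<longleftrightarrow> A + B + S + T = 0" by (simp only: add_cancel_right_left)
next
  assume "P = S + U"
  then have "T + P = (T + S) + U" by (simp add: add.assoc)
  then show "U = T + P \<longleftrightarrow> T = - S" by (simp only: add_cancel_right_left eq_neg_iff_add_eq_0)
qed

locale mutual_actions =
  A: conformal_bracket_space s1 Q1 br1 + B: conformal_bracket_space s2 Q2 br2
  for s1 :: "'k::field_char_0 poly \<Rightarrow> 'a::ab_group_add \<Rightarrow> 'a" and Q1 br1
    and s2 :: "'k poly \<Rightarrow> 'b::ab_group_add \<Rightarrow> 'b" and Q2 br2 +
  fixes l r :: "'a \<Rightarrow> 'b \<Rightarrow> 'b poly" and \<phi> \<psi> :: "'b \<Rightarrow> 'a \<Rightarrow> 'a poly"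
  assumes cends: "cend_hom s1 Q1 s2 Q2 l" "cend_hom s1 Q1 s2 Q2 r"
    "cend_hom s2 Q2 s1 Q1 \<phi>" "cend_hom s2 Q2 s1 Q1 \<psi>"
begin

abbreviation sE where "sE \<equiv> prod_scale s1 s2"
abbreviation brE where "brE \<equiv> double_bracket s1 br1 s2 br2 l r \<phi> \<psi>"
abbreviation bA where "bA \<equiv> bval s1 br1"
abbreviation bB where "bB \<equiv> bval s2 br2"
text \<open>
  The four actions at a scalar: \<open>lv\<close> and \<open>fv\<close> act from the left, \<open>rv\<close> and \<open>gv\<close> are the actions
  \<open>r(a)\<^sub>-\<^sub>\<lambda>\<^sub>-\<^sub>\<partial>\<close> and \<open>\<psi>(x)\<^sub>-\<^sub>\<lambda>\<^sub>-\<^sub>\<partial>\<close> from the right.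
\<close>

abbreviation lv where "lv t a y \<equiv> peval s2 (l a y) [:t:]"
abbreviation rv where "rv t a y \<equiv> peval s2 (r a y) [:- t, - 1:]"
abbreviation fv where "fv t x b \<equiv> peval s1 (\<phi> x b) [:t:]"
abbreviation gv where "gv t x b \<equiv> peval s1 (\<psi> x b) [:- t, - 1:]"

lemma spaces: "kd_space s1" "kd_space s2" by unfold_locales

lemma spaceE: "kd_space sE" by (rule kd_space_prod) (rule spaces)+

sublocale E: kd_space sE by (rule spaceE)

lemma subE: "E.subspace (Q1 \<times> Q2)"
  by (rule subspace_prod[OF spaces A.subV B.subV])

lemma act_over:
  "a \<in> Q1 \<Longrightarrow> y \<in> Q2 \<Longrightarrow> l a y \<in> poly_over Q2" "a \<in> Q1 \<Longrightarrow> y \<in> Q2 \<Longrightarrow> r a y \<in> poly_over Q2"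
  "a \<in> Q1 \<Longrightarrow> y \<in> Q2 \<Longrightarrow> \<phi> y a \<in> poly_over Q1" "a \<in> Q1 \<Longrightarrow> y \<in> Q2 \<Longrightarrow> \<psi> y a \<in> poly_over Q1"
  using cends by (simp_all add: cend_hom_def conformal_linear_def)

lemma act_in:
  "a \<in> Q1 \<Longrightarrow> y \<in> Q2 \<Longrightarrow> peval s2 (l a y) q \<in> Q2" "a \<in> Q1 \<Longrightarrow> y \<in> Q2 \<Longrightarrow> peval s2 (r a y) q \<in> Q2"
  "a \<in> Q1 \<Longrightarrow> y \<in> Q2 \<Longrightarrow> peval s1 (\<phi> y a) q \<in> Q1" "a \<in> Q1 \<Longrightarrow> y \<in> Q2 \<Longrightarrow> peval s1 (\<psi> y a) q \<in> Q1"
  by (simp_all add: A.peval_in[OF A.subV] B.peval_in[OF B.subV] act_over)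

lemma act_add:
  assumes "a \<in> Q1" "b \<in> Q1" "x \<in> Q2" "y \<in> Q2"
  shows "l (a + b) x = l a x + l b x" "l a (x + y) = l a x + l a y"
    "r (a + b) x = r a x + r b x" "r a (x + y) = r a x + r a y"
    "\<phi> (x + y) a = \<phi> x a + \<phi> y a" "\<phi> x (a + b) = \<phi> x a + \<phi> x b"
    "\<psi> (x + y) a = \<psi> x a + \<psi> y a" "\<psi> x (a + b) = \<psi> x a + \<psi> x b"
  using cends assms by (simp_all add: cend_hom_def conformal_linear_def)

lemma zero_in: "0 \<in> Q1" "0 \<in> Q2"
  by (simp_all add: A.subspace_0[OF A.subV] B.subspace_0[OF B.subV])

lemma act_0:
  assumes "a \<in> Q1" "x \<in> Q2"
  shows "l 0 x = 0" "l a 0 = 0" "r 0 x = 0" "r a 0 = 0" "\<phi> 0 a = 0" "\<phi> x 0 = 0" "\<psi> 0 a = 0" "\<psi> x 0 = 0"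
  using act_add[of 0 0 x 0] act_add[of a 0 0 0] act_add[of 0 0 x x] act_add[of a a 0 0] assms zero_in by simp_all

lemma act_scaleL:
  assumes "a \<in> Q1" "x \<in> Q2"
  shows "peval s2 (l (s1 p a) x) q = s2 (pcompose p (- q)) (peval s2 (l a x) q)"
    "peval s2 (r (s1 p a) x) q = s2 (pcompose p (- q)) (peval s2 (r a x) q)"
    "peval s1 (\<phi> (s2 p x) a) q = s1 (pcompose p (- q)) (peval s1 (\<phi> x a) q)"
    "peval s1 (\<psi> (s2 p x) a) q = s1 (pcompose p (- q)) (peval s1 (\<psi> x a) q)"
  using cends assms by (simp_all add: cend_hom_def peval_chom_scale spaces)

lemma act_scaleR:
  assumes "a \<in> Q1" "x \<in> Q2"
  shows "peval s2 (l a (s2 p x)) q = s2 (pcompose p (q + [:0, 1:])) (peval s2 (l a x) q)" (is ?A)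
    "peval s2 (r a (s2 p x)) q = s2 (pcompose p (q + [:0, 1:])) (peval s2 (r a x) q)" (is ?B)
    "peval s1 (\<phi> x (s1 p a)) q = s1 (pcompose p (q + [:0, 1:])) (peval s1 (\<phi> x a) q)" (is ?C)
    "peval s1 (\<psi> x (s1 p a)) q = s1 (pcompose p (q + [:0, 1:])) (peval s1 (\<psi> x a) q)" (is ?D)
proof -
  have "conformal_linear s2 Q2 s2 Q2 (l a)" "conformal_linear s2 Q2 s2 Q2 (r a)"
    "conformal_linear s1 Q1 s1 Q1 (\<phi> x)" "conformal_linear s1 Q1 s1 Q1 (\<psi> x)"
    using cends assms by (simp_all add: cend_hom_def)
  note cl = this[THEN [4] conformal_linear_peval]
  show ?A
    by (rule cl(1)[OF spaces(2) B.subV spaces(2) assms(2)])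
  show ?B
    by (rule cl(2)[OF spaces(2) B.subV spaces(2) assms(2)])
  show ?C
    by (rule cl(3)[OF spaces(1) A.subV spaces(1) assms(1)])
  show ?D
    by (rule cl(4)[OF spaces(1) A.subV spaces(1) assms(1)])
qed

lemma bvalE:
  "bval sE brE t u v =
    (bA t (fst u) (fst v) + fv t (snd u) (fst v) + gv t (snd v) (fst u),
     bB t (snd u) (snd v) + lv t (fst u) (snd v) + rv t (fst v) (snd u))"
  by (simp add: bval_def double_bracket_def peval_embed[OF spaces] A.peval_subst1_neg B.peval_subst1_neg)

lemma brE_over:
  assumes "u \<in> Q1 \<times> Q2" "v \<in> Q1 \<times> Q2"
  shows "brE u v \<in> poly_over (Q1 \<times> Q2)"
proof -
  have 1: "br1 (fst u) (fst v) + \<phi> (snd u) (fst v) + subst1 (- lam1 - del1 s1) (\<psi> (snd v) (fst u)) \<in> poly_over Q1"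
    (is "?p \<in> _")
    using assms A.br_over[of "fst u" "fst v"] act_over(3)[of "fst v" "snd u"]
      A.poly_over_subst1_neg[OF A.subV act_over(4)[of "fst u" "snd v"]]
    by (auto simp: poly_over_def intro!: A.subspace_add[OF A.subV])
  have 2: "br2 (snd u) (snd v) + l (fst u) (snd v) + subst1 (- lam1 - del1 s2) (r (fst v) (snd u)) \<in> poly_over Q2"
    (is "?q \<in> _")
    using assms B.br_over[of "snd u" "snd v"] act_over(1)[of "fst u" "snd v"]
      B.poly_over_subst1_neg[OF B.subV act_over(2)[of "fst v" "snd u"]]
    by (auto simp: poly_over_def intro!: B.subspace_add[OF B.subV])
  have "coeff (brE u v) n = (coeff ?p n, coeff ?q n)" for n
    unfolding double_bracket_def by (simp add: coeff_map_poly zero_prod_def del: coeff_add add: coeff_add[of "map_poly _ _"])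
  then show ?thesis using 1 2 by (simp add: poly_over_def)
qed

text \<open>
  Replacing \<open>\<lambda>\<close> by \<open>- \<lambda> - \<partial>\<close> exchanges the rules for \<open>\<partial>\<close> in the two arguments, so the terms
  with \<open>r\<close> and \<open>\<psi>\<close>, in which the arguments are interchanged, obey the same rules as the
  others.
\<close>

lemma bracketE: "conformal_bracket sE (Q1 \<times> Q2) brE"
proof (rule conformal_bracketI[OF spaceE subE brE_over])
  fix t u v w assume u: "u \<in> Q1 \<times> Q2" and v: "v \<in> Q1 \<times> Q2" and w: "w \<in> Q1 \<times> Q2"
  show "bval sE brE t (u + v) w = bval sE brE t u w + bval sE brE t v w"
    "bval sE brE t u (v + w) = bval sE brE t u v + bval sE brE t u w"
    using u v w by (auto simp: bvalE A.bval_addL A.bval_addR B.bval_addL B.bval_addR act_add)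
next
  fix t p u v assume u: "u \<in> Q1 \<times> Q2" and v: "v \<in> Q1 \<times> Q2"
  show "bval sE brE t (sE p u) v = sE [:poly p (- t):] (bval sE brE t u v)"
    using u v by (auto simp: bvalE prod_scale_def A.bval_scaleL B.bval_scaleL act_scaleL act_scaleR
        pcompose_const A.scale_right_distrib B.scale_right_distrib)
  show "bval sE brE t u (sE p v) = sE (pcompose p [:t, 1:]) (bval sE brE t u v)"
    using u v by (auto simp: bvalE prod_scale_def A.bval_scaleR B.bval_scaleR act_scaleL act_scaleR
        A.scale_right_distrib B.scale_right_distrib)
qed

sublocale CE: conformal_bracket_space sE "Q1 \<times> Q2" brE
  by unfold_locales (rule bracketE)

lemma bval_zeros:
  "a \<in> Q1 \<Longrightarrow> bA t 0 a = 0" "a \<in> Q1 \<Longrightarrow> bA t a 0 = 0" "x \<in> Q2 \<Longrightarrow> bB t 0 x = 0" "x \<in> Q2 \<Longrightarrow> bB t x 0 = 0"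
  by (simp_all add: A.bval_0L A.bval_0R B.bval_0L B.bval_0R)

lemma bvalE_pure:
  assumes "a \<in> Q1" "x \<in> Q2" "c \<in> Q1" "y \<in> Q2"
  shows "bval sE brE t (a, 0) (c, y) = (bA t a c + gv t y a, lv t a y)"
    "bval sE brE t (c, y) (a, 0) = (bA t c a + fv t y a, rv t a y)"
    "bval sE brE t (0, x) (c, y) = (fv t x c, bB t x y + rv t c x)"
    "bval sE brE t (c, y) (0, x) = (gv t x c, bB t y x + lv t c x)"
  using assms by (simp_all add: bvalE act_0 bval_zeros zero_in)

lemma bvalE_pure2:
  assumes "a \<in> Q1" "x \<in> Q2" "b \<in> Q1" "y \<in> Q2"
  shows "bval sE brE t (a, 0) (b, 0) = (bA t a b, 0)"
    "bval sE brE t (a, 0) (0, y) = (gv t y a, lv t a y)"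
    "bval sE brE t (0, y) (a, 0) = (fv t y a, rv t a y)"
    "bval sE brE t (0, x) (0, y) = (0, bB t x y)"
  using assms by (simp_all add: bvalE act_0 bval_zeros zero_in)

text \<open>
  On a triple of homogeneous elements that are not all of one kind, the two components of the
  Jacobi identity are conditions on a representation and on a matched pair.
\<close>

lemma jac_pure_iff:
  assumes "a \<in> Q1" "b \<in> Q1" "x \<in> Q2" "y \<in> Q2"
  shows "CE.jac t m (a, 0) (b, 0) (0, x) = 0 \<longleftrightarrow>
      bA t a (gv m x b) + gv t (lv m b x) a =
        gv (t + m) x (bA t a b) + bA m b (gv t x a) + gv m (lv t a x) b \<and>
      lv t a (lv m b x) = lv (t + m) (bA t a b) x + lv m b (lv t a x)"
    "CE.jac t m (a, 0) (0, x) (b, 0) = 0 \<longleftrightarrow>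
      bA t a (fv m x b) + gv t (rv m b x) a =
        bA (t + m) (gv t x a) b + fv (t + m) (lv t a x) b + fv m x (bA t a b) \<and>
      lv t a (rv m b x) = rv (t + m) b (lv t a x) + rv m (bA t a b) x"
    "CE.jac t m (0, x) (a, 0) (b, 0) = 0 \<longleftrightarrow>
      fv t x (bA m a b) =
        bA (t + m) (fv t x a) b + fv (t + m) (rv t a x) b + bA m a (fv t x b) + gv m (rv t b x) a \<and>
      rv t (bA m a b) x = rv (t + m) b (rv t a x) + lv m a (rv t b x)"
    "CE.jac t m (0, x) (0, y) (a, 0) = 0 \<longleftrightarrow>
      bB t x (rv m a y) + rv t (fv m y a) x =
        rv (t + m) a (bB t x y) + bB m y (rv t a x) + rv m (fv t x a) y \<and>
      fv t x (fv m y a) = fv (t + m) (bB t x y) a + fv m y (fv t x a)"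
    "CE.jac t m (0, x) (a, 0) (0, y) = 0 \<longleftrightarrow>
      bB t x (lv m a y) + rv t (gv m y a) x =
        bB (t + m) (rv t a x) y + lv (t + m) (fv t x a) y + lv m a (bB t x y) \<and>
      fv t x (gv m y a) = gv (t + m) y (fv t x a) + gv m (bB t x y) a"
    "CE.jac t m (a, 0) (0, x) (0, y) = 0 \<longleftrightarrow>
      lv t a (bB m x y) =
        bB (t + m) (lv t a x) y + lv (t + m) (gv t x a) y + bB m x (lv t a y) + rv m (gv t y a) x \<and>
      gv t (bB m x y) a = gv (t + m) y (gv t x a) + fv m x (gv t y a)"
  using assms
  by (auto simp: CE.jac_def bvalE_pure bvalE_pure2 act_in A.bval_in B.bval_in zero_prod_def algebra_simps)

lemma jac_pure_same:
  "\<lbrakk>a \<in> Q1; b \<in> Q1; c \<in> Q1\<rbrakk> \<Longrightarrow> CE.jac t m (a, 0) (b, 0) (c, 0) = (A.jac t m a b c, 0)"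
  "\<lbrakk>x \<in> Q2; y \<in> Q2; z \<in> Q2\<rbrakk> \<Longrightarrow> CE.jac t m (0, x) (0, y) (0, z) = (0, B.jac t m x y z)"
  by (simp_all add: CE.jac_def A.jac_def B.jac_def A.bval_in B.bval_in
      bvalE_pure2(1)[OF _ zero_in(2) _ zero_in(2)] bvalE_pure2(4)[OF zero_in(1) _ zero_in(1)])

lemma jac_from_pure:
  assumes "\<And>t m a b c. a \<in> Q1 \<Longrightarrow> b \<in> Q1 \<Longrightarrow> c \<in> Q1 \<Longrightarrow> CE.jac t m (a, 0) (b, 0) (c, 0) = 0"
    and "\<And>t m a b x. a \<in> Q1 \<Longrightarrow> b \<in> Q1 \<Longrightarrow> x \<in> Q2 \<Longrightarrow> CE.jac t m (a, 0) (b, 0) (0, x) = 0"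
    and "\<And>t m a b x. a \<in> Q1 \<Longrightarrow> b \<in> Q1 \<Longrightarrow> x \<in> Q2 \<Longrightarrow> CE.jac t m (a, 0) (0, x) (b, 0) = 0"
    and "\<And>t m a b x. a \<in> Q1 \<Longrightarrow> b \<in> Q1 \<Longrightarrow> x \<in> Q2 \<Longrightarrow> CE.jac t m (0, x) (a, 0) (b, 0) = 0"
    and "\<And>t m a x y. a \<in> Q1 \<Longrightarrow> x \<in> Q2 \<Longrightarrow> y \<in> Q2 \<Longrightarrow> CE.jac t m (0, x) (0, y) (a, 0) = 0"
    and "\<And>t m a x y. a \<in> Q1 \<Longrightarrow> x \<in> Q2 \<Longrightarrow> y \<in> Q2 \<Longrightarrow> CE.jac t m (0, x) (a, 0) (0, y) = 0"
    and "\<And>t m a x y. a \<in> Q1 \<Longrightarrow> x \<in> Q2 \<Longrightarrow> y \<in> Q2 \<Longrightarrow> CE.jac t m (a, 0) (0, x) (0, y) = 0"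
    and "\<And>t m x y z. x \<in> Q2 \<Longrightarrow> y \<in> Q2 \<Longrightarrow> z \<in> Q2 \<Longrightarrow> CE.jac t m (0, x) (0, y) (0, z) = 0"
    and "u \<in> Q1 \<times> Q2" "v \<in> Q1 \<times> Q2" "w \<in> Q1 \<times> Q2"
  shows "CE.jac t m u v w = 0"
proof -
  obtain a x b y c z where uvw: "u = (a, x)" "v = (b, y)" "w = (c, z)"
    and in1: "a \<in> Q1" "b \<in> Q1" "c \<in> Q1" and in2: "x \<in> Q2" "y \<in> Q2" "z \<in> Q2"
    using assms(9-11) by blast
  have split: "(a, x) = (a, 0) + (0, x)" "(b, y) = (b, 0) + (0, y)" "(c, z) = (c, 0) + (0, z)" by simp_all
  have pure: "(e, 0) \<in> Q1 \<times> Q2" "(0, f) \<in> Q1 \<times> Q2" if "e \<in> Q1" "f \<in> Q2" for e f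
    using that zero_in by simp_all
  have "(a, 0) + (0, x) \<in> Q1 \<times> Q2" "(b, 0) + (0, y) \<in> Q1 \<times> Q2" "(c, 0) + (0, z) \<in> Q1 \<times> Q2"
    using in1 in2 by simp_all
  then show ?thesis
    unfolding uvw split
    by (simp add: CE.jac_add in1 in2 zero_in assms(1-8) del: add_Pair)
qed

lemma lin_rules:
  "a \<in> Q1 \<Longrightarrow> linear_on s2 Q2 s2 (l a)" "a \<in> Q1 \<Longrightarrow> linear_on s2 Q2 s2 (r a)"
  "x \<in> Q2 \<Longrightarrow> linear_on s1 Q1 s1 (\<phi> x)" "x \<in> Q2 \<Longrightarrow> linear_on s1 Q1 s1 (\<psi> x)"
  "x \<in> Q2 \<Longrightarrow> linear_on s1 Q1 s2 (\<lambda>c. l c x)" (is "PROP ?A") "x \<in> Q2 \<Longrightarrow> linear_on s1 Q1 s2 (\<lambda>c. r c x)" (is "PROP ?B")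
  "a \<in> Q1 \<Longrightarrow> linear_on s2 Q2 s1 (\<lambda>z. \<phi> z a)" (is "PROP ?C") "a \<in> Q1 \<Longrightarrow> linear_on s2 Q2 s1 (\<lambda>z. \<psi> z a)" (is "PROP ?D")
proof -
  show "PROP ?A" "PROP ?B"
    by (auto simp: linear_on_def act_add act_scaleL intro!: B.poly_eqI_peval)
  show "PROP ?C" "PROP ?D"
    by (auto simp: linear_on_def act_add act_scaleL intro!: A.poly_eqI_peval)
qed (use cends in \<open>simp_all add: linear_on_def cend_hom_def conformal_linear_def\<close>)

lemmas lin_all = lin_rules A.linear_on_left A.linear_on_right B.linear_on_left B.linear_on_right

lemmas app_rules =
  A.acts_rules[THEN [3] peval2_app[OF spaces(1) spaces(1) A.subV]]
  A.acts_rules[THEN [3] peval2_app[OF spaces(2) spaces(1) B.subV]]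
  B.acts_rules[THEN [3] peval2_app[OF spaces(1) spaces(2) A.subV]]
  B.acts_rules[THEN [3] peval2_app[OF spaces(2) spaces(2) B.subV]]

lemmas over_rules = A.subst_overs[OF A.subV] B.subst_overs[OF B.subV] A.br_over B.br_over act_over

lemmas eval_rules = app_rules over_rules lin_all A.peval2_substs B.peval2_substs
  bval_def[symmetric, of s1] bval_def[symmetric, of s2]

text \<open>
  The conditions on a matched pair at \<open>\<lambda> = t\<close> and \<open>\<mu> = m\<close>, sorted by the type of their arguments: here two
  arguments lie in \<open>Q\<^sub>1\<close> and one in \<open>Q\<^sub>2\<close>, in \<open>matched_conditions2\<close> one lies in \<open>Q\<^sub>1\<close> and two in \<open>Q\<^sub>2\<close>.
\<close>

definition matched_conditions1 where
  "matched_conditions1 a b x t m \<longleftrightarrow>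
    lv t a (lv m b x) = lv (t + m) (bA t a b) x + lv m b (lv t a x) \<and>
    lv t a (rv m b x) = rv (t + m) b (lv t a x) + rv m (bA t a b) x \<and>
    rv (t + m) b (rv m a x) = - rv (t + m) b (lv t a x) \<and>
    bA t a (gv m x b) + gv t (lv m b x) a =
      gv (t + m) x (bA t a b) + bA m b (gv t x a) + gv m (lv t a x) b \<and>
    bA t a (fv m x b) + gv t (rv m b x) a =
      bA (t + m) (gv t x a) b + fv (t + m) (lv t a x) b + fv m x (bA t a b) \<and>
    bA (t + m) (fv t x a) b + fv (t + m) (rv t a x) b +
      bA (t + m) (gv m x a) b + fv (t + m) (lv m a x) b = 0"

definition matched_conditions2 where
  "matched_conditions2 a x y t m \<longleftrightarrow>
    fv t x (fv m y a) = fv (t + m) (bB t x y) a + fv m y (fv t x a) \<and>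
    fv t x (gv m y a) = gv (t + m) y (fv t x a) + gv m (bB t x y) a \<and>
    gv (t + m) y (gv m x a) = - gv (t + m) y (fv t x a) \<and>
    bB t x (rv m a y) + rv t (fv m y a) x =
      rv (t + m) a (bB t x y) + bB m y (rv t a x) + rv m (fv t x a) y \<and>
    lv t a (bB m x y) =
      bB (t + m) (lv t a x) y + lv (t + m) (gv t x a) y + bB m x (lv t a y) + rv m (gv t y a) x \<and>
    bB t x (lv m a y) + rv t (gv m y a) x =
      lv (t + m) (fv t x a) y + lv m a (bB t x y) + bB (t + m) (rv t a x) y"

lemma matched_pair_eval:
  assumes "leibniz_conformal_algebra s1 Q1 br1" "leibniz_conformal_algebra s2 Q2 br2"
  shows "matched_pair s1 Q1 br1 s2 Q2 br2 l r \<phi> \<psi> \<longleftrightarrow>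
    (\<forall>a\<in>Q1. \<forall>b\<in>Q1. \<forall>x\<in>Q2. \<forall>t m. matched_conditions1 a b x t m) \<and>
    (\<forall>a\<in>Q1. \<forall>x\<in>Q2. \<forall>y\<in>Q2. \<forall>t m. matched_conditions2 a x y t m)"
  unfolding matched_pair_def representation_def matched_conditions1_def matched_conditions2_def
  using assms A.subV B.subV spaces cends
  by (simp add: A.poly_poly_eq_iff B.poly_poly_eq_iff eval_rules kd_module_iff) meson

text \<open>
  The third condition on a representation and the last condition on a matched pair each state the
  sum of the Jacobi identities for two orders of the arguments, with \<open>\<lambda>\<close> and \<open>\<mu>\<close> exchanged in one
  of them; hence the quantification over \<open>t\<close> and \<open>m\<close> on both sides.
\<close>

lemma matched_conditions1_iff:
  assumes in': "a \<in> Q1" "b \<in> Q1" "x \<in> Q2"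
  shows "(\<forall>t m. matched_conditions1 a b x t m) \<longleftrightarrow>
    (\<forall>t m. CE.jac t m (a, 0) (b, 0) (0, x) = 0 \<and> CE.jac t m (a, 0) (0, x) (b, 0) = 0 \<and>
      CE.jac t m (0, x) (a, 0) (b, 0) = 0)"
proof -
  note j = jac_pure_iff(1-3)[OF in' in'(3)]
  let ?R = "\<lambda>t m. rv (t + m) b (rv m a x) = - rv (t + m) b (lv t a x)"
  let ?S = "\<lambda>t m. bA (t + m) (fv t x a) b + fv (t + m) (rv t a x) b +
    bA (t + m) (gv m x a) b + fv (t + m) (lv m a x) b = 0"
  have "CE.jac t m (0, x) (a, 0) (b, 0) = 0 \<longleftrightarrow> ?S t m \<and> ?R m t" if "CE.jac m t (a, 0) (0, x) (b, 0) = 0" for t m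
  proof -
    note h = that[unfolded j(2) add.commute[of m t]]
    show ?thesis
      unfolding j(3) group_rearrange(1)[OF conjunct1[OF h]] group_rearrange(2)[OF conjunct2[OF h]]
      by (simp only: add.commute[of m t])
  qed
  moreover have "matched_conditions1 a b x t m \<longleftrightarrow>
    CE.jac t m (a, 0) (b, 0) (0, x) = 0 \<and> CE.jac t m (a, 0) (0, x) (b, 0) = 0 \<and> ?R t m \<and> ?S t m" for t m
    unfolding matched_conditions1_def j by blast
  ultimately show ?thesis by blast
qed

lemma matched_conditions2_iff:
  assumes in': "a \<in> Q1" "x \<in> Q2" "y \<in> Q2"
  shows "(\<forall>t m. matched_conditions2 a x y t m) \<longleftrightarrow>
    (\<forall>t m. CE.jac t m (0, x) (0, y) (a, 0) = 0 \<and> CE.jac t m (0, x) (a, 0) (0, y) = 0 \<and>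
      CE.jac t m (a, 0) (0, x) (0, y) = 0)"
proof -
  note j = jac_pure_iff(4-6)[OF in'(1,1,2,3)]
  let ?R = "\<lambda>t m. gv (t + m) y (gv m x a) = - gv (t + m) y (fv t x a)"
  let ?S = "\<lambda>t m. lv t a (bB m x y) =
      bB (t + m) (lv t a x) y + lv (t + m) (gv t x a) y + bB m x (lv t a y) + rv m (gv t y a) x"
  have "CE.jac t m (a, 0) (0, x) (0, y) = 0 \<longleftrightarrow> ?S t m \<and> ?R m t" if "CE.jac m t (0, x) (a, 0) (0, y) = 0" for t m
  proof -
    note h = that[unfolded j(2) add.commute[of m t]]
    show ?thesis
      unfolding j(3) group_rearrange(2)[OF conjunct2[OF h]] by (simp only: add.commute[of m t])
  qed
  moreover have "matched_conditions2 a x y t m \<longleftrightarrow>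
    CE.jac t m (0, x) (0, y) (a, 0) = 0 \<and> CE.jac t m (0, x) (a, 0) (0, y) = 0 \<and> ?R t m \<and> ?S t m" for t m
    unfolding matched_conditions2_def j by (auto simp: algebra_simps)
  ultimately show ?thesis by blast
qed

text \<open>
  A matched pair is a Leibniz structure on the direct sum that extends those of the summands:
  its conditions are the Jacobi identities for the six kinds of mixed triples.
\<close>

theorem matched_pair_iff_leibniz:
  assumes L1: "leibniz_conformal_algebra s1 Q1 br1" and L2: "leibniz_conformal_algebra s2 Q2 br2"
  shows "matched_pair s1 Q1 br1 s2 Q2 br2 l r \<phi> \<psi> \<longleftrightarrow> leibniz_conformal_algebra sE (Q1 \<times> Q2) brE"
proof -
  have jA: "A.jac t m a b c = 0" if "a \<in> Q1" "b \<in> Q1" "c \<in> Q1" for a b c t m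
    using L1 that by (simp add: leibniz_iff)
  have jB: "B.jac t m x y z = 0" if "x \<in> Q2" "y \<in> Q2" "z \<in> Q2" for x y z t m
    using L2 that by (simp add: leibniz_iff)
  have pure: "(a, 0) \<in> Q1 \<times> Q2" "(0, x) \<in> Q1 \<times> Q2" if "a \<in> Q1" "x \<in> Q2" for a x
    using that zero_in by simp_all
  show ?thesis
    unfolding matched_pair_eval[OF L1 L2] leibniz_iff[of sE]
  proof (intro iffI conjI bracketE ballI allI)
    fix u v w t m
    assume C: "(\<forall>a\<in>Q1. \<forall>b\<in>Q1. \<forall>x\<in>Q2. \<forall>t m. matched_conditions1 a b x t m) \<and>
      (\<forall>a\<in>Q1. \<forall>x\<in>Q2. \<forall>y\<in>Q2. \<forall>t m. matched_conditions2 a x y t m)"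
      and uvw: "u \<in> Q1 \<times> Q2" "v \<in> Q1 \<times> Q2" "w \<in> Q1 \<times> Q2"
    show "CE.jac t m u v w = 0"
      by (rule jac_from_pure[OF _ _ _ _ _ _ _ _ uvw])
        (use C matched_conditions1_iff matched_conditions2_iff in \<open>simp_all add: jac_pure_same jA jB zero_prod_def\<close>)
  next
    fix a b x t m assume "a \<in> Q1" "b \<in> Q1" "x \<in> Q2"
      and L: "conformal_bracket sE (Q1 \<times> Q2) brE \<and> (\<forall>a\<in>Q1 \<times> Q2. \<forall>b\<in>Q1 \<times> Q2. \<forall>c\<in>Q1 \<times> Q2. \<forall>l m. CE.jac l m a b c = 0)"
    then show "matched_conditions1 a b x t m"
      using matched_conditions1_iff[of a b x] pure zero_in by blast
  next
    fix a x y t m assume "a \<in> Q1" "x \<in> Q2" "y \<in> Q2"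
      and L: "conformal_bracket sE (Q1 \<times> Q2) brE \<and> (\<forall>a\<in>Q1 \<times> Q2. \<forall>b\<in>Q1 \<times> Q2. \<forall>c\<in>Q1 \<times> Q2. \<forall>l m. CE.jac l m a b c = 0)"
    then show "matched_conditions2 a x y t m"
      using matched_conditions2_iff[of a x y] pure zero_in by blast
  qed
qed

end

section \<open>Adjoint actions\<close>

context conformal_bracket_space
begin

lemma peval_br_scaleL:
  assumes "a \<in> V" "b \<in> V"
  shows "peval s (br (s p a) b) q = s (pcompose p (- q)) (peval s (br a b) q)"
  using scale_from_generators[OF kd_space_axioms subV module_axioms, of "\<lambda>a. peval s (br a b) q" "- q" a p] cbr assms
  by (simp add: conformal_bracket_def flip: scale_minus_left)

lemma peval_br_scaleR:
  assumes "a \<in> V" "b \<in> V"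
  shows "peval s (br a (s p b)) q = s (pcompose p (q + [:0, 1:])) (peval s (br a b) q)"
  using scale_from_generators[OF kd_space_axioms subV module_axioms, of "\<lambda>b. peval s (br a b) q" "q + [:0, 1:]" b p] cbr assms
  by (simp add: conformal_bracket_def scale_left_distrib)

lemma br_add: "a \<in> V \<Longrightarrow> b \<in> V \<Longrightarrow> c \<in> V \<Longrightarrow> br (a + b) c = br a c + br b c"
    "a \<in> V \<Longrightarrow> b \<in> V \<Longrightarrow> c \<in> V \<Longrightarrow> br a (b + c) = br a b + br a c"
  using cbr by (simp_all add: conformal_bracket_def)

lemma peval_Rop: "peval s (Rop s br a b) [:l:] = peval s (br b a) [:- l, - 1:]"
  by (simp add: Rop_def peval_subst1_neg)

lemma cend_hom_Lop: "cend_hom s V s V (Lop br)"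
  unfolding cend_hom_def
  by (auto simp: conformal_linear_iff[OF kd_space_axioms subV kd_space_axioms subV] Lop_def br_over br_add
      peval_br_scaleL peval_br_scaleR pcompose_const intro!: chom_scale_eqI[OF kd_space_axioms])

lemma cend_hom_Rop: "cend_hom s V s V (Rop s br)"
  unfolding cend_hom_def
  by (auto simp: conformal_linear_iff[OF kd_space_axioms subV kd_space_axioms subV] br_add
      br_over poly_over_subst1_neg[OF subV] peval_Rop subspace_add[OF subV] subspace_scale[OF subV]
      peval_br_scaleL peval_br_scaleR pcompose_const Rop_def[of s br _ _, THEN arg_cong[of _ _ "\<lambda>x. x \<in> poly_over V"]]
      peval_chom_scale[OF kd_space_axioms] intro!: poly_eqI_peval)

end

context perfect_pairing
begin

lemma pr_eqI:
  assumes "v \<in> V" "v' \<in> V" "\<And>w m. w \<in> W \<Longrightarrow> poly (pr v w) m = poly (pr v' w) m"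
  shows "v = v'"
proof -
  have "v - v' = 0"
    by (rule pr_inj) (use assms in \<open>auto simp: V.subspace_diff[OF subV] pr_diffL intro!: poly_ext\<close>)
  then show ?thesis by simp
qed

lemma star_in: "conformal_linear sW W sW W A \<Longrightarrow> v \<in> V \<Longrightarrow> peval sV (star pr V W A v) q \<in> V"
  by (intro V.peval_in[OF subV] star_property(1))

lemma conformal_linear_star:
  assumes A: "conformal_linear sW W sW W A"
  shows "conformal_linear sV V sV V (star pr V W A)"
proof -
  note A' = A[unfolded conformal_linear_iff[OF W.kd_space_axioms subW W.kd_space_axioms subW]]
  have Ain: "peval sW (A w) [:l:] \<in> W" if "w \<in> W" for w l
    using A' that by (simp add: W.peval_in[OF subW])
  note st = star_property[OF A] star_in[OF A]
  show ?thesis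
    unfolding conformal_linear_iff[OF V.kd_space_axioms subV V.kd_space_axioms subV]
  proof (intro conjI ballI allI)
    fix u v l assume uv: "u \<in> V" "v \<in> V"
    show "peval sV (star pr V W A (u + v)) [:l:] = peval sV (star pr V W A u) [:l:] + peval sV (star pr V W A v) [:l:]"
      by (rule pr_eqI) (use uv in \<open>auto simp: st V.subspace_add[OF subV] pr_addL Ain\<close>)
  next
    fix p u l assume u: "u \<in> V"
    show "peval sV (star pr V W A (sV p u)) [:l:] = sV (pcompose p [:l, 1:]) (peval sV (star pr V W A u) [:l:])"
      by (rule pr_eqI) (use u in \<open>auto simp: st V.subspace_scale[OF subV] pr_scaleL Ain poly_pcompose\<close>)
  qed (simp add: st)
qed

text \<open>
  Taking adjoints is compatible with the \<open>k[\<partial>]\<close>-module structures, since an adjoint is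
  determined by its pairings.
\<close>

lemma cend_hom_star:
  assumes A: "cend_hom sC C sW W A" and C: "module.subspace sC C" "kd_space sC"
  shows "cend_hom sC C sV V (\<lambda>c. star pr V W (A c))"
proof -
  interpret C: kd_space sC by (rule C(2))
  have cl: "conformal_linear sW W sW W (A c)" if "c \<in> C" for c
    using A that by (simp add: cend_hom_def)
  note A' = cl[unfolded conformal_linear_iff[OF W.kd_space_axioms subW W.kd_space_axioms subW]]
  have Ain: "peval sW (A c w) [:l:] \<in> W" if "w \<in> W" "c \<in> C" for w l c
    using A' that by (simp add: W.peval_in[OF subW])
  note st = star_property[OF cl] star_in[OF cl]
  have Ascale: "peval sW (A (sC p c) w) [:l:] = sW [:poly p (- l):] (peval sW (A c w) [:l:])"
    if "c \<in> C" "w \<in> W" for p c w l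
    using A that by (simp add: cend_hom_def peval_chom_scale[OF W.kd_space_axioms] pcompose_const)
  have Aadd: "A (c + d) w = A c w + A d w" if "c \<in> C" "d \<in> C" "w \<in> W" for c d w
    using A that by (simp add: cend_hom_def)
  show ?thesis
    unfolding cend_hom_def
  proof (intro conjI ballI allI)
    fix c assume "c \<in> C"
    then show "conformal_linear sV V sV V (star pr V W (A c))" by (intro conformal_linear_star cl)
  next
    fix c d v assume cd: "c \<in> C" "d \<in> C" "v \<in> V"
    show "star pr V W (A (c + d)) v = star pr V W (A c) v + star pr V W (A d) v"
      by (rule V.poly_eqI_peval, rule pr_eqI)
        (use cd in \<open>auto simp: st V.subspace_add[OF subV] pr_addL pr_addR Ain Aadd C.subspace_add[OF C(1)]\<close>)
  next
    fix p c v assume c: "c \<in> C" "v \<in> V"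
    show "star pr V W (A (sC p c)) v = chom_scale sV p (star pr V W (A c)) v"
      by (rule chom_scale_eqI[OF V.kd_space_axioms], rule pr_eqI)
        (use c in \<open>auto simp: st V.subspace_scale[OF subV] pr_scaleL pr_scaleR Ain Ascale C.subspace_scale[OF C(1)]
            pcompose_const\<close>)
  qed
qed

end

lemma cend_hom_neg_diff:
  assumes "cend_hom s V sM M l" "cend_hom s V sM M r" "kd_space s" "module.subspace s V"
    "kd_space sM" "module.subspace sM M"
  shows "cend_hom s V sM M (- l - r)"
proof -
  interpret S: kd_space s by fact
  interpret M: kd_space sM by fact
  have over: "- p - q \<in> poly_over M" if "p \<in> poly_over M" "q \<in> poly_over M" for p q
    using that by (simp add: poly_over_def M.subspace_diff[OF assms(6)] M.subspace_neg[OF assms(6)])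
  have "(- l - r) (s p a) v = chom_scale sM p ((- l - r) a) v" if "a \<in> V" "v \<in> M" for p a v
    by (rule M.poly_eqI_peval) (use assms(1,2) that in \<open>simp add: cend_hom_def peval_chom_scale[OF assms(5)]
        M.scale_right_diff_distrib\<close>)
  then show ?thesis
    using assms(1,2)
    unfolding cend_hom_def conformal_linear_iff[OF assms(5,6,5,6)]
    by (auto simp: over M.scale_right_diff_distrib)
qed

section \<open>A free algebra and its conformal dual\<close>

lemma (in kd_space) additive_sum:
  fixes h :: "'v \<Rightarrow> 'w::ab_group_add"
  assumes V: "subspace V" and add: "\<And>u v. u \<in> V \<Longrightarrow> v \<in> V \<Longrightarrow> h (u + v) = h u + h v"
    and "\<And>i. i \<in> A \<Longrightarrow> g i \<in> V"
  shows "h (sum g A) = (\<Sum>i\<in>A. h (g i))"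
proof -
  have 0: "h 0 = 0" using add[of 0 0] subspace_0[OF V] by simp
  from assms(3) show ?thesis
  proof (induction A rule: infinite_finite_induct)
    case (insert x F)
    have "sum g F \<in> V" using insert.prems by (intro subspace_sum[OF V]) auto
    then show ?case using insert by (simp add: add)
  qed (simp_all add: 0)
qed

locale dual_leibniz =
  fixes s :: "'k::field_char_0 poly \<Rightarrow> 'q::ab_group_add \<Rightarrow> 'q"
    and br :: "'q \<Rightarrow> 'q \<Rightarrow> 'q poly"
    and brd :: "('q \<Rightarrow> 'k poly) \<Rightarrow> ('q \<Rightarrow> 'k poly) \<Rightarrow> ('q \<Rightarrow> 'k poly) poly"
  assumes finQ: "finite_leibniz_conformal_algebra s UNIV br"
    and freeQ: "free_module s UNIV"
    and leibD: "leibniz_conformal_algebra dual_scale (conformal_dual s UNIV) brd"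
begin

abbreviation D where "D \<equiv> conformal_dual s UNIV"

lemma leibQ: "leibniz_conformal_algebra s UNIV br"
  using finQ by (simp add: finite_leibniz_conformal_algebra_def)

sublocale Q: conformal_bracket_space s UNIV br
proof -
  interpret kd_space s
    using leibQ by (simp add: leibniz_conformal_algebra_def kd_module_iff)
  show "conformal_bracket_space s UNIV br"
    using leibQ by unfold_locales (simp add: leibniz_iff)
qed

sublocale D: conformal_bracket_space "dual_scale :: 'k poly \<Rightarrow> ('q \<Rightarrow> 'k poly) \<Rightarrow> _" D brd
proof -
  interpret kd_space "dual_scale :: 'k poly \<Rightarrow> ('q \<Rightarrow> 'k poly) \<Rightarrow> _" by (rule kd_space_dual)
  show "conformal_bracket_space (dual_scale :: 'k poly \<Rightarrow> ('q \<Rightarrow> 'k poly) \<Rightarrow> _) D brd"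
    using leibD by unfold_locales (simp add: leibniz_iff)
qed

lemma spQ: "kd_space s" by unfold_locales
lemma spD: "kd_space (dual_scale :: 'k poly \<Rightarrow> ('q \<Rightarrow> 'k poly) \<Rightarrow> _)" by unfold_locales
lemma subQ: "Q.subspace UNIV" by simp

lemma D_iff: "f \<in> D \<longleftrightarrow> (\<forall>u v. f (u + v) = f u + f v) \<and> (\<forall>p u. f (s p u) = p * f u)"
  by (simp add: conformal_dual_iff[OF spQ subQ])

lemma D_add: "f \<in> D \<Longrightarrow> f (u + v) = f u + f v" and D_scale: "f \<in> D \<Longrightarrow> f (s p u) = p * f u"
  by (simp_all add: D_iff)

lemma D_0: "f \<in> D \<Longrightarrow> f 0 = 0"
  using D_add[of f 0 0] by simp

lemma D_neg: "f \<in> D \<Longrightarrow> f (- u) = - f u"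
  using D_add[of f u "- u"] by (simp add: D_0 eq_neg_iff_add_eq_0 add.commute)

lemma D_diff: "f \<in> D \<Longrightarrow> f (u - v) = f u - f v"
  using D_add[of f u "- v"] by (simp add: D_neg)

lemma D_sum: "f \<in> D \<Longrightarrow> f (sum g A) = (\<Sum>i\<in>A. f (g i))"
  by (induction A rule: infinite_finite_induct) (simp_all add: D_0 D_add)

lemma fibreQ: "f \<in> D \<Longrightarrow> fibre s UNIV \<nu> (\<lambda>v. poly (f v) \<nu>)"
  by (simp add: fibre_def D_add D_scale)

lemma fibreD: "fibre dual_scale D (- \<nu>) (\<lambda>f. poly (f a) \<nu>)"
  by (simp add: fibre_def poly_dual_scale)

lemma fibreQ_peval: "f \<in> D \<Longrightarrow> poly (f (peval s p q)) \<nu> = poly (f (peval s p [:poly q \<nu>:])) \<nu>"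
  by (rule fibre_peval[OF spQ subQ fibreQ]) simp_all

lemma fibreD_peval:
  "p \<in> poly_over D \<Longrightarrow> poly ((peval dual_scale p q) a) \<nu> = poly ((peval dual_scale p [:poly q (- \<nu>):]) a) \<nu>"
  by (rule fibre_peval[OF spD D.subV fibreD])

text \<open>
  Finitely many generators are combinations of finitely many elements of a basis, and these
  already form a basis.
\<close>

lemma finite_basis: "\<exists>S. finite S \<and> Q.independent S \<and> Q.span S = UNIV"
proof -
  obtain S where S: "Q.independent S" "Q.span S = UNIV" using freeQ by (auto simp: free_module_def)
  obtain T where T: "finite T" "Q.span T = UNIV"
    using finQ by (auto simp: finite_leibniz_conformal_algebra_def finitely_generated_def)
  \<comment> \<open>The basis elements that occur in the generators.\<close>
  define S' where "S' = (\<Union>t\<in>T. {b. Q.representation S t b \<noteq> 0})"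
  have fin: "finite S'" using T(1) by (auto simp: S'_def Q.finite_representation)
  have sub: "S' \<subseteq> S" by (auto simp: S'_def dest: Q.representation_ne_zero)
  have "t \<in> Q.span S'" if "t \<in> T" for t
  proof -
    have "(\<Sum>b | Q.representation S t b \<noteq> 0. s (Q.representation S t b) b) = t"
      using S by (intro Q.sum_nonzero_representation_eq) auto
    moreover have "(\<Sum>b | Q.representation S t b \<noteq> 0. s (Q.representation S t b) b) \<in> Q.span S'"
      using that by (intro Q.span_sum Q.span_scale Q.span_base) (auto simp: S'_def)
    ultimately show ?thesis by simp
  qed
  then have "Q.span T \<subseteq> Q.span S'" by (intro Q.span_minimal) auto
  then show ?thesis using T(2) fin Q.independent_mono[OF S(1) sub] by blast
qed

definition basis where "basis = (SOME S. finite S \<and> Q.independent S \<and> Q.span S = UNIV)"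

lemma basis: "finite basis" "Q.independent basis" "Q.span basis = UNIV"
  using someI_ex[OF finite_basis] by (simp_all add: basis_def)

definition coord :: "'q \<Rightarrow> 'q \<Rightarrow> 'k poly" where
  "coord e v = Q.representation basis v e"

lemma coord_in: "coord e \<in> D"
  by (simp add: D_iff coord_def Q.representation_add Q.representation_scale basis)

lemma coord_sum: "(\<Sum>e\<in>basis. s (coord e v) e) = v"
  unfolding coord_def by (rule Q.sum_representation_eq) (use basis in auto)

lemma D_expand: "f \<in> D \<Longrightarrow> f v = (\<Sum>e\<in>basis. coord e v * f e)"
  using D_sum[of f "\<lambda>e. s (coord e v) e" basis] by (simp add: coord_sum D_scale)

lemma Q_sep:
  assumes "\<And>f. f \<in> D \<Longrightarrow> f v = 0"
  shows "v = 0"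
  using coord_sum[of v] assms[OF coord_in] by simp

lemma D_fun_expand: "f \<in> D \<Longrightarrow> f = (\<Sum>e\<in>basis. dual_scale (pcompose (f e) [:0, - 1:]) (coord e))"
  by (rule ext) (simp add: sum_fun_apply dual_scale_eq D_expand[of f] mult.commute flip: pcompose_assoc,
    simp add: pcompose_pCons)

text \<open>
  Here surjectivity is the description of the conformal dual as a module of linear maps.
\<close>

sublocale PD: perfect_pairing dual_scale s D UNIV pair_dual
proof
  show "\<exists>v\<in>D. \<forall>w\<in>UNIV. pair_dual v w = \<theta> w"
    if "\<And>w w'. w \<in> UNIV \<Longrightarrow> w' \<in> UNIV \<Longrightarrow> \<theta> (w + w') = \<theta> w + \<theta> w'"
      "\<And>p w. w \<in> UNIV \<Longrightarrow> \<theta> (s p w) = p * \<theta> w" for \<theta>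
    using that by (intro bexI[of _ \<theta>]) (auto simp: pair_dual_def D_iff)
  show "finitely_generated s UNIV"
    using finQ by (simp add: finite_leibniz_conformal_algebra_def)
qed (auto simp: pair_dual_def D_add D_scale dual_scale_eq D.subV)

text \<open>
  This is the reflexivity of a free module of finite rank, with \<open>basis\<close> and \<open>coord\<close> as dual
  bases.
\<close>

sublocale PQ: perfect_pairing s dual_scale UNIV D pair_bidual
proof
  show "v = 0" if "\<And>w. w \<in> D \<Longrightarrow> pair_bidual v w = 0" for v
  proof (rule Q_sep)
    fix f assume "f \<in> D"
    then have "pcompose (f v) [:0, - 1:] = 0" using that by (simp add: pair_bidual_def pair_dual_def)
    then have "poly (f v) (- x) = 0" for x by (metis poly_pcompose poly_0 mult_minus1_right
          add_0 poly_pCons mult_zero_right add_0_right)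
    then have "poly (f v) x = 0" for x by (metis minus_minus)
    then show "f v = 0" by (intro poly_ext) simp
  qed
  show "\<exists>v\<in>UNIV. \<forall>w\<in>D. pair_bidual v w = \<theta> w"
    if add: "\<And>w w'. w \<in> D \<Longrightarrow> w' \<in> D \<Longrightarrow> \<theta> (w + w') = \<theta> w + \<theta> w'"
      and scale: "\<And>p w. w \<in> D \<Longrightarrow> \<theta> (dual_scale p w) = p * \<theta> w" for \<theta>
  proof (intro bexI ballI)
    fix w assume w: "w \<in> D"
    \<comment> \<open>The sign and the substitution of \<open>- \<partial>\<close> undo those in the definition of the pairing of \<open>Q\<close> with its dual.\<close>
    let ?v = "\<Sum>e\<in>basis. s (- pcompose (\<theta> (coord e)) [:0, - 1:]) e"
    have "\<theta> (\<Sum>e\<in>basis. dual_scale (p e) (coord e)) = (\<Sum>e\<in>basis. \<theta> (dual_scale (p e) (coord e)))" for p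
      by (rule D.additive_sum[OF D.subV add]) (intro D.subspace_scale[OF D.subV] coord_in | assumption)+
    then have \<theta>_sum: "\<theta> (\<Sum>e\<in>basis. dual_scale (p e) (coord e)) = (\<Sum>e\<in>basis. p e * \<theta> (coord e))" for p
      by (simp only: scale[OF coord_in])
    have \<theta>w: "\<theta> w = (\<Sum>e\<in>basis. pcompose (w e) [:0, - 1:] * \<theta> (coord e))"
      by (subst D_fun_expand[OF w]) (rule \<theta>_sum)
    show "pair_bidual ?v w = \<theta> w"
      by (rule poly_ext)
        (simp add: \<theta>w pair_bidual_def pair_dual_def D_sum[OF w] D_neg[OF w] D_scale[OF w] poly_pcompose
          poly_sum sum_negf mult.commute)
  qed simp
  show "finitely_generated dual_scale D"
    unfolding finitely_generated_def
  proof (intro exI conjI)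
    show "finite (coord ` basis)" using basis(1) by simp
    show "D.span (coord ` basis) = D"
    proof
      show "D.span (coord ` basis) \<subseteq> D" by (intro D.span_minimal D.subV) (auto simp: coord_in)
      show "D \<subseteq> D.span (coord ` basis)"
      proof
        fix f assume f: "f \<in> D"
        show "f \<in> D.span (coord ` basis)"
          by (subst D_fun_expand[OF f]) (intro D.span_sum D.span_scale D.span_base imageI)
      qed
    qed
  qed
qed (auto simp: pair_bidual_def pair_dual_def D_add D_scale dual_scale_eq D.subV pcompose_add pcompose_mult
    simp flip: pcompose_assoc simp: pcompose_pCons)

abbreviation bQ where "bQ \<equiv> bval s br"
abbreviation bD where "bD \<equiv> bval dual_scale brd"

lemma pair_bidual_poly: "poly (pair_bidual u f) x = - poly (f u) (- x)"
  by (simp add: pair_bidual_def pair_dual_def poly_pcompose)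

lemma clL: "conformal_linear s UNIV s UNIV (Lop br a)" and clR: "conformal_linear s UNIV s UNIV (Rop s br a)"
  using Q.cend_hom_Lop Q.cend_hom_Rop by (simp_all add: cend_hom_def)

lemma dclL: "f \<in> D \<Longrightarrow> conformal_linear dual_scale D dual_scale D (Lop brd f)"
  and dclR: "f \<in> D \<Longrightarrow> conformal_linear dual_scale D dual_scale D (Rop dual_scale brd f)"
  using D.cend_hom_Lop D.cend_hom_Rop by (simp_all add: cend_hom_def)

lemma Lstar_over: "f \<in> D \<Longrightarrow> Lstar s br a f \<in> poly_over D"
  and Rstar_over: "f \<in> D \<Longrightarrow> Rstar s br a f \<in> poly_over D"
  unfolding Lstar_def Rstar_def by (intro PD.star_property(1) clL clR; assumption)+

text \<open>
  In the four formulas that follow the operator \<open>\<partial>\<close> in \<open>R\<close> has been replaced by the scalar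
  that it becomes under the pairing, so that only values of the two brackets are left.
\<close>

lemma Lstar_val:
  "f \<in> D \<Longrightarrow> poly ((peval dual_scale (Lstar s br a f) [:l:]) x) m = - poly (f (bQ l a x)) (m - l)"
  using PD.star_property(2)[OF clL, of f x a l m] by (simp add: Lstar_def pair_dual_def Lop_def bval_def)

lemma Rstar_val:
  "f \<in> D \<Longrightarrow> poly ((peval dual_scale (Rstar s br a f) [:l:]) x) m = - poly (f (bQ (- m) x a)) (m - l)"
  using PD.star_property(2)[OF clR, of f x a l m] fibreQ_peval[of f "br x a" "[:- l, - 1:]" "m - l"]
  by (simp add: Rstar_def pair_dual_def Q.peval_Rop bval_def)

lemma dual_Lstar_val:
  assumes "f \<in> D" "h \<in> D"
  shows "poly (h (peval s (dual_Lstar s brd f b) [:l:])) n = - poly (bD l f h b) (l + n)"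
proof -
  have "- poly (h (peval s (dual_Lstar s brd f b) [:l:])) n = poly (bD l f h b) (l + n)"
    using assms PQ.star_property(2)[OF dclL, of f b h l "- n"]
    by (simp add: dual_Lstar_def pair_bidual_poly Lop_def bval_def)
  then show ?thesis by (metis minus_minus)
qed

lemma dual_Rstar_val:
  assumes "f \<in> D" "h \<in> D"
  shows "poly (h (peval s (dual_Rstar s brd f b) [:l:])) n = - poly (bD n h f b) (l + n)"
proof -
  have "- poly (h (peval s (dual_Rstar s brd f b) [:l:])) n = poly (bD n h f b) (l + n)"
    using assms PQ.star_property(2)[OF dclR, of f b h l "- n"]
      fibreD_peval[OF D.br_over, of h f "[:- l, - 1:]" b "l + n"]
    by (simp add: dual_Rstar_def pair_bidual_poly D.peval_Rop bval_def)
  then show ?thesis by (metis minus_minus)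
qed

lemma cend_homs:
  "cend_hom s UNIV dual_scale D (Lstar s br)" "cend_hom s UNIV dual_scale D (Rstar s br)"
  "cend_hom dual_scale D s UNIV (dual_Lstar s brd)" (is ?A) "cend_hom dual_scale D s UNIV (dual_Rstar s brd)" (is ?B)
proof -
  have eqs: "Lstar s br = (\<lambda>c. star pair_dual D UNIV (Lop br c))" "Rstar s br = (\<lambda>c. star pair_dual D UNIV (Rop s br c))"
    "dual_Lstar s brd = (\<lambda>c. star pair_bidual UNIV D (Lop brd c))"
    "dual_Rstar s brd = (\<lambda>c. star pair_bidual UNIV D (Rop dual_scale brd c))"
    by (simp_all add: fun_eq_iff Lstar_def Rstar_def dual_Lstar_def dual_Rstar_def)
  show "cend_hom s UNIV dual_scale D (Lstar s br)" "cend_hom s UNIV dual_scale D (Rstar s br)"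
    unfolding eqs by (intro PD.cend_hom_star Q.cend_hom_Lop Q.cend_hom_Rop spQ subQ)+
  show ?A ?B
    unfolding eqs by (intro PQ.cend_hom_star D.cend_hom_Lop D.cend_hom_Rop spD D.subV)+
qed

sublocale MA: mutual_actions s UNIV br dual_scale D brd "Lstar s br" "- Lstar s br - Rstar s br"
  "dual_Lstar s brd" "- dual_Lstar s brd - dual_Rstar s brd"
  by unfold_locales (intro cend_homs cend_hom_neg_diff spQ subQ spD D.subV)+

abbreviation bE where "bE \<equiv> bval MA.sE MA.brE"
abbreviation E where "E \<equiv> (UNIV :: 'q set) \<times> D"

text \<open>
  This is \<open>B(w, [x, z])\<close> for the bracket on \<open>Q \<oplus> Q\<^sup>*\<^sup>c\<close>, when \<open>w\<close>, \<open>x\<close>, \<open>z\<close> carry the momenta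
  \<open>n\<close>, \<open>l\<close>, \<open>k = - l - n\<close>.  With \<open>A(h; a, b) = \<langle>h, [a, b]\<rangle>\<close> and \<open>C(f, g; c) = \<langle>[f, g], c\<rangle>\<close> it reads
  \<open>A(h; a, b) + A(g; a, c) - A(f; b, c) - A(f; c, b) - C(f, h; b) + C(g, h; a) + C(h, g; a) - C(f, g; c)\<close>,
  which is visibly symmetric in \<open>w\<close> and \<open>z\<close>.
\<close>

definition triple where
  "triple n w l x z = (let c = fst w; h = snd w; a = fst x; f = snd x; b = fst z; g = snd z; k = - l - n in
     poly (h (bQ l a b)) n + poly (g (bQ l a c)) k - poly (f (bQ k b c)) l - poly (f (bQ n c b)) l
     - poly (bD l f h b) (l + n) + poly (bD k g h a) (k + n) + poly (bD n h g a) (k + n) - poly (bD l f g c) (l + k))"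

lemma poly_standard_form: "poly (standard_form w v) n = poly (snd w (fst v)) n - poly (snd v (fst w)) (- n)"
  by (simp add: standard_form_def pair_dual_def poly_pcompose)

lemma gv_val:
  assumes "g \<in> D" "h \<in> D"
  shows "poly (h (MA.gv l g a)) n = poly (bD (- l - n) g h a) (- l) + poly (bD n h g a) (- l)"
  using assms fibreQ_peval[of h "(- dual_Lstar s brd - dual_Rstar s brd) g a" "[:- l, - 1:]" n]
  by (simp add: D_diff D_neg dual_Lstar_val dual_Rstar_val)

lemma rv_val:
  assumes "f \<in> D"
  shows "poly (MA.rv l b f c) n = poly (f (bQ (n - l) b c)) l + poly (f (bQ (- n) c b)) l"
proof -
  have "(- Lstar s br - Rstar s br) b f \<in> poly_over D"
    using cend_hom_neg_diff[OF cend_homs(1,2) spQ subQ spD D.subV] assms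
    by (simp add: cend_hom_def conformal_linear_def)
  from fibreD_peval[OF this, of "[:- l, - 1:]" c n] show ?thesis
    using assms by (simp add: Lstar_val Rstar_val)
qed

text \<open>
  The adjoint actions were chosen so that all eight terms are values of the two given
  brackets.
\<close>

lemma triple_bE:
  assumes "w \<in> E" "x \<in> E" "z \<in> E"
  shows "poly (standard_form w (bE l x z)) n = triple n w l x z"
  using assms
  by (auto simp: triple_def Let_def MA.bvalE poly_standard_form D_add gv_val rv_val dual_Lstar_val Lstar_val
      algebra_simps minus_diff_commute simp del: minus_apply uminus_apply)

end

section \<open>The standard form and Manin triples\<close>

lemma leibniz_subalgebra:
  assumes "leibniz_conformal_algebra s V br" "U \<subseteq> V" "module.subspace s U"
    and "\<And>a b. a \<in> U \<Longrightarrow> b \<in> U \<Longrightarrow> br a b \<in> poly_over U"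
  shows "leibniz_conformal_algebra s U br"
  using assms unfolding leibniz_conformal_algebra_def kd_module_def by blast

lemma finitely_generated_prod:
  assumes "kd_space s" "kd_space s'" "finitely_generated s U" "finitely_generated s' V"
  shows "finitely_generated (prod_scale s s') (U \<times> V)"
proof -
  interpret S: kd_space s by fact
  interpret S': kd_space s' by fact
  interpret P: kd_space "prod_scale s s'" by (rule kd_space_prod) fact+
  obtain A where A: "finite A" "S.span A = U" using assms(3) by (auto simp: finitely_generated_def)
  obtain B where B: "finite B" "S'.span B = V" using assms(4) by (auto simp: finitely_generated_def)
  interpret L: module_hom s "prod_scale s s'" "\<lambda>x. (x, 0)"
    by unfold_locales (simp_all add: prod_scale_def)
  interpret R: module_hom s' "prod_scale s s'" "\<lambda>y. (0, y)"
    by unfold_locales (simp_all add: prod_scale_def)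
  have "P.span ((\<lambda>x. (x, 0)) ` A \<union> (\<lambda>y. (0, y)) ` B) = U \<times> V"
    unfolding P.span_Un L.span_image R.span_image A(2) B(2) by force
  then show ?thesis
    unfolding finitely_generated_def using A(1) B(1) by (intro exI conjI) auto
qed

lemma finitely_generated_0: "kd_space s \<Longrightarrow> finitely_generated s {0}"
  unfolding finitely_generated_def using module.span_empty[of s] by (auto simp: kd_space_def intro!: exI[of _ "{}"])

context dual_leibniz
begin

abbreviation form where "form n w v \<equiv> poly (standard_form w v) n"

lemma in_E: "(a, 0) \<in> E" "f \<in> D \<Longrightarrow> (0, f) \<in> E" "(a, f) \<in> E \<longleftrightarrow> f \<in> D" "w \<in> E \<longleftrightarrow> snd w \<in> D"
  using D.subspace_0[OF D.subV] by (auto simp: mem_Times_iff)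

lemma form_skew: "form n v w = - form (- n) w v"
  by (simp add: poly_standard_form)

lemma form_add:
  "u \<in> E \<Longrightarrow> v \<in> E \<Longrightarrow> w \<in> E \<Longrightarrow> form n (u + v) w = form n u w + form n v w"
  "u \<in> E \<Longrightarrow> v \<in> E \<Longrightarrow> w \<in> E \<Longrightarrow> form n u (v + w) = form n u v + form n u w"
  by (auto simp: poly_standard_form D_add)

lemma form_scale:
  "u \<in> E \<Longrightarrow> v \<in> E \<Longrightarrow> form n (MA.sE p u) v = poly p (- n) * form n u v"
  "u \<in> E \<Longrightarrow> v \<in> E \<Longrightarrow> form n u (MA.sE p v) = poly p n * form n u v"
  by (auto simp: poly_standard_form prod_scale_def D_scale poly_dual_scale algebra_simps)

lemma form_diff: "u \<in> E \<Longrightarrow> v \<in> E \<Longrightarrow> w \<in> E \<Longrightarrow> form n u (v - w) = form n u v - form n u w"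
  by (auto simp: poly_standard_form D_diff)

lemma form_isotropic: "form n (a, 0) (b, 0) = 0" "f \<in> D \<Longrightarrow> g \<in> D \<Longrightarrow> form n (0, f) (0, g) = 0"
  by (simp_all add: poly_standard_form D_0)

lemma form_nondegenerate:
  assumes v: "v \<in> E" and 0: "\<And>w n. w \<in> E \<Longrightarrow> form n w v = 0"
  shows "v = 0"
proof -
  obtain a f where af: "v = (a, f)" "f \<in> D" using v by auto
  have "a = 0"
    by (rule Q_sep, rule poly_ext) (use 0[OF in_E(2)] af in \<open>simp add: poly_standard_form D_0\<close>)
  moreover have "f x = 0" for x
    by (rule poly_ext) (use 0[OF in_E(1)[of x], of "- _"] af in \<open>simp add: poly_standard_form\<close>)
  ultimately show ?thesis using af(1) by (simp add: zero_prod_def fun_eq_iff)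
qed

lemma form_eqI:
  assumes "u \<in> E" "v \<in> E" "\<And>w n. w \<in> E \<Longrightarrow> form n w u = form n w v"
  shows "u = v"
proof -
  have "u - v = 0"
    by (rule form_nondegenerate) (use assms in \<open>simp_all add: MA.E.subspace_diff[OF MA.subE] form_diff\<close>)
  then show ?thesis by simp
qed

lemma standard_bilinear: "conformal_bilinear_form MA.sE E standard_form"
  unfolding conformal_bilinear_form_def
  by (intro conjI ballI allI poly_ext) (simp_all add: form_add form_scale lam1_def del: mem_Sigma_iff)

lemma standard_skew: "skew_symmetric_form E standard_form"
  unfolding skew_symmetric_form_def
proof (intro ballI poly_ext)
  fix u v :: "'q \<times> ('q \<Rightarrow> 'k poly)" and x
  show "form x u v = poly (- pcompose (standard_form v u) [:0, - 1:]) x"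
    by (simp add: poly_pcompose form_skew[where v = u and w = v])
qed

text \<open>
  A conformal functional on \<open>Q \<oplus> Q\<^sup>*\<^sup>c\<close> restricts to an element of \<open>Q\<^sup>*\<^sup>c\<close> and to a
  functional on \<open>Q\<^sup>*\<^sup>c\<close>, which comes from \<open>Q\<close> by reflexivity.
\<close>

lemma standard_nondegenerate: "nondegenerate_form MA.sE E standard_form"
proof -
  define \<Phi> where "\<Phi> v w = (if w \<in> E then standard_form v w else 0)" for v w
  note dual_iff = conformal_dual_iff[OF MA.spaceE MA.subE]
  have \<Phi>_in: "\<Phi> v \<in> conformal_dual MA.sE E" if "v \<in> E" for v
    using that unfolding dual_iff
    by (intro conjI ballI allI impI poly_ext)
      (simp_all add: \<Phi>_def MA.E.subspace_add[OF MA.subE] MA.E.subspace_scale[OF MA.subE] form_add form_scale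
        del: mem_Sigma_iff)
  have hom: "kd_hom MA.sE E dual_scale (conformal_dual MA.sE E) \<Phi>"
    unfolding kd_hom_def
    by (intro conjI ballI allI ext poly_ext)
      (simp_all add: \<Phi>_in \<Phi>_def form_add form_scale poly_dual_scale del: mem_Sigma_iff)
  have inj: "inj_on \<Phi> E"
  proof (rule inj_onI)
    fix u v assume uv: "u \<in> E" "v \<in> E" "\<Phi> u = \<Phi> v"
    show "u = v"
    proof (rule form_eqI[OF uv(1,2)])
      fix w n assume "w \<in> E"
      then have "standard_form u w = standard_form v w"
        using fun_cong[OF uv(3), of w] by (simp add: \<Phi>_def)
      then show "form n w u = form n w v" by (simp add: form_skew[where v = w])
    qed
  qed
  have surj: "\<exists>v\<in>E. \<Phi> v = F" if F: "F \<in> conformal_dual MA.sE E" for F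
  proof -
    note F' = F[unfolded dual_iff]
    have h: "(\<lambda>a. F (a, 0)) \<in> D"
      unfolding D_iff
    proof (intro conjI allI)
      fix a b p
      have "F ((a, 0) + (b, 0)) = F (a, 0) + F (b, 0)" using F' in_E(1) by blast
      then show "F (a + b, 0) = F (a, 0) + F (b, 0)" by simp
      have "F (MA.sE p (a, 0)) = p * F (a, 0)" using F' in_E(1) by blast
      then show "F (s p a, 0) = p * F (a, 0)" by (simp add: prod_scale_def)
    qed
    have "\<exists>c\<in>UNIV. \<forall>g\<in>D. pair_bidual c g = F (0, g)"
    proof (rule PQ.pr_surj)
      fix f g p assume f: "f \<in> D"
      have "F (MA.sE p (0, f)) = p * F (0, f)" using F' in_E(2)[OF f] by blast
      then show "F (0, dual_scale p f) = p * F (0, f)" by (simp add: prod_scale_def)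
      assume g: "g \<in> D"
      have "F ((0, f) + (0, g)) = F (0, f) + F (0, g)" using F' in_E(2)[OF f] in_E(2)[OF g] by blast
      then show "F (0, f + g) = F (0, f) + F (0, g)" by (simp add: plus_fun_def)
    qed
    then obtain c where c: "\<And>g. g \<in> D \<Longrightarrow> pair_bidual c g = F (0, g)" by blast
    have "\<Phi> (c, \<lambda>a. F (a, 0)) w = F w" for w
    proof (cases "w \<in> E")
      case True
      then obtain a g where w: "w = (a, g)" "g \<in> D" by auto
      have "F w = F (a, 0) + F (0, g)"
        using F' in_E(1)[of a] in_E(2)[OF w(2)] w by (metis add_Pair add_0 add.right_neutral)
      also have "F (0, g) = pair_bidual c g" by (simp add: c w(2))
      finally show ?thesis
        using w by (simp add: \<Phi>_def standard_form_def pair_dual_def pair_bidual_def flip: zero_fun_def)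
    next
      case False
      have "F w = 0" using F' False by blast
      then show ?thesis by (simp only: \<Phi>_def False if_False)
    qed
    moreover have "(c, \<lambda>a. F (a, 0)) \<in> E" using h by simp
    ultimately show ?thesis by blast
  qed
  have "bij_betw \<Phi> E (conformal_dual MA.sE E)"
    unfolding bij_betw_def using inj surj \<Phi>_in by blast
  with hom show ?thesis
    unfolding nondegenerate_form_def Let_def \<Phi>_def by blast
qed

end

locale bracket_on_double = dual_leibniz s br brd
  for s :: "'k::field_char_0 poly \<Rightarrow> 'q::ab_group_add \<Rightarrow> 'q" and br and brd +
  fixes brX :: "'q \<times> ('q \<Rightarrow> 'k poly) \<Rightarrow> 'q \<times> ('q \<Rightarrow> 'k poly) \<Rightarrow> ('q \<times> ('q \<Rightarrow> 'k poly)) poly"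
  assumes bracketX: "conformal_bracket MA.sE E brX"
begin

sublocale X: conformal_bracket_space MA.sE E brX
  by unfold_locales (rule bracketX)

definition tri_form where "tri_form n w l x z = form n w (bval MA.sE brX l x z)"

lemma tri_form_add:
  assumes "w \<in> E" "x \<in> E" "z \<in> E" "u \<in> E"
  shows "tri_form n (w + u) l x z = tri_form n w l x z + tri_form n u l x z"
    "tri_form n w l (x + u) z = tri_form n w l x z + tri_form n w l u z"
    "tri_form n w l x (z + u) = tri_form n w l x z + tri_form n w l x u"
  using assms by (simp_all add: tri_form_def X.bval_addL X.bval_addR form_add X.bval_in del: mem_Sigma_iff)

text \<open>
  In \<open>[c\<^sub>-\<^sub>\<mu>\<^sub>-\<^sub>\<partial> a]\<close>, paired at \<open>- \<lambda>\<close>, the operator \<open>\<partial>\<close> becomes \<open>\<lambda>\<close>. Invariance is then a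
  cyclic rule for the trilinear form, with the momenta \<open>m\<close>, \<open>l\<close>, \<open>- m - l\<close> attached to \<open>a\<close>,
  \<open>b\<close>, \<open>c\<close>.
\<close>

lemma invariant_iff:
  "invariant_form MA.sE E brX standard_form \<longleftrightarrow>
    (\<forall>a\<in>E. \<forall>b\<in>E. \<forall>c\<in>E. \<forall>l m. tri_form m a l b c = - tri_form l b m a c - tri_form l b (- m - l) c a)"
proof -
  have lin: "linear_on MA.sE E triv_scale (standard_form a)" "linear_on MA.sE E triv_scale (\<lambda>x. standard_form x a)"
    if "a \<in> E" for a
    using that unfolding linear_on_def
    by (intro conjI ballI allI poly_ext; simp add: form_add form_scale del: mem_Sigma_iff)+
  have over: "subst mu p + subst (- mu - del MA.sE) q \<in> poly_over (poly_over E)"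
    if "p \<in> poly_over E" "q \<in> poly_over E" for p q
    using MA.E.subst_overs[OF MA.subE that(1)] MA.E.subst_overs[OF MA.subE that(2)]
    by (simp add: poly_over_def MA.E.subspace_add[OF MA.subE] del: mem_Sigma_iff)
  have fib: "fibre MA.sE E (- \<nu>) (\<lambda>u. form \<nu> u b)" if "b \<in> E" for b \<nu>
    using that by (simp add: fibre_def form_add form_scale del: mem_Sigma_iff)
  have "app (standard_form a) mu (subst lam (brX b c)) =
        app (\<lambda>x. standard_form x b) (- lam) (subst mu (brX a c) + subst (- mu - del MA.sE) (brX c a)) \<longleftrightarrow>
      (\<forall>l m. tri_form m a l b c = - tri_form l b m a c - tri_form l b (- m - l) c a)"
    if abc: "a \<in> E" "b \<in> E" "c \<in> E" for a b c
  proof -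
    have 1: "peval2 triv_scale (app (standard_form a) mu (subst lam (brX b c))) l m = tri_form m a l b c" for l m
      using abc by (simp add: tri_form_def bval_def X.br_over MA.E.subst_overs[OF MA.subE] MA.E.peval2_substs
          peval2_app[OF MA.spaceE kd_space_triv MA.subE lin(1) _ K.acts_mu] del: mem_Sigma_iff)
    have 2: "peval2 triv_scale (app (\<lambda>x. standard_form x b) (- lam) (subst mu (brX a c) + subst (- mu - del MA.sE) (brX c a))) l m
        = - tri_form l b m a c - tri_form l b (- m - l) c a" for l m
    proof -
      have "peval2 triv_scale (app (\<lambda>x. standard_form x b) (- lam) (subst mu (brX a c) + subst (- mu - del MA.sE) (brX c a))) l m
        = form (- l) (bval MA.sE brX m a c) b + form (- l) (peval MA.sE (brX c a) [:- m, - 1:]) b"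
        using abc by (simp add: bval_def X.br_over over MA.E.peval2_substs form_add MA.E.peval_in[OF MA.subE]
            peval2_app[OF MA.spaceE kd_space_triv MA.subE lin(2) _ K.acts_neg_lam] del: mem_Sigma_iff)
      also have "form (- l) (peval MA.sE (brX c a) [:- m, - 1:]) b = form (- l) (bval MA.sE brX (- m - l) c a) b"
        using fibre_peval[OF MA.spaceE MA.subE fib[OF abc(2), of "- l"] X.br_over[OF abc(3,1)], of "[:- m, - 1:]"]
        by (simp add: bval_def)
      finally show ?thesis
        by (simp only: tri_form_def form_skew[where n = "- l"] minus_minus add_uminus_conv_diff)
    qed
    show ?thesis by (simp add: K.poly_poly_eq_iff 1 2)
  qed
  then show ?thesis unfolding invariant_form_def by blast
qed

end

context dual_leibniz
begin

lemma bracket_on_double_brE: "bracket_on_double s br brd MA.brE"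
  by unfold_locales (rule MA.bracketE)

lemma invariant_brE: "invariant_form MA.sE E MA.brE standard_form"
proof -
  interpret B: bracket_on_double s br brd MA.brE by (rule bracket_on_double_brE)
  have *: "triple m a l b c = - triple l b m a c - triple l b (- m - l) c a" for a b c l m
    by (simp add: triple_def Let_def minus_diff_commute add.commute)
  show ?thesis
    unfolding B.invariant_iff
  proof (intro ballI allI)
    fix a b c l m assume "a \<in> E" "b \<in> E" "c \<in> E"
    then show "B.tri_form m a l b c = - B.tri_form l b m a c - B.tri_form l b (- m - l) c a"
      unfolding B.tri_form_def by (simp only: triple_bE) (rule *)
  qed
qed

lemma brE_embed:
  "MA.brE (a, 0) (b, 0) = map_poly (\<lambda>x. (x, 0)) (br a b)" (is ?A)
  "f \<in> D \<Longrightarrow> g \<in> D \<Longrightarrow> MA.brE (0, f) (0, g) = map_poly (\<lambda>h. (0, h)) (brd f g)" (is "PROP ?B")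
proof -
  show ?A
    by (rule MA.E.poly_eqI_peval)
      (use MA.bvalE_pure2(1)[of a 0 b 0] MA.zero_in in \<open>simp add: bval_def peval_embed[OF spQ spD]\<close>)
  show "PROP ?B"
    by (rule MA.E.poly_eqI_peval)
      (use MA.bvalE_pure2(4)[of 0 f 0 g] in \<open>simp add: bval_def peval_embed[OF spQ spD]\<close>)
qed

end

locale invariant_extension = bracket_on_double s br brd brX
  for s :: "'k::field_char_0 poly \<Rightarrow> 'q::ab_group_add \<Rightarrow> 'q" and br and brd and brX +
  assumes inv: "invariant_form MA.sE E brX standard_form"
    and extQ: "brX (a, 0) (b, 0) = map_poly (\<lambda>x. (x, 0)) (br a b)"
    and extD: "f \<in> D \<Longrightarrow> g \<in> D \<Longrightarrow> brX (0, f) (0, g) = map_poly (\<lambda>h. (0, h)) (brd f g)"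
begin

lemma tri_form_cyclic: "a \<in> E \<Longrightarrow> b \<in> E \<Longrightarrow> c \<in> E \<Longrightarrow> tri_form m a l b c = - tri_form l b m a c - tri_form l b (- m - l) c a"
  using inv[unfolded invariant_iff] by blast

text \<open>Both sides have the same expansion under the cyclic rule.\<close>

lemma tri_form_sym: "a \<in> E \<Longrightarrow> b \<in> E \<Longrightarrow> c \<in> E \<Longrightarrow> tri_form m a l b c = tri_form (- m - l) c l b a"
  using tri_form_cyclic[of a b c m l] tri_form_cyclic[of c b a "- m - l" l] by (simp del: mem_Sigma_iff)

lemma tri_form_same:
  "tri_form n (0, h) l (a, 0) (b, 0) = form n (0, h) (bQ l a b, 0)"
  "tri_form n (c, 0) l (a, 0) (b, 0) = 0"
  "f \<in> D \<Longrightarrow> g \<in> D \<Longrightarrow> tri_form n (c, 0) l (0, f) (0, g) = form n (c, 0) (0, bD l f g)"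
  "h \<in> D \<Longrightarrow> f \<in> D \<Longrightarrow> g \<in> D \<Longrightarrow> tri_form n (0, h) l (0, f) (0, g) = 0"
  using D.bval_in
  by (simp_all add: tri_form_def bval_def extQ extD peval_embed[OF spQ spD] form_isotropic)

text \<open>
  The cyclic rule and the symmetry move a lone element of one summand into the slot outside
  the bracket, where the value is that of a given bracket.
\<close>

lemma tri_form_mixed:
  assumes "f \<in> D" "g \<in> D"
  shows "tri_form n (c, 0) l (a, 0) (0, g) = form (- n - l) (0, g) (bQ l a c, 0)" (is ?A)
    "tri_form n (c, 0) l (0, f) (b, 0) = - form l (0, f) (bQ n c b, 0) - form l (0, f) (bQ (- n - l) b c, 0)" (is ?B)
    "tri_form n (0, f) l (a, 0) (0, g) = - form l (a, 0) (0, bD n f g) - form l (a, 0) (0, bD (- n - l) g f)" (is ?C)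
    "tri_form n (0, g) l (0, f) (b, 0) = form (- n - l) (b, 0) (0, bD l f g)" (is ?D)
proof -
  show ?A
    using tri_form_sym[of "(c, 0)" "(a, 0)" "(0, g)" n l] assms by (simp add: in_E(1,2) tri_form_same del: mem_Sigma_iff)
  show ?B
    using tri_form_cyclic[of "(c, 0)" "(0, f)" "(b, 0)" n l] assms by (simp add: in_E(1,2) tri_form_same del: mem_Sigma_iff)
  show ?C
    using tri_form_cyclic[of "(0, f)" "(a, 0)" "(0, g)" n l] assms by (simp add: in_E(1,2) tri_form_same del: mem_Sigma_iff)
  show ?D
    using tri_form_sym[of "(0, g)" "(0, f)" "(b, 0)" n l] assms by (simp add: in_E(1,2) tri_form_same del: mem_Sigma_iff)
qed

end

context dual_leibniz
begin

lemma invariant_extension_brE: "invariant_extension s br brd MA.brE"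
  by (intro invariant_extension.intro invariant_extension_axioms.intro bracket_on_double_brE
      invariant_brE brE_embed)

text \<open>
  The form is nondegenerate, and the trilinear form of an invariant bracket is determined by
  the brackets on the two isotropic summands.
\<close>

lemma invariant_extension_unique:
  assumes "invariant_extension s br brd brX" "x \<in> E" "z \<in> E"
  shows "brX x z = MA.brE x z"
proof (rule MA.E.poly_eqI_peval)
  fix l
  interpret X: invariant_extension s br brd brX by fact
  interpret Y: invariant_extension s br brd MA.brE by (rule invariant_extension_brE)
  have "X.tri_form n w l x z = Y.tri_form n w l x z" if "w \<in> E" for w n
  proof -
    have split: "v = (fst v, 0) + (0, snd v)" for v :: "'q \<times> ('q \<Rightarrow> 'k poly)"
      by (cases v) simp
    from that assms(2,3) obtain c h a f b g where *: "w = (c, 0) + (0, h)" "x = (a, 0) + (0, f)" "z = (b, 0) + (0, g)"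
      and D: "h \<in> D" "f \<in> D" "g \<in> D"
      using split[of w] split[of x] split[of z] unfolding in_E(4) by blast
    have "(c, 0) + (0, h) \<in> E" "(a, 0) + (0, f) \<in> E" "(b, 0) + (0, g) \<in> E"
      using D by (simp_all add: in_E)
    then show ?thesis
      unfolding * using D
      by (simp add: X.tri_form_add Y.tri_form_add in_E(1,2) X.tri_form_same Y.tri_form_same X.tri_form_mixed Y.tri_form_mixed
          del: add_Pair mem_Sigma_iff)
  qed
  then have "bval MA.sE brX l x z = bval MA.sE MA.brE l x z"
    using assms(2,3) X.X.bval_in MA.CE.bval_in
    by (intro form_eqI) (simp_all add: X.tri_form_def Y.tri_form_def del: mem_Sigma_iff)
  then show "peval MA.sE (brX x z) [:l:] = peval MA.sE (MA.brE x z) [:l:]" by (simp add: bval_def)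
qed

text \<open>
  A Manin triple supplies an invariant extension of the two brackets, which is unique;
  conversely all properties of the standard form hold without any condition, and only the
  Jacobi identity of the bracket on the sum remains.
\<close>

theorem manin_triple_iff_leibniz:
  "(\<exists>brX. conformal_manin_triple MA.sE E brX (UNIV \<times> {0}) ({0} \<times> D) standard_form \<and>
      (\<forall>a b. brX (a, 0) (b, 0) = map_poly (\<lambda>x. (x, 0)) (br a b)) \<and>
      (\<forall>f\<in>D. \<forall>g\<in>D. brX (0, f) (0, g) = map_poly (\<lambda>h. (0, h)) (brd f g)))
   \<longleftrightarrow> leibniz_conformal_algebra MA.sE E MA.brE"
  (is "?M \<longleftrightarrow> ?L")
proof
  assume ?M
  then obtain brX where X: "conformal_manin_triple MA.sE E brX (UNIV \<times> {0}) ({0} \<times> D) standard_form"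
    "\<forall>a b. brX (a, 0) (b, 0) = map_poly (\<lambda>x. (x, 0)) (br a b)"
    "\<forall>f\<in>D. \<forall>g\<in>D. brX (0, f) (0, g) = map_poly (\<lambda>h. (0, h)) (brd f g)" by blast
  have L: "leibniz_conformal_algebra MA.sE E brX"
    using X(1) unfolding conformal_manin_triple_def finite_leibniz_conformal_algebra_def by blast
  interpret Y: bracket_on_double s br brd brX
    by unfold_locales (use L in \<open>simp add: leibniz_iff\<close>)
  interpret X: invariant_extension s br brd brX
    by unfold_locales (use X in \<open>auto simp: conformal_manin_triple_def\<close>)
  have eq: "bval MA.sE brX l x z = bE l x z" if "x \<in> E" "z \<in> E" for l x z
    using invariant_extension_unique[OF X.invariant_extension_axioms that] by (simp add: bval_def)
  show ?L
    unfolding leibniz_iff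
  proof (intro conjI MA.bracketE ballI allI)
    fix a b c l m assume abc: "a \<in> E" "b \<in> E" "c \<in> E"
    have "Y.X.jac l m a b c = 0" using L[unfolded leibniz_iff] abc by blast
    then show "MA.CE.jac l m a b c = 0"
      using abc MA.CE.bval_in by (simp add: Y.X.jac_def MA.CE.jac_def eq del: mem_Sigma_iff)
  qed
next
  assume L: ?L
  have fgQ: "finitely_generated s UNIV" and fgD: "finitely_generated dual_scale D"
    using PD.W_fg PQ.W_fg .
  have subs: "MA.E.subspace (UNIV \<times> {0})" "MA.E.subspace ({0} \<times> D)"
    by (rule subspace_prod[OF spQ spD]; simp add: D.subV)+
  have "MA.brE x y \<in> poly_over (UNIV \<times> {0})" if "x \<in> UNIV \<times> {0}" "y \<in> UNIV \<times> {0}" for x y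
    using that by (auto simp: brE_embed zero_prod_def intro!: poly_over_map[of _ UNIV])
  then have L0: "leibniz_conformal_algebra MA.sE (UNIV \<times> {0}) MA.brE"
    by (intro leibniz_subalgebra[OF L] subs) (auto simp: D.subspace_0[OF D.subV])
  have "MA.brE x y \<in> poly_over ({0} \<times> D)" if "x \<in> {0} \<times> D" "y \<in> {0} \<times> D" for x y
    using that by (auto simp: brE_embed zero_prod_def D.br_over intro!: poly_over_map[of _ D])
  then have L1: "leibniz_conformal_algebra MA.sE ({0} \<times> D) MA.brE"
    by (intro leibniz_subalgebra[OF L] subs) (auto simp: in_E)
  have "E = {x + y |x y. x \<in> UNIV \<times> {0} \<and> y \<in> {0} \<times> D}"
  proof -
    have "(a, f) \<in> {x + y |x y. x \<in> UNIV \<times> {0} \<and> y \<in> {0} \<times> D}" if "f \<in> D" for a :: 'q and f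
      by (rule CollectI, rule exI[of _ "(a, 0)"], rule exI[of _ "(0, f)"]) (use that in simp)
    then show ?thesis by auto
  qed
  then have "conformal_manin_triple MA.sE E MA.brE (UNIV \<times> {0}) ({0} \<times> D) standard_form"
    unfolding conformal_manin_triple_def finite_leibniz_conformal_algebra_def
    using L L0 L1 standard_bilinear standard_skew standard_nondegenerate invariant_brE
      finitely_generated_prod[OF spQ spD fgQ fgD]
      finitely_generated_prod[OF spQ spD fgQ finitely_generated_0[OF spD]]
      finitely_generated_prod[OF spQ spD finitely_generated_0[OF spQ] fgD] in_E
    by (auto simp: zero_prod_def form_isotropic in_E intro!: poly_ext)
  then show ?M
    using brE_embed by blast
qed

end

section \<open>The four-point function of the Jacobi identity\<close>

context dual_leibniz
begin

lemma bE_in: "x \<in> E \<Longrightarrow> y \<in> E \<Longrightarrow> bE l x y \<in> E"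
  by (rule MA.CE.bval_in)

lemma form_bE_cyclic:
  assumes "a \<in> E" "b \<in> E" "c \<in> E" "l + m + k = 0"
  shows "form m a (bE l b c) = - form l b (bE m a c) - form l b (bE k c a)"
proof -
  interpret X: invariant_extension s br brd MA.brE by (rule invariant_extension_brE)
  have "k = - m - l" using assms(4) by (simp add: eq_neg_iff_add_eq_0 algebra_simps)
  then show ?thesis using X.tri_form_cyclic[OF assms(1-3)] by (simp add: X.tri_form_def)
qed

lemma form_0: "w \<in> E \<Longrightarrow> form n w 0 = 0"
  by (simp add: poly_standard_form D_0 mem_Times_iff)

lemma neg_momentum: "l + m + n + k = 0 \<Longrightarrow> - (l + m) = n + k" for l :: 'k
  by (rule minus_unique) (simp add: add.assoc)

lemma form_bE_sym:
  assumes "a \<in> E" "b \<in> E" "c \<in> E" "l + m + k = 0"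
  shows "form m a (bE l b c) = form k c (bE l b a)"
proof -
  have "l + k + m = 0" using assms(4) by (simp add: algebra_simps)
  then show ?thesis
    unfolding form_bE_cyclic[OF assms] form_bE_cyclic[OF assms(3,2,1) \<open>l + k + m = 0\<close>]
    by (metis minus_diff_commute)
qed

text \<open>The arguments come with their momenta, which are understood to add up to zero.\<close>

definition pair_form where "pair_form x l y m z k w = form (l + m) (bE l x y) (bE k z w)"

definition jac_form where "jac_form x l y m w n z = form n w (MA.CE.jac l m x y z)"

lemma pair_form_antisym: "l + m + n + k = 0 \<Longrightarrow> pair_form x l y m z k w = - pair_form z k w n x l y"
  unfolding pair_form_def by (subst form_skew) (simp only: neg_momentum add.commute[of n k])

text \<open>
  Invariance moves the outer bracket of each term of the Jacobi identity to the other side of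
  the form.
\<close>

lemma jac_form_expand:
  assumes E: "x \<in> E" "y \<in> E" "w \<in> E" "z \<in> E" and k: "l + m + n + k = 0"
  shows "jac_form x l y m w n z = - pair_form x l w n y m z + pair_form x l y m w n z + pair_form x l y m z k w + pair_form y m w n x l z"
proof -
  note in' = E bE_in
  have 1: "form n w (bE l x (bE m y z)) = - pair_form x l w n y m z"
  proof -
    have "form n w (bE l x (bE m y z)) = form (m + k) (bE m y z) (bE l x w)"
      by (rule form_bE_sym) (use E k in \<open>simp_all add: bE_in algebra_simps del: mem_Sigma_iff\<close>)
    also have "\<dots> = - form (l + n) (bE l x w) (bE m y z)"
      using neg_momentum[of m k l n] k by (subst form_skew) (simp add: algebra_simps)
    finally show ?thesis by (simp add: pair_form_def)
  qed
  have 2: "form n w (bE m y (bE l x z)) = - pair_form y m w n x l z"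
  proof -
    have "form n w (bE m y (bE l x z)) = form (l + k) (bE l x z) (bE m y w)"
      by (rule form_bE_sym) (use E k in \<open>simp_all add: bE_in algebra_simps del: mem_Sigma_iff\<close>)
    also have "\<dots> = - form (m + n) (bE m y w) (bE l x z)"
      using neg_momentum[of l k m n] k by (subst form_skew) (simp add: algebra_simps)
    finally show ?thesis by (simp add: pair_form_def)
  qed
  have 3: "form n w (bE (l + m) (bE l x y) z) = - pair_form x l y m w n z - pair_form x l y m z k w"
    unfolding pair_form_def
    by (rule form_bE_cyclic) (use E k in \<open>simp_all add: bE_in algebra_simps del: mem_Sigma_iff\<close>)
  have "jac_form x l y m w n z = form n w (bE l x (bE m y z)) - form n w (bE (l + m) (bE l x y) z) - form n w (bE m y (bE l x z))"
    using E by (simp add: jac_form_def MA.CE.jac_def form_diff bE_in MA.E.subspace_diff[OF MA.subE] del: mem_Sigma_iff)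
  then show ?thesis by (simp add: 1 2 3)
qed

lemma jac_form_sym:
  assumes E: "x \<in> E" "y \<in> E" "w \<in> E" "z \<in> E" and k: "l + m + n + k = 0"
  shows "jac_form x l y m w n z = jac_form x l y m z k w"
proof -
  have k': "l + m + k + n = 0" "l + n + k + m = 0" "m + n + k + l = 0" "l + n + m + k = 0" "m + n + l + k = 0"
    using k by (simp_all add: algebra_simps)
  show ?thesis
    using jac_form_expand[OF E k] jac_form_expand[OF E(1,2,4,3) k'(1)]
      pair_form_antisym[of l n k m x w y z] pair_form_antisym[of m n k l y w x z] k' by simp
qed

text \<open>After expansion the pairings of brackets cancel by antisymmetry.\<close>

lemma jac_form_cyclic:
  assumes E: "x \<in> E" "y \<in> E" "w \<in> E" "z \<in> E" and k: "l + m + n + k = 0"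
  shows "jac_form x l y m w n z = - jac_form x l w n y m z - jac_form x l z k y m w"
proof -
  have k': "l + n + m + k = 0" "l + k + m + n = 0"
    using k by (simp_all add: algebra_simps)
  have k'': "m + n + k + l = 0" "k + m + n + l = 0" "n + m + k + l = 0"
    using k by (simp_all add: algebra_simps)
  show ?thesis
    unfolding jac_form_expand[OF E k] jac_form_expand[OF E(1,3,2,4) k'(1)] jac_form_expand[OF E(1,4,2,3) k'(2)]
      pair_form_antisym[OF k''(1)] pair_form_antisym[OF k''(2)] pair_form_antisym[OF k''(3)]
    by (simp add: algebra_simps)
qed

text \<open>
  This form in the symmetrised products \<open>x \<circ> y = [x, y] + [y, x]\<close> and \<open>w \<circ> z\<close> is the part of the
  four-point function that is symmetric in \<open>x\<close> and \<open>y\<close>.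
\<close>

definition sym_form where "sym_form x l y m w n z k = form (l + m) (bE l x y + bE m y x) (bE n w z + bE k z w)"

lemma jac_form_symmetrised:
  assumes E: "x \<in> E" "y \<in> E" "w \<in> E" "z \<in> E" and k: "l + m + n + k = 0"
  shows "jac_form x l y m w n z + jac_form y m x l w n z = sym_form x l y m w n z k"
proof -
  have k': "m + l + n + k = 0" using k by (simp add: algebra_simps)
  show ?thesis
    using jac_form_expand[OF E k] jac_form_expand[OF E(2,1,3,4) k'] E
    by (simp add: sym_form_def pair_form_def form_add bE_in MA.E.subspace_add[OF MA.subE] add.commute[of m l] del: mem_Sigma_iff)
qed

lemma sym_form_skew:
  assumes k: "l + m + n + k = 0"
  shows "sym_form x l y m w n z k = - sym_form w n z k x l y m"
  unfolding sym_form_def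
  using neg_momentum[OF k] by (subst form_skew) (simp add: add.commute)

text \<open>
  \<open>sym_form\<close> changes its sign when the two pairs are exchanged, since the form is
  skew-symmetric.
\<close>

lemma jac_form_swap:
  assumes E: "x \<in> E" "y \<in> E" "w \<in> E" "z \<in> E" and k: "l + m + n + k = 0"
  shows "jac_form x l y m w n z = - jac_form y m x l w n z - jac_form w n z k x l y - jac_form z k w n x l y"
proof -
  have k': "n + k + l + m = 0" using k by (simp add: algebra_simps)
  have *: "jac_form x l y m w n z + jac_form y m x l w n z = - (jac_form w n z k x l y + jac_form z k w n x l y)"
    unfolding jac_form_symmetrised[OF E k] jac_form_symmetrised[OF E(3,4,1,2) k'] by (rule sym_form_skew[OF k])
  have "jac_form x l y m w n z = (jac_form x l y m w n z + jac_form y m x l w n z) - jac_form y m x l w n z" by simp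
  also have "\<dots> = - jac_form y m x l w n z - jac_form w n z k x l y - jac_form z k w n x l y"
    unfolding * by (simp add: algebra_simps)
  finally show ?thesis .
qed

lemma jac_eq_0I:
  assumes "x \<in> E" "y \<in> E" "z \<in> E"
    and "\<And>c n. jac_form x l y m (c, 0) n z = 0" "\<And>h n. h \<in> D \<Longrightarrow> jac_form x l y m (0, h) n z = 0"
  shows "MA.CE.jac l m x y z = 0"
proof (rule form_nondegenerate)
  show jE: "MA.CE.jac l m x y z \<in> E" by (rule MA.CE.jac_in) fact+
  fix w n assume "w \<in> E"
  then obtain c h where w: "w = (c, 0) + (0, h)" "h \<in> D" by (cases w) simp
  show "form n w (MA.CE.jac l m x y z) = 0"
    unfolding w(1)
    using assms(4)[of c n] assms(5)[OF w(2), of n] in_E(1)[of c] in_E(2)[OF w(2)] jE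
    by (simp add: jac_form_def form_add del: add_Pair mem_Sigma_iff)
qed

text \<open>
  The four-point function is evaluated on elements of the summands. If at least three of them
  come from the same summand, it vanishes because \<open>Q\<close> and \<open>Q\<^sup>*\<^sup>c\<close> are Leibniz algebras. If two
  come from each, the symmetries reduce everything to the arguments \<open>a\<close>, \<open>f\<close> tested on \<open>g\<close>,
  \<open>b\<close> and to \<open>f\<close>, \<open>a\<close> tested on \<open>g\<close>, \<open>b\<close>, and the sum of these two cases is \<open>sym_form\<close>.
\<close>

theorem leibniz_iff_four_point:
  "leibniz_conformal_algebra MA.sE E MA.brE \<longleftrightarrow>
    (\<forall>a b. \<forall>f\<in>D. \<forall>g\<in>D. \<forall>l m n. jac_form (a, 0) l (0, f) m (0, g) n (b, 0) = 0) \<and>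
    (\<forall>a b. \<forall>f\<in>D. \<forall>g\<in>D. \<forall>l m n. sym_form (a, 0) l (0, f) m (0, g) n (b, 0) (- l - m - n) = 0)"
proof
  assume L: "leibniz_conformal_algebra MA.sE E MA.brE"
  have J: "MA.CE.jac l m u v w = 0" if "u \<in> E" "v \<in> E" "w \<in> E" for u v w l m
    using L[unfolded leibniz_iff] that by blast
  have jac_form: "jac_form u l v m w n z = 0" if "u \<in> E" "v \<in> E" "z \<in> E" "w \<in> E" for u v w z l m n
    unfolding jac_form_def J[OF that(1-3)] by (rule form_0) fact
  show "(\<forall>a b. \<forall>f\<in>D. \<forall>g\<in>D. \<forall>l m n. jac_form (a, 0) l (0, f) m (0, g) n (b, 0) = 0) \<and>
    (\<forall>a b. \<forall>f\<in>D. \<forall>g\<in>D. \<forall>l m n. sym_form (a, 0) l (0, f) m (0, g) n (b, 0) (- l - m - n) = 0)"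
    by (intro conjI allI ballI) (simp_all add: jac_form in_E(1,2) flip: jac_form_symmetrised del: mem_Sigma_iff)
next
  assume A: "(\<forall>a b. \<forall>f\<in>D. \<forall>g\<in>D. \<forall>l m n. jac_form (a, 0) l (0, f) m (0, g) n (b, 0) = 0) \<and>
    (\<forall>a b. \<forall>f\<in>D. \<forall>g\<in>D. \<forall>l m n. sym_form (a, 0) l (0, f) m (0, g) n (b, 0) (- l - m - n) = 0)"
  let ?Q = "\<lambda>a :: 'q. (a, 0 :: 'q \<Rightarrow> 'k poly)" and ?D = "\<lambda>f :: 'q \<Rightarrow> 'k poly. (0 :: 'q, f)"
  note inE = in_E(1) in_E(2)
  have sum0: "l + m + n + (- l - m - n) = 0" for l m n :: 'k by simp
  \<comment> \<open>Two arguments from each summand, \<open>x\<close> and \<open>y\<close> from different ones: these are the hypotheses.\<close>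
  have afgb: "jac_form (?Q a) l (?D f) m (?D g) n (?Q b) = 0" if "f \<in> D" "g \<in> D" for a b f g l m n
    using A that by blast
  have afbg: "jac_form (?Q a) l (?D f) m (?Q b) n (?D g) = 0" if "f \<in> D" "g \<in> D" for a b f g l m n
    using jac_form_sym[OF inE(1) inE(2) inE(1) inE(2) sum0] afgb that by simp
  have fagb: "jac_form (?D f) l (?Q a) m (?D g) n (?Q b) = 0" if "f \<in> D" "g \<in> D" for a b f g l m n
    using jac_form_symmetrised[OF inE(1) inE(2) inE(2) inE(1), of f g m l n "- m - l - n" a b] afgb[OF that] A that by simp
  have fabg: "jac_form (?D f) l (?Q a) m (?Q b) n (?D g) = 0" if "f \<in> D" "g \<in> D" for a b f g l m n
    using jac_form_sym[OF inE(2) inE(1) inE(1) inE(2) sum0] fagb that by simp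
  \<comment> \<open>If three arguments lie in one summand, the symmetries move the fourth one to the tested place,
    where the defect is that of \<open>Q\<close> or of \<open>Q\<^sup>*\<^sup>c\<close>.\<close>
  have jQ: "MA.CE.jac l m (?Q a) (?Q b) (?Q c) = 0" for a b c l m
    using leibQ by (simp add: MA.jac_pure_same leibniz_iff zero_prod_def)
  have jD: "MA.CE.jac l m (?D f) (?D g) (?D h) = 0" if "f \<in> D" "g \<in> D" "h \<in> D" for f g h l m
    using leibD that by (simp add: MA.jac_pure_same leibniz_iff zero_prod_def)
  have abwc: "jac_form (?Q a) l (?Q b) m w n (?Q c) = 0" if "w \<in> E" for a b c w l m n
    unfolding jac_form_def jQ by (rule form_0) fact
  have fgwh: "jac_form (?D f) l (?D g) m w n (?D h) = 0" if "w \<in> E" "f \<in> D" "g \<in> D" "h \<in> D" for f g h w l m n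
    unfolding jac_form_def jD[OF that(2-4)] by (rule form_0) fact
  have sums: "l + n + m + (- l - m - n) = 0" "l + (- l - m - n) + m + n = 0" for l m n :: 'k
    by simp_all
  have aawf: "jac_form (?Q a) l (?Q b) m (?Q c) n (?D f) = 0" if "f \<in> D" for a b c f l m n
    using jac_form_sym[OF inE(1) inE(1) inE(1) inE(2) sum0] abwc[OF inE(2)] that by simp
  have ffwa: "jac_form (?D f) l (?D g) m (?D h) n (?Q a) = 0" if "f \<in> D" "g \<in> D" "h \<in> D" for a h g f l m n
    using jac_form_sym[OF inE(2) inE(2) inE(2) inE(1) sum0] fgwh[OF inE(1)] that by simp
  have afcb: "jac_form (?Q a) l (?D f) m (?Q c) n (?Q b) = 0" if "f \<in> D" for a b c f l m n
    unfolding jac_form_cyclic[OF inE(1) inE(2)[OF that] inE(1) inE(1) sum0] by (simp add: aawf abwc inE that)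
  have fahg: "jac_form (?D f) l (?Q a) m (?D h) n (?D g) = 0" if "f \<in> D" "g \<in> D" "h \<in> D" for a h g f l m n
    unfolding jac_form_cyclic[OF inE(2)[OF that(1)] inE(1) inE(2)[OF that(3)] inE(2)[OF that(2)] sum0]
    by (simp add: ffwa fgwh[OF inE(1)] that)
  show "leibniz_conformal_algebra MA.sE E MA.brE"
    unfolding leibniz_iff
  proof (intro conjI MA.bracketE ballI allI)
    fix u v w :: "'q \<times> ('q \<Rightarrow> 'k poly)" and l m assume uvw: "u \<in> E" "v \<in> E" "w \<in> E"
    show "MA.CE.jac l m u v w = 0"
    proof (rule MA.jac_from_pure[OF _ _ _ _ _ _ _ _ uvw])
      fix l m and a b :: 'q and f assume f: "f \<in> D"
      show "MA.CE.jac l m (?Q a) (?Q b) (?D f) = 0"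
      proof (rule jac_eq_0I[OF inE(1) inE(1) inE(2)[OF f]])
        fix h n assume h: "h \<in> D"
        show "jac_form (?Q a) l (?Q b) m (?D h) n (?D f) = 0"
          unfolding jac_form_cyclic[OF inE(1) inE(1) inE(2)[OF h] inE(2)[OF f] sum0] by (simp add: afbg f h)
      qed (simp add: aawf f)
      show "MA.CE.jac l m (?Q a) (?D f) (?Q b) = 0"
        by (rule jac_eq_0I) (simp_all add: inE f afcb afgb del: mem_Sigma_iff)
      show "MA.CE.jac l m (?D f) (?Q a) (?Q b) = 0"
      proof (rule jac_eq_0I[OF inE(2)[OF f] inE(1) inE(1)])
        fix c n
        show "jac_form (?D f) l (?Q a) m (?Q c) n (?Q b) = 0"
          unfolding jac_form_swap[OF inE(2)[OF f] inE(1) inE(1) inE(1) sum0] by (simp add: afcb abwc[OF inE(2)[OF f]] f)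
      qed (simp add: fagb f)
    next
      fix l m and a :: 'q and f g assume fg: "f \<in> D" "g \<in> D"
      show "MA.CE.jac l m (?D f) (?D g) (?Q a) = 0"
      proof (rule jac_eq_0I[OF inE(2)[OF fg(1)] inE(2)[OF fg(2)] inE(1)])
        fix c n
        show "jac_form (?D f) l (?D g) m (?Q c) n (?Q a) = 0"
          unfolding jac_form_cyclic[OF inE(2)[OF fg(1)] inE(2)[OF fg(2)] inE(1) inE(1) sum0] by (simp add: fagb fg)
      qed (simp add: ffwa fg)
      show "MA.CE.jac l m (?D f) (?Q a) (?D g) = 0"
        by (rule jac_eq_0I) (simp_all add: inE fg fahg fabg del: mem_Sigma_iff)
      show "MA.CE.jac l m (?Q a) (?D f) (?D g) = 0"
      proof (rule jac_eq_0I[OF inE(1) inE(2)[OF fg(1)] inE(2)[OF fg(2)]])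
        fix h n assume h: "h \<in> D"
        show "jac_form (?Q a) l (?D f) m (?D h) n (?D g) = 0"
          unfolding jac_form_swap[OF inE(1) inE(2)[OF fg(1)] inE(2)[OF h] inE(2)[OF fg(2)] sum0]
          by (simp add: fahg fgwh[OF inE(1)] fg h)
      qed (simp add: afbg fg)
    qed (simp_all add: jQ jD)
  qed
qed

end

section \<open>Tensors as functionals on multilinear forms\<close>

definition fun_scale :: "'k::field_char_0 \<Rightarrow> ('b \<Rightarrow> 'k) \<Rightarrow> 'b \<Rightarrow> 'k" where
  "fun_scale c t = (\<lambda>\<beta>. c * t \<beta>)"

lemma vector_space_fun: "vector_space (fun_scale :: 'k::field_char_0 \<Rightarrow> ('b \<Rightarrow> 'k) \<Rightarrow> _)"
  by unfold_locales (simp_all add: fun_scale_def fun_eq_iff algebra_simps)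

lemma fun_scale_0 [simp]: "fun_scale c 0 = 0"
  by (simp add: fun_scale_def fun_eq_iff)

lemma vector_space_fun_poly: "vector_space (\<lambda>c :: 'k::field_char_0. map_poly (fun_scale c :: ('b \<Rightarrow> 'k) \<Rightarrow> _))"
  by unfold_locales (auto intro!: poly_eqI simp: coeff_map_poly fun_scale_def fun_eq_iff algebra_simps)

lemma vector_space_field: "vector_space ((*) :: 'k::field \<Rightarrow> 'k \<Rightarrow> 'k)"
  by unfold_locales (simp_all add: algebra_simps)

lemma linear_eval: "Vector_Spaces.linear (fun_scale :: 'k::field_char_0 \<Rightarrow> ('b \<Rightarrow> 'k) \<Rightarrow> _) (*) (\<lambda>t. t \<beta>)"
  by (simp add: Vector_Spaces.linear_iff vector_space_fun vector_space_field) (simp add: fun_scale_def)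

definition form_value :: "('b \<Rightarrow> 'k::field_char_0) poly \<Rightarrow> 'k \<Rightarrow> 'b \<Rightarrow> 'k" where
  "form_value P x \<beta> = poly (map_poly (\<lambda>t. t \<beta>) P) x"

lemma form_value_0 [simp]: "form_value 0 x \<beta> = 0"
  by (simp add: form_value_def)

lemma form_value_pCons [simp]: "form_value (pCons t P) x \<beta> = t \<beta> + x * form_value P x \<beta>"
  by (simp add: form_value_def map_poly_pCons)

lemma form_value_add [simp]: "form_value (P + P') x \<beta> = form_value P x \<beta> + form_value P' x \<beta>"
proof -
  have "map_poly (\<lambda>t. t \<beta>) (P + P') = map_poly (\<lambda>t. t \<beta>) P + map_poly (\<lambda>t. t \<beta>) P'"
    by (rule poly_eqI) (simp add: coeff_map_poly)
  then show ?thesis by (simp add: form_value_def)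
qed

lemma form_value_uminus [simp]: "form_value (- P) x \<beta> = - form_value P x \<beta>"
  using form_value_add[of P "- P" x \<beta>] by (simp add: eq_neg_iff_add_eq_0 add.commute)

lemma form_value_diff [simp]: "form_value (P - P') x \<beta> = form_value P x \<beta> - form_value P' x \<beta>"
  using form_value_add[of P "- P'" x \<beta>] by simp

lemma form_value_sum: "form_value (sum F A) x \<beta> = (\<Sum>i\<in>A. form_value (F i) x \<beta>)"
  by (induction A rule: infinite_finite_induct) simp_all

lemma form_value_lam1 [simp]: "form_value (lam1 P) x \<beta> = x * form_value P x \<beta>"
  by (simp add: lam1_def)

lemma form_value_expand: "form_value P x \<beta> = (\<Sum>n\<le>degree P. x ^ n * coeff P n \<beta>)"
proof -
  have "degree (map_poly (\<lambda>t. t \<beta>) P) \<le> degree P"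
    by (rule degree_le) (simp add: coeff_map_poly coeff_eq_0)
  then show ?thesis
    unfolding form_value_def poly_altdef
    by (intro sum.mono_neutral_cong_left) (auto simp: coeff_map_poly coeff_eq_0 intro: le_degree)
qed

lemma linear_form_value:
  "Vector_Spaces.linear (\<lambda>c :: 'k::field_char_0. map_poly (fun_scale c)) (*) (\<lambda>P. form_value P x \<beta>)"
proof -
  have "form_value (map_poly (fun_scale c) P) x \<beta> = c * form_value P x \<beta>" for c :: 'k and P
    by (induction P) (simp_all add: map_poly_pCons algebra_simps, simp add: fun_scale_def)
  then show ?thesis
    by (simp add: Vector_Spaces.linear_iff vector_space_fun_poly vector_space_field)
qed

context kd_space
begin

abbreviation T where "T \<equiv> tensor_space s"

abbreviation klinear where "klinear \<equiv> Vector_Spaces.linear (base_scale s) (*)"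

definition prod_form :: "('v \<Rightarrow> 'k) \<Rightarrow> ('v \<Rightarrow> 'k) \<Rightarrow> 'v \<Rightarrow> 'v \<Rightarrow> 'k" where
  "prod_form \<phi> \<psi> = (\<lambda>x y. \<phi> x * \<psi> y)"

lemma klinear_iff: "klinear \<phi> \<longleftrightarrow> (\<forall>x y. \<phi> (x + y) = \<phi> x + \<phi> y) \<and> (\<forall>c x. \<phi> (base_scale s c x) = c * \<phi> x)"
  by (simp add: Vector_Spaces.linear_iff vector_space_base vector_space_field)

lemma bilinear_form_iff: "bilinear_form s \<beta> \<longleftrightarrow>
  (\<forall>x y z. \<beta> (x + y) z = \<beta> x z + \<beta> y z) \<and> (\<forall>c x z. \<beta> (base_scale s c x) z = c * \<beta> x z) \<and>
  (\<forall>x y z. \<beta> z (x + y) = \<beta> z x + \<beta> z y) \<and> (\<forall>c x z. \<beta> z (base_scale s c x) = c * \<beta> z x)"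
  unfolding bilinear_form_def klinear_iff by blast

lemma trilinear_form_iff: "trilinear_form s \<gamma> \<longleftrightarrow>
  (\<forall>x y z w. \<gamma> (x + y) z w = \<gamma> x z w + \<gamma> y z w) \<and> (\<forall>c x z w. \<gamma> (base_scale s c x) z w = c * \<gamma> x z w) \<and>
  (\<forall>x y z w. \<gamma> z (x + y) w = \<gamma> z x w + \<gamma> z y w) \<and> (\<forall>c x z w. \<gamma> z (base_scale s c x) w = c * \<gamma> z x w) \<and>
  (\<forall>x y z w. \<gamma> z w (x + y) = \<gamma> z w x + \<gamma> z w y) \<and> (\<forall>c x z w. \<gamma> z w (base_scale s c x) = c * \<gamma> z w x)"
  unfolding trilinear_form_def klinear_iff by auto

lemma prod_form_bilinear: "klinear \<phi> \<Longrightarrow> klinear \<psi> \<Longrightarrow> bilinear_form s (prod_form \<phi> \<psi>)"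
  by (simp add: bilinear_form_iff klinear_iff prod_form_def algebra_simps)

definition bilinear_map :: "('k \<Rightarrow> 'w::ab_group_add \<Rightarrow> 'w) \<Rightarrow> ('v \<Rightarrow> 'v \<Rightarrow> 'w) \<Rightarrow> bool" where
  "bilinear_map k B \<longleftrightarrow>
    (\<forall>y. Vector_Spaces.linear (base_scale s) k (\<lambda>x. B x y)) \<and> (\<forall>x. Vector_Spaces.linear (base_scale s) k (B x))"

lemma bilinear_mapI:
  assumes "vector_space k"
    and "\<And>x y z. B (x + y) z = B x z + B y z" "\<And>c x z. B (base_scale s c x) z = k c (B x z)"
    and "\<And>x y z. B z (x + y) = B z x + B z y" "\<And>c x z. B z (base_scale s c x) = k c (B z x)"
  shows "bilinear_map k B"
  using assms by (simp add: bilinear_map_def Vector_Spaces.linear_iff vector_space_base)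

lemma tensor_cases:
  assumes "t \<in> T"
  obtains ps where "t = (\<Sum>(x, y)\<leftarrow>ps. tens s x y)"
  using assms by (auto simp: tensor_space_def)

lemma tens_list_eval:
  "bilinear_form s \<beta> \<Longrightarrow> (\<Sum>(x, y)\<leftarrow>ps. tens s x y) \<beta> = (\<Sum>(x, y)\<leftarrow>ps. \<beta> x y)"
  by (simp add: sum_list_fun_apply tens_def case_prod_beta')

text \<open>
  A tensor is a functional on bilinear forms, so a functional of a lifted map is the value of
  the tensor at a form. All operators on tensors are computed from this rule.
\<close>

lemma lift_eval:
  assumes B: "bilinear_map k B" and \<Theta>: "Vector_Spaces.linear k (*) \<Theta>" and t: "t \<in> T"
  shows "\<Theta> (tensor_lift s B t) = t (\<lambda>x y. \<Theta> (B x y))"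
proof -
  obtain ps where ps: "t = (\<Sum>(x, y)\<leftarrow>ps. tens s x y)" using t by (rule tensor_cases)
  have lift: "tensor_lift s B t = (\<Sum>(x, y)\<leftarrow>ps. B x y)"
    unfolding ps using B by (intro tensor_lift_sum_list) (auto simp: bilinear_map_def)
  have "bilinear_form s (\<lambda>x y. \<Theta> (B x y))"
    using B \<Theta> by (simp add: bilinear_map_def bilinear_form_iff Vector_Spaces.linear_iff)
  note bil = this
  show ?thesis
    unfolding lift unfolding ps tens_list_eval[OF bil] by (simp add: linear_sum_list[OF \<Theta>] case_prod_beta')
qed

lemma lift_in:
  assumes B: "bilinear_map k B" and t: "t \<in> T"
    and P: "0 \<in> P" "\<And>u v. u \<in> P \<Longrightarrow> v \<in> P \<Longrightarrow> u + v \<in> P" "\<And>x y. B x y \<in> P"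
  shows "tensor_lift s B t \<in> P"
proof -
  obtain ps where ps: "t = (\<Sum>(x, y)\<leftarrow>ps. tens s x y)" using t by (rule tensor_cases)
  have "tensor_lift s B t = (\<Sum>(x, y)\<leftarrow>ps. B x y)"
    unfolding ps using B by (intro tensor_lift_sum_list) (auto simp: bilinear_map_def)
  moreover have "(\<Sum>(x, y)\<leftarrow>qs. B x y) \<in> P" for qs
    by (induction qs) (auto simp: P)
  ultimately show ?thesis by simp
qed

lemma tens_apply: "bilinear_form s \<beta> \<Longrightarrow> tens s x y \<beta> = \<beta> x y"
  by (simp add: tens_def)

lemma tens_in: "tens s x y \<in> T"
  unfolding tensor_space_def by (rule range_eqI[of _ _ "[(x, y)]"]) simp

lemma tensor_0: "0 \<in> T"
  unfolding tensor_space_def by (rule range_eqI[of _ _ "[]"]) simp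

lemma tensor_add: "t \<in> T \<Longrightarrow> t' \<in> T \<Longrightarrow> t + t' \<in> T"
proof (elim tensor_cases)
  fix ps qs assume "t = (\<Sum>(x, y)\<leftarrow>ps. tens s x y)" "t' = (\<Sum>(x, y)\<leftarrow>qs. tens s x y)"
  then show "t + t' \<in> T"
    unfolding tensor_space_def by (intro range_eqI[of _ _ "ps @ qs"]) simp
qed

lemma tensor_scale_in:
  assumes "t \<in> T"
  shows "fun_scale c t \<in> T"
proof -
  obtain ps where ps: "t = (\<Sum>(x, y)\<leftarrow>ps. tens s x y)" using assms by (rule tensor_cases)
  have "fun_scale c (\<Sum>(x, y)\<leftarrow>qs. tens s x y) \<in> T" for qs
  proof (induction qs)
    case (Cons q qs)
    obtain x y where q: "q = (x, y)" by (cases q)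
    have "fun_scale c (\<Sum>(x, y)\<leftarrow>q # qs. tens s x y) = tens s (base_scale s c x) y + fun_scale c (\<Sum>(x, y)\<leftarrow>qs. tens s x y)"
      by (simp add: q fun_scale_def fun_eq_iff tens_bilinear[OF module_axioms] algebra_simps)
    then show ?case using tensor_add[OF tens_in Cons] by (simp only:)
  qed (simp add: tensor_0 del: zero_fun_apply)
  then show ?thesis by (simp only: ps)
qed

lemma tensor_uminus: "t \<in> T \<Longrightarrow> - t \<in> T"
proof -
  have "fun_scale (- 1) t = - t" by (rule ext) (simp add: fun_scale_def)
  then show "t \<in> T \<Longrightarrow> - t \<in> T" using tensor_scale_in[of t "- 1"] by (simp only:)
qed

lemma tensor_diff: "t \<in> T \<Longrightarrow> t' \<in> T \<Longrightarrow> t - t' \<in> T"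
  using tensor_add[OF _ tensor_uminus, of t t'] by (simp only: add_uminus_conv_diff)

lemma tensor_form_linear:
  assumes t: "t \<in> T" and "bilinear_form s \<beta>"
  shows "bilinear_form s \<beta>' \<Longrightarrow> t (\<lambda>x y. \<beta> x y + \<beta>' x y) = t \<beta> + t \<beta>'" (is "PROP ?A") "t (\<lambda>x y. c * \<beta> x y) = c * t \<beta>" (is ?B)
proof -
  obtain ps where ps: "t = (\<Sum>(x, y)\<leftarrow>ps. tens s x y)" using t by (rule tensor_cases)
  have bil: "bilinear_form s \<beta>' \<Longrightarrow> bilinear_form s (\<lambda>x y. \<beta> x y + \<beta>' x y)" "bilinear_form s (\<lambda>x y. c * \<beta> x y)"
    using assms(2) by (simp_all add: bilinear_form_iff algebra_simps)
  have "(\<Sum>(x, y)\<leftarrow>qs. \<beta> x y + \<beta>' x y) = (\<Sum>(x, y)\<leftarrow>qs. \<beta> x y) + (\<Sum>(x, y)\<leftarrow>qs. \<beta>' x y)"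
    "(\<Sum>(x, y)\<leftarrow>qs. c * \<beta> x y) = c * (\<Sum>(x, y)\<leftarrow>qs. \<beta> x y)" for qs
    by (induction qs) (auto simp: algebra_simps)
  then show "PROP ?A" ?B
    by (simp_all add: ps tens_list_eval assms bil)
qed

lemma tensor_zero_form: "t \<in> T \<Longrightarrow> t (\<lambda>x y. 0) = 0"
  using tensor_form_linear(2)[of t "\<lambda>x y. 0" 0] by (simp add: bilinear_form_iff)

lemma tensor_non_form: "t \<in> T \<Longrightarrow> \<not> bilinear_form s \<beta> \<Longrightarrow> t \<beta> = 0"
  by (erule tensor_cases) (simp add: sum_list_fun_apply tens_def case_prod_beta')

lemma tens_bilinear_map:
  assumes "\<And>x y. f (x + y) = f x + f y" "\<And>c x. f (base_scale s c x) = base_scale s c (f x)"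
    and "\<And>x y. g (x + y) = g x + g y" "\<And>c x. g (base_scale s c x) = base_scale s c (g x)"
  shows "bilinear_map fun_scale (\<lambda>x y. tens s (f x) (g y))" "bilinear_map fun_scale (\<lambda>x y. tens s (g y) (f x))"
  by (rule bilinear_mapI[OF vector_space_fun];
    simp add: assms tens_bilinear[OF module_axioms] fun_scale_def)+

lemma tensor_operator_values:
  assumes t: "t \<in> T"
  shows "pdL s t \<in> T" "bilinear_form s \<beta> \<Longrightarrow> pdL s t \<beta> = t (\<lambda>x y. \<beta> (pd s x) y)" (is "PROP ?A")
    "pdR s t \<in> T" "bilinear_form s \<beta> \<Longrightarrow> pdR s t \<beta> = t (\<lambda>x y. \<beta> x (pd s y))" (is "PROP ?B")
    "twist s t \<in> T" "bilinear_form s \<beta> \<Longrightarrow> twist s t \<beta> = t (\<lambda>x y. \<beta> y x)" (is "PROP ?C")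
proof -
  have B: "bilinear_map fun_scale (\<lambda>x y. tens s (pd s x) y)" "bilinear_map fun_scale (\<lambda>x y. tens s x (pd s y))"
    "bilinear_map fun_scale (\<lambda>x y. tens s y x)"
    using tens_bilinear_map(1)[of "pd s" "\<lambda>x. x"] tens_bilinear_map(1)[of "\<lambda>x. x" "pd s"]
      tens_bilinear_map(2)[of "\<lambda>x. x" "\<lambda>x. x"] by (simp_all add: scale_right_distrib mult.commute)
  show "pdL s t \<in> T"
    unfolding pdL_def by (rule lift_in[OF B(1) t tensor_0 tensor_add tens_in])
  show "pdR s t \<in> T"
    unfolding pdR_def by (rule lift_in[OF B(2) t tensor_0 tensor_add tens_in])
  show "twist s t \<in> T"
    unfolding twist_def by (rule lift_in[OF B(3) t tensor_0 tensor_add tens_in])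
  show "PROP ?A"
    "PROP ?B"
    "PROP ?C"
    unfolding pdL_def pdR_def twist_def
    using lift_eval[OF B(1) linear_eval t, of \<beta>] lift_eval[OF B(2) linear_eval t, of \<beta>]
      lift_eval[OF B(3) linear_eval t, of \<beta>] by (simp_all add: tens_apply)
qed

lemma form_value_linear:
  assumes e: "\<And>x y. e (x + y) = e x + e y" "\<And>c x. e (base_scale s c x) = fun_scale c (e x)"
  shows "form_value (map_poly e p) x \<beta> = e (peval s p [:x:]) \<beta>"
proof -
  have "e 0 = 0" using e(1)[of 0 0] by (simp only: add_0 add_cancel_right_right)
  then show ?thesis
    by (induction p) (simp_all add: map_poly_pCons e, simp add: fun_scale_def)
qed

lemma act_form_values:
  assumes A: "linear_on s UNIV s A" and t: "t \<in> T"
  shows "actL s A t \<in> poly_over T" "actR s A t \<in> poly_over T"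
    and "bilinear_form s \<beta> \<Longrightarrow> form_value (actL s A t) x \<beta> = t (\<lambda>u v. \<beta> (peval s (A u) [:x:]) v)" (is "PROP ?A")
    and "bilinear_form s \<beta> \<Longrightarrow> form_value (actR s A t) x \<beta> = t (\<lambda>u v. \<beta> u (peval s (A v) [:x:]))" (is "PROP ?B")
proof -
  have A': "A (u + v) = A u + A v" "A (base_scale s c u) = map_poly (base_scale s c) (A u)" for u v c
    using A by (simp_all add: linear_on_def)
  note tb = tens_bilinear[OF module_axioms]
  have ts: "tens s (base_scale s c x) y = fun_scale c (tens s x y)"
    "tens s x (base_scale s c y) = fun_scale c (tens s x y)" for c x y
    by (simp_all only: tb fun_scale_def)
  have t0: "tens s 0 y = 0" "tens s y 0 = 0" for y
    using tb(1)[of 0 0 y] tb(2)[of y 0 0] by simp_all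
  have B: "bilinear_map (\<lambda>c. map_poly (fun_scale c)) (\<lambda>x y. map_poly (\<lambda>z. tens s z y) (A x))"
    "bilinear_map (\<lambda>c. map_poly (fun_scale c)) (\<lambda>x y. map_poly (\<lambda>z. tens s x z) (A y))"
    by (rule bilinear_mapI[OF vector_space_fun_poly];
      auto intro!: poly_eqI simp: A' coeff_map_poly t0 tb fun_eq_iff fun_scale_def)+
  have over: "map_poly (\<lambda>z. tens s z y) p \<in> poly_over T" "map_poly (\<lambda>z. tens s y z) p \<in> poly_over T" for y p
    by (simp_all add: poly_over_def coeff_map_poly t0 tens_in)
  have add: "P + P' \<in> poly_over T" if "P \<in> poly_over T" "P' \<in> poly_over T" for P P'
    using that by (simp add: poly_over_def tensor_add)
  show "actL s A t \<in> poly_over T"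
    unfolding actL_def by (rule lift_in[OF B(1) t poly_over_0[OF tensor_0] add over(1)])
  show "actR s A t \<in> poly_over T"
    unfolding actR_def by (rule lift_in[OF B(2) t poly_over_0[OF tensor_0] add over(2)])
  have val: "form_value (map_poly (\<lambda>z. tens s z v) p) x \<beta> = tens s (peval s p [:x:]) v \<beta>"
    "form_value (map_poly (\<lambda>z. tens s v z) p) x \<beta> = tens s v (peval s p [:x:]) \<beta>" for v p
    by (rule form_value_linear; (rule tb ts))+
  show "PROP ?A"
    "PROP ?B"
    unfolding actL_def actR_def
    using lift_eval[OF B(1) linear_form_value t, of x \<beta>] lift_eval[OF B(2) linear_form_value t, of x \<beta>]
    by (simp_all add: val tens_apply)
qed

lemma form_value_map:
  assumes "P \<in> poly_over T" "F 0 = 0" "\<And>t. t \<in> T \<Longrightarrow> F t \<beta> = y * t \<beta>'"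
  shows "form_value (map_poly F P) x \<beta> = y * form_value P x \<beta>'"
  using assms(1)
proof (induction P)
  case (pCons t P)
  then show ?case by (simp add: poly_over_pCons map_poly_pCons assms algebra_simps)
qed simp

lemma form_value_subst1:
  assumes P: "P \<in> poly_over T"
    and N: "\<And>P. P \<in> poly_over T \<Longrightarrow> N P \<in> poly_over T"
    and act: "\<And>P. P \<in> poly_over T \<Longrightarrow> form_value (N P) x \<beta> = y * form_value P x \<beta>"
  shows "form_value (subst1 N P) x \<beta> = form_value P y \<beta>"
proof -
  have *: "(N ^^ n) P \<in> poly_over T \<and> form_value ((N ^^ n) P) x \<beta> = y ^ n * form_value P x \<beta>"
    if "P \<in> poly_over T" for P n
    by (induction n) (simp_all add: that N act)
  have "[:coeff P n:] \<in> poly_over T" for n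
    using P by (simp add: poly_over_pCons poly_over_coeff tensor_0)
  then have "form_value (subst1 N P) x \<beta> = (\<Sum>n\<le>degree P. y ^ n * form_value [:coeff P n:] x \<beta>)"
    by (simp only: subst1_def form_value_sum *)
  then show ?thesis by (simp add: form_value_expand[of P])
qed

lemma subst1_over:
  assumes P: "P \<in> poly_over T"
    and N: "\<And>P. P \<in> poly_over T \<Longrightarrow> N P \<in> poly_over T"
  shows "subst1 N P \<in> poly_over T"
proof -
  have *: "(N ^^ n) P \<in> poly_over T" if "P \<in> poly_over T" for P n
    by (induction n) (simp_all add: that N)
  have "[:coeff P n:] \<in> poly_over T" for n
    using P by (simp add: poly_over_pCons poly_over_coeff tensor_0)
  then have N_in: "(N ^^ n) [:coeff P n:] \<in> poly_over T" for n by (rule *)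
  have "sum F A \<in> poly_over T"
    if "\<And>i. F i \<in> poly_over T" for F and A :: "nat set"
    by (induction A rule: infinite_finite_induct) (use that in \<open>auto simp: tensor_0 poly_over_def tensor_add\<close>)
  note in_sum = this
  show ?thesis unfolding subst1_def by (rule in_sum) (rule N_in)
qed

subsection \<open>Separation by products of functionals\<close>

definition separating :: "('v \<Rightarrow> 'k) set \<Rightarrow> bool" where
  "separating F \<longleftrightarrow> (\<forall>\<phi>\<in>F. klinear \<phi>) \<and> (\<forall>x. (\<forall>\<phi>\<in>F. \<phi> x = 0) \<longrightarrow> x = 0)"

lemma klinear_sum_list:
  "klinear \<phi> \<Longrightarrow> \<phi> (\<Sum>p\<leftarrow>ps. base_scale s (c p) (u p)) = (\<Sum>p\<leftarrow>ps. c p * \<phi> (u p))"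
  by (simp add: linear_sum_list) (simp add: klinear_iff)

lemma separating_list:
  assumes F: "separating F" and h: "klinear h" and 0: "\<And>\<phi>. \<phi> \<in> F \<Longrightarrow> (\<Sum>p\<leftarrow>ps. c p * \<phi> (u p)) = 0"
  shows "(\<Sum>p\<leftarrow>ps. c p * h (u p)) = 0"
proof -
  have "(\<Sum>p\<leftarrow>ps. base_scale s (c p) (u p)) = 0"
    using F 0 by (auto simp: separating_def klinear_sum_list)
  then have "h (\<Sum>p\<leftarrow>ps. base_scale s (c p) (u p)) = 0" using h by (metis klinear_iff mult_zero_left scale_zero_right)
  then show ?thesis by (simp add: klinear_sum_list[OF h])
qed

text \<open>
  Coordinates with respect to a basis over \<open>k\<close>, which need not be finite; each vector only
  meets finitely many of them.
\<close>

lemma klinear_coordinates: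
  obtains \<rho> :: "'v \<Rightarrow> 'v \<Rightarrow> 'k"
  where "\<And>b. klinear (\<lambda>x. \<rho> x b)" "\<And>x. finite {b. \<rho> x b \<noteq> 0}"
    "\<And>C h x. finite C \<Longrightarrow> {b. \<rho> x b \<noteq> 0} \<subseteq> C \<Longrightarrow> klinear h \<Longrightarrow> h x = (\<Sum>b\<in>C. \<rho> x b * h b)"
proof -
  interpret vs: vector_space "base_scale s" by (rule vector_space_base)
  obtain B where B: "vs.independent B" "UNIV \<subseteq> vs.span B"
    by (rule vs.maximal_independent_subset[of UNIV])
  then have span: "x \<in> vs.span B" for x by blast
  have "klinear (\<lambda>x. vs.representation B x b)" for b
    by (simp add: klinear_iff vs.representation_add[OF B(1) span span] vs.representation_scale[OF B(1) span])
  moreover have "h x = (\<Sum>b\<in>C. vs.representation B x b * h b)"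
    if C: "finite C" "{b. vs.representation B x b \<noteq> 0} \<subseteq> C" and h: "klinear h" for C h x
  proof -
    interpret h: Vector_Spaces.linear "base_scale s" "(*)" h by (rule h)
    have "h x = h (\<Sum>b | vs.representation B x b \<noteq> 0. base_scale s (vs.representation B x b) b)"
      using vs.sum_nonzero_representation_eq[OF B(1) span, of x] by simp
    also have "\<dots> = (\<Sum>b | vs.representation B x b \<noteq> 0. vs.representation B x b * h b)"
      by (simp add: h.sum h.scale)
    also have "\<dots> = (\<Sum>b\<in>C. vs.representation B x b * h b)"
      using C by (intro sum.mono_neutral_left) auto
    finally show ?thesis .
  qed
  ultimately show thesis using vs.finite_representation by (intro that[of "vs.representation B"])
qed

lemma sum_list_swap: "(\<Sum>p\<leftarrow>ps. \<Sum>b\<in>C. F p b) = (\<Sum>b\<in>C. \<Sum>p\<leftarrow>ps. F p b)" for F :: "'i \<Rightarrow> 'j \<Rightarrow> 'k"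
  by (induction ps) (simp_all add: sum.distrib)

text \<open>
  Separation in one factor at a time replaces the functionals of the family by arbitrary
  linear ones. Coordinates in the first factor then write the value at any bilinear form as a
  finite sum of values at products of functionals.
\<close>

lemma tensor_eq_0I:
  assumes F: "separating F" and t: "t \<in> T"
    and 0: "\<And>\<phi> \<psi>. \<phi> \<in> F \<Longrightarrow> \<psi> \<in> F \<Longrightarrow> t (prod_form \<phi> \<psi>) = 0"
  shows "t = 0"
proof
  fix \<beta>
  obtain ps where ps: "t = (\<Sum>(x, y)\<leftarrow>ps. tens s x y)" using t by (rule tensor_cases)
  have val: "t \<beta> = (\<Sum>p\<leftarrow>ps. \<beta> (fst p) (snd p))" if "bilinear_form s \<beta>" for \<beta>
    unfolding ps tens_list_eval[OF that] by (simp add: case_prod_beta')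
  have pv: "t (prod_form \<phi> \<psi>) = (\<Sum>p\<leftarrow>ps. \<phi> (fst p) * \<psi> (snd p))" if "klinear \<phi>" "klinear \<psi>" for \<phi> \<psi>
    using val[OF prod_form_bilinear[OF that]] by (simp add: prod_form_def)
  have lin: "klinear \<phi>" if "\<phi> \<in> F" for \<phi> using F that by (simp add: separating_def)
  have 1: "(\<Sum>p\<leftarrow>ps. h (fst p) * \<psi> (snd p)) = 0" if "klinear h" "\<psi> \<in> F" for h \<psi>
    unfolding mult.commute[of "h _"]
    by (rule separating_list[OF F that(1)]) (use that 0 pv lin in \<open>simp add: mult.commute\<close>)
  have 2: "(\<Sum>p\<leftarrow>ps. h (fst p) * h' (snd p)) = 0" if "klinear h" "klinear h'" for h h'
    by (rule separating_list[OF F that(2)]) (rule 1[OF that(1)])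
  show "t \<beta> = 0 \<beta>"
  proof (cases "bilinear_form s \<beta>")
    case True
    obtain \<rho> where \<rho>: "\<And>b. klinear (\<lambda>x. \<rho> x b)" "\<And>x. finite {b. \<rho> x b \<noteq> 0}"
      "\<And>C h x. finite C \<Longrightarrow> {b. \<rho> x b \<noteq> 0} \<subseteq> C \<Longrightarrow> klinear h \<Longrightarrow> h x = (\<Sum>b\<in>C. \<rho> x b * h b)"
      by (rule klinear_coordinates) (rule that; assumption)
    define C where "C = (\<Union>p\<in>set ps. {b. \<rho> (fst p) b \<noteq> 0})"
    have C: "finite C" using \<rho>(2) by (simp add: C_def)
    have "t \<beta> = (\<Sum>p\<leftarrow>ps. \<beta> (fst p) (snd p))" by (rule val[OF True])
    also have "\<dots> = (\<Sum>p\<leftarrow>ps. \<Sum>b\<in>C. \<rho> (fst p) b * \<beta> b (snd p))"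
    proof (rule arg_cong[of _ _ sum_list], rule map_cong[OF refl])
      fix p assume "p \<in> set ps"
      then show "\<beta> (fst p) (snd p) = (\<Sum>b\<in>C. \<rho> (fst p) b * \<beta> b (snd p))"
        using True by (intro \<rho>(3)[OF C]) (auto simp: C_def bilinear_form_def)
    qed
    also have "\<dots> = (\<Sum>b\<in>C. \<Sum>p\<leftarrow>ps. \<rho> (fst p) b * \<beta> b (snd p))" by (rule sum_list_swap)
    also have "\<dots> = 0"
      using True \<rho>(1) by (intro sum.neutral ballI 2) (auto simp: bilinear_form_def)
    finally show ?thesis by simp
  qed (simp add: tensor_non_form[OF t])
qed

lemma tensor_poly_eqI:
  assumes F: "separating F" and P: "P \<in> poly_over T" "P' \<in> poly_over T"
    and eq: "\<And>\<phi> \<psi> x. \<phi> \<in> F \<Longrightarrow> \<psi> \<in> F \<Longrightarrow> form_value P x (prod_form \<phi> \<psi>) = form_value P' x (prod_form \<phi> \<psi>)"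
  shows "P = P'"
proof (rule poly_eqI)
  fix n
  have "coeff P n - coeff P' n = 0"
  proof (rule tensor_eq_0I[OF F])
    show "coeff P n - coeff P' n \<in> T" using P by (simp add: poly_over_def tensor_diff)
    fix \<phi> \<psi> assume "\<phi> \<in> F" "\<psi> \<in> F"
    then have "map_poly (\<lambda>t. t (prod_form \<phi> \<psi>)) P = map_poly (\<lambda>t. t (prod_form \<phi> \<psi>)) P'"
      by (intro poly_ext) (simp add: eq flip: form_value_def)
    then have "coeff (map_poly (\<lambda>t. t (prod_form \<phi> \<psi>)) P) n = coeff (map_poly (\<lambda>t. t (prod_form \<phi> \<psi>)) P') n" by simp
    then show "(coeff P n - coeff P' n) (prod_form \<phi> \<psi>) = 0" by (simp add: coeff_map_poly)
  qed
  then show "coeff P n = coeff P' n" by simp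
qed

subsection \<open>Triple tensors\<close>

definition tensor_space3 :: "('k, 'v) tensor3 set" where
  "tensor_space3 = range (\<lambda>ps. \<Sum>(x, y, z)\<leftarrow>ps. tens3 s x y z)"

lemma tens3_list_eval:
  "trilinear_form s \<gamma> \<Longrightarrow> (\<Sum>(x, y, z)\<leftarrow>ps. tens3 s x y z) \<gamma> = (\<Sum>(x, y, z)\<leftarrow>ps. \<gamma> x y z)"
  by (simp add: sum_list_fun_apply tens3_def case_prod_beta')

lemma tens3_in: "tens3 s x y z \<in> tensor_space3"
  unfolding tensor_space3_def by (rule range_eqI[of _ _ "[(x, y, z)]"]) simp

lemma tensor3_0: "0 \<in> tensor_space3"
  unfolding tensor_space3_def by (rule range_eqI[of _ _ "[]"]) simp

lemma tensor3_add: "t \<in> tensor_space3 \<Longrightarrow> t' \<in> tensor_space3 \<Longrightarrow> t + t' \<in> tensor_space3"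
proof -
  assume "t \<in> tensor_space3" "t' \<in> tensor_space3"
  then obtain ps qs where "t = (\<Sum>(x, y, z)\<leftarrow>ps. tens3 s x y z)" "t' = (\<Sum>(x, y, z)\<leftarrow>qs. tens3 s x y z)"
    by (auto simp: tensor_space3_def)
  then show "t + t' \<in> tensor_space3"
    unfolding tensor_space3_def by (intro range_eqI[of _ _ "ps @ qs"]) simp
qed

lemma tens3_multilinear:
  "tens3 s (x + x') y z = tens3 s x y z + tens3 s x' y z" "tens3 s (base_scale s c x) y z = fun_scale c (tens3 s x y z)"
  "tens3 s x (y + y') z = tens3 s x y z + tens3 s x y' z" "tens3 s x (base_scale s c y) z = fun_scale c (tens3 s x y z)"
  "tens3 s x y (z + z') = tens3 s x y z + tens3 s x y z'" "tens3 s x y (base_scale s c z) = fun_scale c (tens3 s x y z)"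
  by (auto simp: fun_scale_def fun_eq_iff tens3_def trilinear_form_iff)

lemma twist12_values:
  assumes u: "u \<in> tensor_space3"
  shows "twist12 s u \<in> tensor_space3" "trilinear_form s \<gamma> \<Longrightarrow> twist12 s u \<gamma> = u (\<lambda>x y z. \<gamma> y x z)"
proof -
  obtain ps where ps: "u = (\<Sum>(x, y, z)\<leftarrow>ps. tens3 s x y z)" using u by (auto simp: tensor_space3_def)
  have tw: "twist12 s u = (\<Sum>(x, y, z)\<leftarrow>ps. tens3 s y x z)"
    unfolding ps twist12_def
    by (rule tensor_lift3_sum_list[where k = fun_scale])
      (simp_all add: Vector_Spaces.linear_iff vector_space_base vector_space_fun tens3_multilinear)
  have "(\<Sum>(x, y, z)\<leftarrow>qs. tens3 s y x z) \<in> tensor_space3" for qs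
    by (induction qs) (auto simp: tensor3_0 tensor3_add tens3_in simp del: plus_fun_apply zero_fun_apply)
  then show "twist12 s u \<in> tensor_space3" by (simp add: tw)
  assume \<gamma>: "trilinear_form s \<gamma>"
  then have \<gamma>': "trilinear_form s (\<lambda>x y z. \<gamma> y x z)" by (simp add: trilinear_form_iff)
  show "twist12 s u \<gamma> = u (\<lambda>x y z. \<gamma> y x z)"
    unfolding tw unfolding ps tens3_list_eval[OF \<gamma>']
    using \<gamma> by (simp add: sum_list_fun_apply tens3_def case_prod_beta')
qed

lemma insertion_values:
  assumes t: "t \<in> T"
  shows "tensor_lift s (\<lambda>y z. tens3 s x y z) t \<in> tensor_space3" (is ?A)
    "tensor_lift s (\<lambda>y z. tens3 s x y z) t \<gamma> = (if trilinear_form s \<gamma> then t (\<gamma> x) else 0)" (is ?B)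
    "tensor_lift s (\<lambda>y z. tens3 s y z x) t \<in> tensor_space3" (is ?C)
    "tensor_lift s (\<lambda>y z. tens3 s y z x) t \<gamma> = (if trilinear_form s \<gamma> then t (\<lambda>y z. \<gamma> y z x) else 0)" (is ?D)
proof -
  have B: "bilinear_map fun_scale (\<lambda>y z. tens3 s x y z)" "bilinear_map fun_scale (\<lambda>y z. tens3 s y z x)"
    by (rule bilinear_mapI[OF vector_space_fun]; rule tens3_multilinear)+
  show ?A
    by (rule lift_in[OF B(1) t tensor3_0 tensor3_add tens3_in])
  show ?C
    by (rule lift_in[OF B(2) t tensor3_0 tensor3_add tens3_in])
  show ?B
    ?D
    using lift_eval[OF B(1) linear_eval t, of \<gamma>] lift_eval[OF B(2) linear_eval t, of \<gamma>] tensor_zero_form[OF t]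
    by (simp_all add: tens3_def)
qed

lemma trilinear_slices:
  assumes "trilinear_form s \<gamma>"
  shows "bilinear_form s (\<gamma> x)" "bilinear_form s (\<lambda>y z. \<gamma> y z x)"
  using assms by (simp_all add: trilinear_form_iff bilinear_form_iff)

lemma coaction_values:
  assumes \<Delta>: "\<And>x. \<Delta> x \<in> T" "\<And>x y. \<Delta> (x + y) = \<Delta> x + \<Delta> y"
      "\<And>c x. \<Delta> (base_scale s c x) = fun_scale c (\<Delta> x)"
    and t: "t \<in> T"
  shows "coR s \<Delta> t \<in> tensor_space3" "trilinear_form s \<gamma> \<Longrightarrow> coR s \<Delta> t \<gamma> = t (\<lambda>x y. \<Delta> y (\<gamma> x))" (is "PROP ?A")
    "coL s \<Delta> t \<in> tensor_space3" "trilinear_form s \<gamma> \<Longrightarrow> coL s \<Delta> t \<gamma> = t (\<lambda>x y. \<Delta> x (\<lambda>x1 x2. \<gamma> x1 x2 y))" (is "PROP ?B")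
proof -
  have sl: "\<gamma> (x + x') = (\<lambda>y z. \<gamma> x y z + \<gamma> x' y z)" "\<gamma> (base_scale s c x) = (\<lambda>y z. c * \<gamma> x y z)"
    "(\<lambda>y z. \<gamma> y z (x + x')) = (\<lambda>y z. \<gamma> y z x + \<gamma> y z x')" "(\<lambda>y z. \<gamma> y z (base_scale s c x)) = (\<lambda>y z. c * \<gamma> y z x)"
    if "trilinear_form s \<gamma>" for \<gamma> x x' c
    using that by (simp_all add: trilinear_form_iff fun_eq_iff)
  have R: "\<Delta> z (\<gamma> (x + x')) = \<Delta> z (\<gamma> x) + \<Delta> z (\<gamma> x')" "\<Delta> z (\<gamma> (base_scale s c x)) = c * \<Delta> z (\<gamma> x)"
    "\<Delta> z (\<lambda>u v. \<gamma> u v (x + x')) = \<Delta> z (\<lambda>u v. \<gamma> u v x) + \<Delta> z (\<lambda>u v. \<gamma> u v x')"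
    "\<Delta> z (\<lambda>u v. \<gamma> u v (base_scale s c x)) = c * \<Delta> z (\<lambda>u v. \<gamma> u v x)"
    if "trilinear_form s \<gamma>" for \<gamma> x x' c z
    unfolding sl[OF that]
    by (rule tensor_form_linear[OF \<Delta>(1)]; rule trilinear_slices[OF that])+
  have B: "bilinear_map fun_scale (\<lambda>x y. tensor_lift s (\<lambda>y1 y2. tens3 s x y1 y2) (\<Delta> y))"
    "bilinear_map fun_scale (\<lambda>x y. tensor_lift s (\<lambda>x1 x2. tens3 s x1 x2 y) (\<Delta> x))"
    by (rule bilinear_mapI[OF vector_space_fun];
      simp add: fun_eq_iff fun_scale_def insertion_values \<Delta>(1); simp add: R \<Delta>(2,3) fun_scale_def)+
  show "coR s \<Delta> t \<in> tensor_space3"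
    unfolding coR_def by (rule lift_in[OF B(1) t tensor3_0 tensor3_add insertion_values(1)[OF \<Delta>(1)]])
  show "coL s \<Delta> t \<in> tensor_space3"
    unfolding coL_def by (rule lift_in[OF B(2) t tensor3_0 tensor3_add insertion_values(3)[OF \<Delta>(1)]])
  show "PROP ?A"
    "PROP ?B"
    unfolding coR_def coL_def
    using lift_eval[OF B(1) linear_eval t, of \<gamma>] lift_eval[OF B(2) linear_eval t, of \<gamma>]
    by (simp_all add: insertion_values \<Delta>)
qed

text \<open>The argument for two factors, with coordinates in the first two of three.\<close>

lemma tensor3_eqI:
  assumes F: "separating F" and uv: "u \<in> tensor_space3" "v \<in> tensor_space3"
    and eq: "\<And>\<phi> \<psi> \<chi>. \<phi> \<in> F \<Longrightarrow> \<psi> \<in> F \<Longrightarrow> \<chi> \<in> F \<Longrightarrow>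
      u (\<lambda>x y z. \<phi> x * \<psi> y * \<chi> z) = v (\<lambda>x y z. \<phi> x * \<psi> y * \<chi> z)"
  shows "u = v"
proof
  fix \<gamma>
  obtain us vs where us: "u = (\<Sum>(x, y, z)\<leftarrow>us. tens3 s x y z)" and vs: "v = (\<Sum>(x, y, z)\<leftarrow>vs. tens3 s x y z)"
    using uv by (auto simp: tensor_space3_def)
  \<comment> \<open>The difference of the two tensors, as one list of signed triples.\<close>
  define ps where "ps = map (Pair (1 :: 'k)) us @ map (Pair (- 1)) vs"
  have val: "u \<gamma> - v \<gamma> = (\<Sum>p\<leftarrow>ps. fst p * \<gamma> (fst (snd p)) (fst (snd (snd p))) (snd (snd (snd p))))"
    if "trilinear_form s \<gamma>" for \<gamma>
  proof -
    have "(\<Sum>p\<leftarrow>vs. - G p) = - (\<Sum>p\<leftarrow>vs. G p)" for G :: "_ \<Rightarrow> 'k" by (induction vs) simp_all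
    then show ?thesis
      unfolding us vs tens3_list_eval[OF that] by (simp add: ps_def case_prod_beta' o_def)
  qed
  let ?x = "\<lambda>p. fst (snd p)" and ?y = "\<lambda>p. fst (snd (snd p))" and ?z = "\<lambda>p. snd (snd (snd p))"
  have lin: "klinear \<phi>" if "\<phi> \<in> F" for \<phi> using F that by (simp add: separating_def)
  have 0: "(\<Sum>p\<leftarrow>ps. fst p * (\<phi> (?x p) * \<psi> (?y p) * \<chi> (?z p))) = 0" if "\<phi> \<in> F" "\<psi> \<in> F" "\<chi> \<in> F" for \<phi> \<psi> \<chi>
  proof -
    have "trilinear_form s (\<lambda>x y z. \<phi> x * \<psi> y * \<chi> z)"
      using lin[OF that(1)] lin[OF that(2)] lin[OF that(3)]
      by (simp add: trilinear_form_iff klinear_iff algebra_simps)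
    from val[OF this] eq[OF that] show ?thesis by simp
  qed
  have 1: "(\<Sum>p\<leftarrow>ps. fst p * \<psi> (?y p) * \<chi> (?z p) * h (?x p)) = 0" if "klinear h" "\<psi> \<in> F" "\<chi> \<in> F" for h \<psi> \<chi>
    by (rule separating_list[OF F that(1)]) (use 0[OF _ that(2,3)] in \<open>simp add: mult_ac\<close>)
  have 2: "(\<Sum>p\<leftarrow>ps. fst p * h (?x p) * \<chi> (?z p) * h' (?y p)) = 0" if "klinear h" "klinear h'" "\<chi> \<in> F" for h h' \<chi>
    by (rule separating_list[OF F that(2)]) (use 1[OF that(1) _ that(3)] in \<open>simp add: mult_ac\<close>)
  have 3: "(\<Sum>p\<leftarrow>ps. fst p * h (?x p) * h' (?y p) * h'' (?z p)) = 0" if "klinear h" "klinear h'" "klinear h''" for h h' h''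
    by (rule separating_list[OF F that(3)]) (use 2[OF that(1,2)] in \<open>simp add: mult_ac\<close>)
  show "u \<gamma> = v \<gamma>"
  proof (cases "trilinear_form s \<gamma>")
    case True
    obtain \<rho> where \<rho>: "\<And>b. klinear (\<lambda>x. \<rho> x b)" "\<And>x. finite {b. \<rho> x b \<noteq> 0}"
      "\<And>C h x. finite C \<Longrightarrow> {b. \<rho> x b \<noteq> 0} \<subseteq> C \<Longrightarrow> klinear h \<Longrightarrow> h x = (\<Sum>b\<in>C. \<rho> x b * h b)"
      by (rule klinear_coordinates) (rule that; assumption)
    define C where "C = (\<Union>p\<in>set ps. {b. \<rho> (?x p) b \<noteq> 0} \<union> {b. \<rho> (?y p) b \<noteq> 0})"
    have C: "finite C" using \<rho>(2) by (simp add: C_def)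
    have kl: "klinear (\<lambda>x. \<gamma> x y z)" "klinear (\<lambda>y. \<gamma> x y z)" "klinear (\<gamma> x y)" for x y z
      using True by (simp_all add: trilinear_form_def)
    have "u \<gamma> - v \<gamma> = (\<Sum>p\<leftarrow>ps. fst p * \<gamma> (?x p) (?y p) (?z p))" by (rule val[OF True])
    also have "\<dots> = (\<Sum>p\<leftarrow>ps. \<Sum>b\<in>C. \<Sum>c\<in>C. fst p * \<rho> (?x p) b * \<rho> (?y p) c * \<gamma> b c (?z p))"
    proof (rule arg_cong[of _ _ sum_list], rule map_cong[OF refl])
      fix p assume p: "p \<in> set ps"
      have "\<gamma> (?x p) (?y p) (?z p) = (\<Sum>b\<in>C. \<rho> (?x p) b * \<gamma> b (?y p) (?z p))"
        by (rule \<rho>(3)[OF C _ kl(1)]) (use p in \<open>auto simp: C_def\<close>)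
      also have "\<dots> = (\<Sum>b\<in>C. \<rho> (?x p) b * (\<Sum>c\<in>C. \<rho> (?y p) c * \<gamma> b c (?z p)))"
        by (rule sum.cong[OF refl], subst \<rho>(3)[OF C _ kl(2)]) (use p in \<open>auto simp: C_def\<close>)
      finally show "fst p * \<gamma> (?x p) (?y p) (?z p) = (\<Sum>b\<in>C. \<Sum>c\<in>C. fst p * \<rho> (?x p) b * \<rho> (?y p) c * \<gamma> b c (?z p))"
        by (simp add: sum_distrib_left mult.assoc)
    qed
    also have "\<dots> = (\<Sum>b\<in>C. \<Sum>c\<in>C. \<Sum>p\<leftarrow>ps. fst p * \<rho> (?x p) b * \<rho> (?y p) c * \<gamma> b c (?z p))"
      by (simp add: sum_list_swap)
    also have "\<dots> = 0"
      by (intro sum.neutral ballI 3 \<rho>(1) kl(3))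
    finally show ?thesis by simp
  next
    case False
    then show ?thesis by (simp add: us vs sum_list_fun_apply tens3_def case_prod_beta')
  qed
qed

end

section \<open>The cobracket in terms of the dual bracket\<close>

lemma sum3_zero: "0 = A + B + C \<Longrightarrow> A = - B - C" for A :: "'g::ab_group_add"
  by (simp add: eq_diff_eq eq_neg_iff_add_eq_0 add.commute add.left_commute)

context dual_leibniz
begin

abbreviation LS where "LS l a f \<equiv> peval dual_scale (Lstar s br a f) [:l:]"
abbreviation RS where "RS l a f \<equiv> peval dual_scale (Rstar s br a f) [:l:]"

lemma LS_in: "f \<in> D \<Longrightarrow> LS l a f \<in> D" and RS_in: "f \<in> D \<Longrightarrow> RS l a f \<in> D"
  by (intro D.peval_in[OF D.subV] Lstar_over Rstar_over; assumption)+

lemma L_adjoint: "f \<in> D \<Longrightarrow> poly (f (peval s (Lop br a u) [:l:])) p = - poly (LS l a f u) (p + l)"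
  using PD.star_property(2)[OF clL, of f u a l "p + l"] by (simp add: Lstar_def pair_dual_def)

lemma R_adjoint: "f \<in> D \<Longrightarrow> poly (f (peval s (Rop s br a u) [:l:])) p = - poly (RS l a f u) (p + l)"
  using PD.star_property(2)[OF clR, of f u a l "p + l"] by (simp add: Rstar_def pair_dual_def)

lemma r_over: "f \<in> D \<Longrightarrow> (- Lstar s br - Rstar s br) b f \<in> poly_over D"
  using MA.act_over(2)[of b f] by simp

lemma fibre_bD:
  assumes "g \<in> D"
  shows "fibre dual_scale D (- p) (\<lambda>h. poly (bD p h g a) t)"
    and "fibre dual_scale D (p - t) (\<lambda>h. poly (bD p g h a) t)"
  using assms
  by (simp_all add: fibre_def D.bval_addL D.bval_addR D.bval_scaleL D.bval_scaleR poly_dual_scale poly_pcompose)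

lemma momentum_last: "l + m + n + k = 0 \<Longrightarrow> k = - l - m - n" for l :: 'k
  unfolding add_eq_0_iff[of "l + m + n" k] by (simp add: algebra_simps)

lemma bD_neg_diff:
  assumes "f \<in> D" "h \<in> D" "g \<in> D"
  shows "bD p (- f - h) g = - bD p f g - bD p h g" "bD p g (- f - h) = - bD p g f - bD p g h"
proof -
  have "- f - h \<in> D" using assms by (simp only: D.subspace_diff[OF D.subV] D.subspace_neg[OF D.subV])
  then have "bD p (- f - h + f + h) g = bD p (- f - h) g + bD p f g + bD p h g"
    "bD p g (- f - h + f + h) = bD p g (- f - h) + bD p g f + bD p g h"
    using assms by (simp_all only: D.bval_addL D.bval_addR D.subspace_add[OF D.subV])
  moreover have "- f - h + f + h = 0" by (rule ext) simp
  ultimately show "bD p (- f - h) g = - bD p f g - bD p h g" "bD p g (- f - h) = - bD p g f - bD p g h"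
    using D.bval_0L[OF assms(3), of p] D.bval_0R[OF assms(3), of p]
    by (auto intro!: sum3_zero simp del: plus_fun_apply zero_fun_apply minus_apply uminus_apply)
qed

text \<open>
  In the bracket of \<open>Q\<^sup>*\<^sup>c\<close>, evaluated at scalars, an argument is seen through a fibre
  functional; this makes the operator \<open>\<partial>\<close> in \<open>r(b)\<^sub>-\<^sub>\<mu>\<^sub>-\<^sub>\<partial> f\<close> a scalar.
\<close>

lemma bD_rv:
  assumes "f \<in> D" "g \<in> D"
  shows "poly (bD p (MA.rv m b f) g a) t = - poly (bD p (LS (p - m) b f) g a) t - poly (bD p (RS (p - m) b f) g a) t" (is ?A)
    and "poly (bD p g (MA.rv m b f) a) t = - poly (bD p g (LS (t - p - m) b f) a) t - poly (bD p g (RS (t - p - m) b f) a) t" (is ?B)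
proof -
  have 1: "poly (bD p (MA.rv m b f) g a) t = poly (bD p (- LS (p - m) b f - RS (p - m) b f) g a) t"
    using fibre_peval[OF spD D.subV fibre_bD(1)[where p = p and a = a and t = t, OF assms(2)]
        r_over[where b = b, OF assms(1)], where q = "[:- m, - 1:]"]
    by simp
  have 2: "poly (bD p g (MA.rv m b f) a) t = poly (bD p g (- LS (t - p - m) b f - RS (t - p - m) b f) a) t"
    using fibre_peval[OF spD D.subV fibre_bD(2)[where p = p and a = a and t = t, OF assms(2)]
        r_over[where b = b, OF assms(1)], where q = "[:- m, - 1:]"]
    by simp
  show ?A
    unfolding 1 bD_neg_diff(1)[OF LS_in[OF assms(1)] RS_in[OF assms(1)] assms(2)] by simp
  show ?B
    unfolding 2 bD_neg_diff(2)[OF LS_in[OF assms(1)] RS_in[OF assms(1)] assms(2)] by simp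
qed

text \<open>
  The value of \<open>\<Delta>(a)\<close> at the product of the fibre functionals \<open>f\<^sub>p\<close> and \<open>g\<^sub>q\<close>, written with the bracket of
  \<open>Q\<^sup>*\<^sup>c\<close> alone.
\<close>

definition cob where "cob p f q g a = poly (bD p f g a) (p + q)"

lemma g_bQ_right:
  "g \<in> D \<Longrightarrow> l + m + n + k = 0 \<Longrightarrow> poly (g (bQ (l + m) y b)) n = - poly (RS k b g y) (n + k)"
  using Rstar_val[of g b k y "n + k"] neg_momentum[of n k l m] by (simp add: algebra_simps)

lemma form_bE_left:
  assumes "g \<in> D" "v \<in> E"
  shows "form n (0, g) (bE t v (b, 0)) = poly (g (bQ t (fst v) b)) n - poly (bD t (snd v) g b) (t + n)"
proof -
  obtain y h where v: "v = (y, h)" "h \<in> D" using assms(2) by auto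
  show ?thesis
    unfolding triple_bE[OF in_E(2)[OF assms(1)] assms(2) in_E(1)]
    using assms(1) v(2) MA.zero_in
    by (simp add: triple_def Let_def v(1) MA.bval_zeros D.bval_0L D.bval_0R D_0)
qed

lemma form_bE_right:
  assumes "g \<in> D" "v \<in> E"
  shows "form n (0, g) (bE l (a, 0) v) =
    poly (g (bQ l a (fst v))) n + poly (bD (- l - n) (snd v) g a) (- l) + poly (bD n g (snd v) a) (- l)"
proof -
  obtain y h where v: "v = (y, h)" "h \<in> D" using assms(2) by auto
  show ?thesis
    unfolding triple_bE[OF in_E(2)[OF assms(1)] in_E(1) assms(2)]
    using assms(1) v(2) MA.zero_in
    by (simp add: triple_def Let_def v(1) MA.bval_zeros D.bval_0L D.bval_0R D_0)
qed

text \<open>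
  By invariance the form is \<open>- B(g, [a \<circ> f, b])\<close>. Of \<open>a \<circ> f\<close> only the adjoint of \<open>R(a)\<close>
  survives in \<open>Q\<^sup>*\<^sup>c\<close>, and likewise in \<open>Q\<close>: the contributions of left multiplication cancel.
\<close>

lemma sym_form_cob:
  assumes D: "f \<in> D" "g \<in> D" and k: "l + m + n + k = 0"
  shows "sym_form (a, 0) l (0, f) m (0, g) n (b, 0) k =
    cob (n + k) (RS k b g) m f a - cob (l + m) (RS l a f) n g b"
proof -
  let ?u = "bE l (a, 0) (0, f) + bE m (0, f) (a, 0)"
  have u: "?u = (MA.gv l f a + MA.fv m f a, LS l a f + MA.rv m a f)"
    using MA.bvalE_pure2(2)[of a 0 a f l] MA.bvalE_pure2(3)[of a 0 a f m] D MA.zero_in by simp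
  have uE: "?u \<in> E" by (intro MA.E.subspace_add[OF MA.subE] bE_in in_E(1) in_E(2) D)
  have g2: "RS k b g \<in> D" by (rule RS_in[OF D(2)])
  have rvD: "MA.rv m a f \<in> D" using D MA.act_in(2)[of a f] by simp
  have m': "- l - (n + k) = m" "m + (n + k) = - l" "n + k + m = - l" "l + m - m = l"
    unfolding momentum_last[OF k] by simp_all
  have "sym_form (a, 0) l (0, f) m (0, g) n (b, 0) k = - form n (0, g) (bE (l + m) ?u (b, 0))"
  proof -
    have "form n (0, g) (bE (l + m) ?u (b, 0)) =
        - form (l + m) ?u (bE n (0, g) (b, 0)) - form (l + m) ?u (bE k (b, 0) (0, g))"
      by (rule form_bE_cyclic[OF in_E(2)[OF D(2)] uE in_E(1) k])
    then show ?thesis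
      unfolding sym_form_def form_add(2)[OF uE bE_in[OF in_E(2)[OF D(2)] in_E(1)] bE_in[OF in_E(1) in_E(2)[OF D(2)]]]
      by simp
  qed
  also have "form n (0, g) (bE (l + m) ?u (b, 0)) = poly (g (bQ (l + m) (fst ?u) b)) n - poly (bD (l + m) (snd ?u) g b) (l + m + n)"
    by (rule form_bE_left[OF D(2) uE])
  also have "poly (g (bQ (l + m) (fst ?u) b)) n = - poly (RS k b g (fst ?u)) (n + k)"
    by (rule g_bQ_right[OF D(2) k])
  also have "poly (RS k b g (fst ?u)) (n + k) = poly (bD (n + k) (RS k b g) f a) (- l)"
    unfolding u fst_conv D_add[OF g2] poly_add gv_val[OF D(1) g2] dual_Lstar_val[OF D(1) g2] m' by simp
  also have "poly (bD (l + m) (snd ?u) g b) (l + m + n) = - poly (bD (l + m) (RS l a f) g b) (l + m + n)"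
    unfolding u snd_conv D.bval_addL[OF LS_in[OF D(1)] rvD D(2)]
    using bD_rv(1)[OF D, where p = "l + m" and m = m and b = a and a = b and t = "l + m + n"] by (simp add: m')
  finally show ?thesis by (simp add: cob_def m' del: zero_fun_apply)
qed

text \<open>
  The nine terms arise from \<open>[a, [f, b]]\<close>, \<open>[[a, f], b]\<close> and \<open>[f, [a, b]]\<close>, in which \<open>[a, f]\<close>
  and \<open>[f, b]\<close> have components in both summands.
\<close>

lemma jac_form_cob:
  assumes D: "f \<in> D" "g \<in> D" and k: "l + m + n + k = 0"
  shows "jac_form (a, 0) l (0, f) m (0, g) n (b, 0) =
    cob m f n g (bQ l a b)
    + (cob m f (n + k) (RS k b g) a + cob (n + k) (RS k b g) m f a)
    - (cob (m + k) (LS k b f) n g a + cob n g (m + k) (LS k b f) a)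
    - (cob (m + k) (RS k b f) n g a + cob n g (m + k) (RS k b f) a)
    + cob m f (n + l) (LS l a g) b + cob (m + l) (LS l a f) n g b"
proof -
  have E: "(a, 0) \<in> E" "(0, f) \<in> E" "(0, g) \<in> E" "(b, 0) \<in> E" by (intro in_E(1) in_E(2) D)+
  let ?u = "bE m (0, f) (b, 0)" and ?v = "bE l (a, 0) (0, f)"
  have u: "?u = (MA.fv m f b, MA.rv m b f)" and v: "?v = (MA.gv l f a, LS l a f)"
    using MA.bvalE_pure2(3)[of b 0 b f m] MA.bvalE_pure2(2)[of a 0 a f l] D MA.zero_in by simp_all
  have uE: "?u \<in> E" and vE: "?v \<in> E" by (intro bE_in E)+
  have rvD: "MA.rv m b f \<in> D" using D MA.act_in(2)[of b f] by simp
  have g1: "LS l a g \<in> D" and g2: "RS k b g \<in> D" using LS_in RS_in D by blast+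
  have mom: "- l - n = m + k" "m + k + n = - l" "m + k - m = k" "- l - n - m = k"
      "m + (n + k) = - l" "n + k + m = - l" "- l - (n + k) = m"
    unfolding momentum_last[OF k] by simp_all
  have 1: "form n (0, g) (bE l (a, 0) ?u) =
      poly (g (bQ l a (MA.fv m f b))) n + poly (bD (m + k) (MA.rv m b f) g a) (- l) + poly (bD n g (MA.rv m b f) a) (- l)"
    by (subst form_bE_right[OF D(2) uE]) (simp only: u fst_conv snd_conv mom)
  have 11: "poly (g (bQ l a y)) n = - poly (LS l a g y) (n + l)" for y
    using Lstar_val[OF D(2), of a l y "n + l"] by simp
  have 12: "poly (bD (m + k) (MA.rv m b f) g a) (- l) = - cob (m + k) (LS k b f) n g a - cob (m + k) (RS k b f) n g a"
    unfolding bD_rv(1)[OF D] cob_def mom by simp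
  have 13: "poly (bD n g (MA.rv m b f) a) (- l) = - cob n g (m + k) (LS k b f) a - cob n g (m + k) (RS k b f) a"
    unfolding bD_rv(2)[OF D] cob_def mom add.commute[of n "m + k"] by simp
  have 14: "poly (LS l a g (MA.fv m f b)) (n + l) = - cob m f (n + l) (LS l a g) b"
    unfolding dual_Lstar_val[OF D(1) g1] cob_def ..
  have 2: "form n (0, g) (bE (l + m) ?v (b, 0)) =
      poly (g (bQ (l + m) (MA.gv l f a) b)) n - poly (bD (l + m) (LS l a f) g b) (l + m + n)"
    by (subst form_bE_left[OF D(2) vE]) (simp only: v fst_conv snd_conv)
  have 21: "poly (RS k b g (MA.gv l f a)) (n + k) = cob m f (n + k) (RS k b g) a + cob (n + k) (RS k b g) m f a"
    unfolding gv_val[OF D(1) g2] cob_def mom by simp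
  have 3: "form n (0, g) (bE m (0, f) (bE l (a, 0) (b, 0))) = - cob m f n g (bQ l a b)"
  proof -
    have "bE l (a, 0) (b, 0) = (bQ l a b, 0)" using MA.bvalE_pure2(1)[of a 0 b 0 l] MA.zero_in by simp
    then show ?thesis
      using triple_bE[OF E(3,2) in_E(1)[of "bQ l a b"], where n = n and l = m] D
      by (simp add: triple_def Let_def cob_def MA.bval_zeros D.bval_0L D.bval_0R D_0)
  qed
  have "jac_form (a, 0) l (0, f) m (0, g) n (b, 0) = form n (0, g) (bE l (a, 0) ?u) - form n (0, g) (bE (l + m) ?v (b, 0))
      - form n (0, g) (bE m (0, f) (bE l (a, 0) (b, 0)))"
    using E by (simp add: jac_form_def MA.CE.jac_def form_diff bE_in MA.E.subspace_diff[OF MA.subE] del: mem_Sigma_iff)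
  then show ?thesis
    unfolding 1 2 3 11 12 13 14 g_bQ_right[OF D(2) k] 21
    by (simp add: cob_def add.commute[of m l] algebra_simps)
qed

abbreviation pform where "pform p f q g \<equiv> Q.prod_form (\<lambda>x. poly (f x) p) (\<lambda>x. poly (g x) q)"

lemma klinear_ev: "f \<in> D \<Longrightarrow> Q.klinear (\<lambda>x. poly (f x) p)"
  by (simp add: Q.klinear_iff D_add D_scale)

lemma pform_bilinear: "f \<in> D \<Longrightarrow> g \<in> D \<Longrightarrow> bilinear_form s (pform p f q g)"
  by (intro Q.prod_form_bilinear klinear_ev)

definition evals where "evals = {\<phi>. \<exists>f\<in>D. \<exists>p. \<phi> = (\<lambda>x. poly (f x) p)}"

lemma separating_evals: "Q.separating evals"
  unfolding Q.separating_def evals_def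
  by (auto simp: klinear_ev intro!: Q_sep poly_ext) (metis poly_0)

lemma act_values:
  assumes t: "t \<in> tensor_space s" and D: "f \<in> D" "g \<in> D"
  shows "form_value (actL s (Lop br a) t) l (pform p f q g) = - t (pform (p + l) (LS l a f) q g)" (is ?A)
    "form_value (actL s (Rop s br a) t) l (pform p f q g) = - t (pform (p + l) (RS l a f) q g)" (is ?B)
    "form_value (actR s (Lop br a) t) l (pform p f q g) = - t (pform p f (q + l) (LS l a g))" (is ?C)
    "form_value (actR s (Rop s br a) t) l (pform p f q g) = - t (pform p f (q + l) (RS l a g))" (is ?D)
proof -
  have lin: "linear_on s UNIV s (Lop br a)" "linear_on s UNIV s (Rop s br a)"
    using clL[of a] clR[of a] by (simp_all add: linear_on_def conformal_linear_def)
  have neg: "t (\<lambda>u v. - \<beta> u v) = - t \<beta>" if "bilinear_form s \<beta>" for \<beta>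
    using Q.tensor_form_linear(2)[OF t that, of "- 1"] by simp
  note vals = Q.act_form_values(3,4)[OF _ t pform_bilinear[OF D]]
  have e: "(\<lambda>u v. pform p f q g (peval s (Lop br a u) [:l:]) v) = (\<lambda>u v. - pform (p + l) (LS l a f) q g u v)"
    "(\<lambda>u v. pform p f q g (peval s (Rop s br a u) [:l:]) v) = (\<lambda>u v. - pform (p + l) (RS l a f) q g u v)"
    "(\<lambda>u v. pform p f q g u (peval s (Lop br a v) [:l:])) = (\<lambda>u v. - pform p f (q + l) (LS l a g) u v)"
    "(\<lambda>u v. pform p f q g u (peval s (Rop s br a v) [:l:])) = (\<lambda>u v. - pform p f (q + l) (RS l a g) u v)"
    by (simp_all add: Q.prod_form_def L_adjoint R_adjoint D)
  show ?A
    ?B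
    ?C
    ?D
    unfolding vals(1)[OF lin(1)] vals(1)[OF lin(2)] vals(2)[OF lin(1)] vals(2)[OF lin(2)] e
    by (intro neg pform_bilinear D LS_in RS_in)+
qed

lemma pd_values:
  assumes t: "t \<in> tensor_space s" and D: "f \<in> D" "g \<in> D"
  shows "pdL s t (pform p f q g) = p * t (pform p f q g)" (is ?A) "pdR s t (pform p f q g) = q * t (pform p f q g)" (is ?B)
    "twist s t (pform p f q g) = t (pform q g p f)" (is ?C)
proof -
  note b = pform_bilinear[OF D, of p q]
  have e: "(\<lambda>x y. pform p f q g (pd s x) y) = (\<lambda>x y. p * pform p f q g x y)"
    "(\<lambda>x y. pform p f q g x (pd s y)) = (\<lambda>x y. q * pform p f q g x y)"
    "(\<lambda>x y. pform p f q g y x) = pform q g p f"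
    by (simp_all add: Q.prod_form_def D_scale D fun_eq_iff mult_ac)
  show ?A ?B
    ?C
    unfolding Q.tensor_operator_values(2)[OF t b] Q.tensor_operator_values(4)[OF t b] Q.tensor_operator_values(6)[OF t b] e
    by (simp_all only: Q.tensor_form_linear(2)[OF t b])
qed

lemma pd_zero: "pdL s 0 = 0" "pdR s 0 = 0" "twist s 0 = 0"
  by (rule Q.tensor_eq_0I[OF separating_evals];
      auto simp: Q.tensor_operator_values Q.tensor_0 evals_def pd_values simp del: zero_fun_apply; simp)+

end

locale dual_cobracket = dual_leibniz s br brd
  for s :: "'k::field_char_0 poly \<Rightarrow> 'q::ab_group_add \<Rightarrow> 'q" and br and brd +
  fixes \<Delta> :: "'q \<Rightarrow> ('k, 'q) tensor2"
  assumes cob_hom: "kd_hom s UNIV (tensor_scale s) (tensor_space s) \<Delta>"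
    and cob_dual: "\<And>f g a. f \<in> D \<Longrightarrow> g \<in> D \<Longrightarrow>
      app (\<lambda>h. pair_dual h a) mu (subst lam (brd f g)) = tensor_pairing s f g lam (mu - lam) (\<Delta> a)"
begin

lemma cob_in: "\<Delta> a \<in> tensor_space s" and cob_add: "\<Delta> (a + b) = \<Delta> a + \<Delta> b"
  and cob_scale: "\<Delta> (base_scale s c a) = fun_scale c (\<Delta> a)"
  using cob_hom by (simp_all add: kd_hom_def tensor_scale_def kd_action_def fun_scale_def)

lemma cob_0: "\<Delta> 0 = 0"
  using cob_add[of 0 0] by (simp only: add_0 add_cancel_right_right)

text \<open>The hypothesis that the two structures correspond, at \<open>\<lambda> = p\<close> and \<open>\<mu> = p + q\<close>.\<close>

lemma cob_value:
  assumes D: "f \<in> D" "g \<in> D"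
  shows "\<Delta> a (pform p f q g) = cob p f q g a"
proof -
  have lin: "linear_on dual_scale D triv_scale (\<lambda>h. pair_dual h a)"
    by (auto simp: linear_on_def pair_dual_def dual_scale_eq pcompose_const)
  have "peval2 triv_scale (app (\<lambda>h. pair_dual h a) mu (subst lam (brd f g))) p (p + q) = cob p f q g a"
    unfolding peval2_app[OF spD kd_space_triv D.subV lin D.subst_overs(1)[OF D.subV D.br_over[OF D]] K.acts_mu]
    by (simp add: D.peval2_substs cob_def bval_def pair_dual_def)
  moreover have "peval2 triv_scale (tensor_pairing s f g lam (mu - lam) (\<Delta> a)) p (p + q) = \<Delta> a (pform p f q g)"
  proof -
    let ?k = "\<lambda>c :: 'k. smult [:c:] :: 'k poly poly \<Rightarrow> _"
    have vs: "vector_space ?k"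
      by unfold_locales (simp_all add: smult_add_right smult_add_left[symmetric] mult.commute flip: one_pCons)
    have eqI: "X = Y" if "\<And>l m. peval2 triv_scale X l m = peval2 triv_scale Y l m" for X Y :: "'k poly poly"
      by (rule K.poly_poly_eqI) (rule that)
    have mult: "peval2 triv_scale (X * Y) l m = peval2 triv_scale X l m * peval2 triv_scale Y l m"
      "peval2 triv_scale (smult [:c:] X) l m = c * peval2 triv_scale X l m" for X Y :: "'k poly poly" and c l m
      by (simp_all add: peval2_triv)
    have B: "Q.bilinear_map ?k (\<lambda>x y. subst lam (pair_dual f x) * subst (mu - lam) (pair_dual g y))"
      by (rule Q.bilinear_mapI[OF vs]; rule eqI;
        simp add: mult K.peval2_substs pair_dual_def D_add D_scale D algebra_simps)
    have \<Theta>: "Vector_Spaces.linear ?k (*) (\<lambda>X. peval2 triv_scale X p (p + q))"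
      by (simp add: Vector_Spaces.linear_iff vs vector_space_field mult)
    show ?thesis
      unfolding tensor_pairing_def Q.lift_eval[OF B \<Theta> cob_in]
      by (simp add: mult K.peval2_substs pair_dual_def Q.prod_form_def)
  qed
  ultimately show ?thesis using cob_dual[OF D] by simp
qed

text \<open>
  On products of three fibre functionals the coalgebra identity is the Jacobi identity of
  \<open>Q\<^sup>*\<^sup>c\<close>.
\<close>

lemma coalgebra: "leibniz_conformal_coalgebra s \<Delta>"
  unfolding leibniz_conformal_coalgebra_def
proof (intro conjI allI cob_hom)
  show "kd_module s UNIV" using spQ by (simp add: kd_module_iff)
  fix a
  note co = Q.coaction_values[of \<Delta>, OF cob_in cob_add cob_scale cob_in[of a]]
  show "coR s \<Delta> (\<Delta> a) = coL s \<Delta> (\<Delta> a) + twist12 s (coR s \<Delta> (\<Delta> a))"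
  proof (rule Q.tensor3_eqI[OF separating_evals])
    show "coR s \<Delta> (\<Delta> a) \<in> Q.tensor_space3" by (rule co)
    show "coL s \<Delta> (\<Delta> a) + twist12 s (coR s \<Delta> (\<Delta> a)) \<in> Q.tensor_space3"
      by (intro Q.tensor3_add Q.twist12_values co)
    fix \<phi> \<psi> \<chi> assume "\<phi> \<in> evals" "\<psi> \<in> evals" "\<chi> \<in> evals"
    then obtain f p g q h r where D: "f \<in> D" "g \<in> D" "h \<in> D"
      and \<phi>: "\<phi> = (\<lambda>x. poly (f x) p)" and \<psi>: "\<psi> = (\<lambda>x. poly (g x) q)" and \<chi>: "\<chi> = (\<lambda>x. poly (h x) r)"
      by (auto simp: evals_def)
    have tri: "trilinear_form s (\<lambda>x y z. poly (f x) p * poly (g y) q * poly (h z) r)"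
      if "f \<in> D" "g \<in> D" "h \<in> D" for f g h p q r
      using that by (simp add: Q.trilinear_form_iff D_add D_scale algebra_simps)
    have R: "coR s \<Delta> (\<Delta> a) (\<lambda>x y z. poly (f x) p * poly (g y) q * poly (h z) r) = poly (bD p f (bD q g h) a) (p + q + r)"
      if D: "f \<in> D" "g \<in> D" "h \<in> D" for f g h p q r
    proof -
      have "\<Delta> y (\<lambda>u v. poly (f x) p * poly (g u) q * poly (h v) r) = poly (f x) p * poly (bD q g h y) (q + r)" for x y
        using Q.tensor_form_linear(2)[OF cob_in pform_bilinear[OF D(2,3)], of y "poly (f x) p" q r]
          cob_value[OF D(2,3)] by (simp add: Q.prod_form_def cob_def mult.assoc)
      then have "coR s \<Delta> (\<Delta> a) (\<lambda>x y z. poly (f x) p * poly (g y) q * poly (h z) r) = \<Delta> a (pform p f (q + r) (bD q g h))"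
        unfolding co(2)[OF tri[OF D]] by (simp add: Q.prod_form_def)
      then show ?thesis
        using cob_value[OF D(1) D.bval_in[OF D(2,3)]] by (simp add: cob_def add.assoc)
    qed
    have L: "coL s \<Delta> (\<Delta> a) (\<lambda>x y z. poly (f x) p * poly (g y) q * poly (h z) r) = poly (bD (p + q) (bD p f g) h a) (p + q + r)"
    proof -
      have "\<Delta> x (\<lambda>u v. poly (f u) p * poly (g v) q * poly (h y) r) = poly (bD p f g x) (p + q) * poly (h y) r" for x y
        using Q.tensor_form_linear(2)[OF cob_in pform_bilinear[OF D(1,2)], of x "poly (h y) r" p q]
          cob_value[OF D(1,2)] by (simp add: Q.prod_form_def cob_def mult_ac)
      then have "coL s \<Delta> (\<Delta> a) (\<lambda>x y z. poly (f x) p * poly (g y) q * poly (h z) r) = \<Delta> a (pform (p + q) (bD p f g) r h)"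
        unfolding co(4)[OF tri[OF D]] by (simp add: Q.prod_form_def)
      then show ?thesis
        using cob_value[OF D.bval_in[OF D(1,2)] D(3)] by (simp add: cob_def)
    qed
    have T: "twist12 s (coR s \<Delta> (\<Delta> a)) (\<lambda>x y z. poly (f x) p * poly (g y) q * poly (h z) r) = poly (bD q g (bD p f h) a) (p + q + r)"
    proof -
      have e: "(\<lambda>x y z. poly (f y) p * poly (g x) q * poly (h z) r) = (\<lambda>x y z. poly (g x) q * poly (f y) p * poly (h z) r)"
        by (simp add: fun_eq_iff mult_ac)
      show ?thesis
        unfolding Q.twist12_values(2)[OF co(1) tri[OF D]] e R[OF D(2,1,3)] by (simp add: add.commute[of q p])
    qed
    have "D.jac p q f g h = 0" using leibD D by (simp add: leibniz_iff)
    then have "bD p f (bD q g h) = bD (p + q) (bD p f g) h + bD q g (bD p f h)"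
      unfolding D.jac_def diff_diff_eq by (rule iffD2[OF eq_iff_diff_eq_0])
    then have "poly (bD p f (bD q g h) a) (p + q + r) =
        poly (bD (p + q) (bD p f g) h a) (p + q + r) + poly (bD q g (bD p f h) a) (p + q + r)"
      by simp
    then show "coR s \<Delta> (\<Delta> a) (\<lambda>x y z. \<phi> x * \<psi> y * \<chi> z) =
        (coL s \<Delta> (\<Delta> a) + twist12 s (coR s \<Delta> (\<Delta> a))) (\<lambda>x y z. \<phi> x * \<psi> y * \<chi> z)"
      unfolding \<phi> \<psi> \<chi> plus_fun_apply R[OF D] L T .
  qed
qed

end

section \<open>The bialgebra conditions\<close>

context dual_cobracket
begin

abbreviation T where "T \<equiv> tensor_space s"

lemma over_closed:
  "P \<in> poly_over T \<Longrightarrow> P' \<in> poly_over T \<Longrightarrow> P + P' \<in> poly_over T" (is "PROP ?A")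
  "P \<in> poly_over T \<Longrightarrow> P' \<in> poly_over T \<Longrightarrow> P - P' \<in> poly_over T" (is "PROP ?B")
  "P \<in> poly_over T \<Longrightarrow> - P \<in> poly_over T" (is "PROP ?C")
  "P \<in> poly_over T \<Longrightarrow> lam1 P \<in> poly_over T" (is "PROP ?D")
  "P \<in> poly_over T \<Longrightarrow> map_poly (pdL s) P \<in> poly_over T" (is "PROP ?E")
  "P \<in> poly_over T \<Longrightarrow> map_poly (pdL s + pdR s) P \<in> poly_over T" (is "PROP ?F")
  "P \<in> poly_over T \<Longrightarrow> map_poly (twist s) P \<in> poly_over T" (is "PROP ?G")
proof -
  show "PROP ?F"
    by (rule poly_over_map) (auto simp: pd_zero Q.tensor_add Q.tensor_operator_values(1,3))
  show "PROP ?E" "PROP ?G"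
    by (rule poly_over_map; simp add: pd_zero Q.tensor_operator_values(1,5) del: zero_fun_apply)+
  show "PROP ?D"
    unfolding lam1_def poly_over_pCons by (rule conjI[OF Q.tensor_0])
  show "PROP ?A"
    "PROP ?B" "PROP ?C"
    unfolding poly_over_def coeff_add coeff_diff coeff_minus mem_Collect_eq
    by (blast intro: Q.tensor_add Q.tensor_diff Q.tensor_uminus)+
qed

lemma tensor_poly_eq_iff:
  assumes "P \<in> poly_over T" "P' \<in> poly_over T"
  shows "P = P' \<longleftrightarrow> (\<forall>f\<in>D. \<forall>g\<in>D. \<forall>p q x. form_value P x (pform p f q g) = form_value P' x (pform p f q g))"
proof
  assume R: "\<forall>f\<in>D. \<forall>g\<in>D. \<forall>p q x. form_value P x (pform p f q g) = form_value P' x (pform p f q g)"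
  show "P = P'"
    by (rule Q.tensor_poly_eqI[OF separating_evals assms]) (use R in \<open>auto simp: evals_def\<close>)
qed simp

lemma pd_poly_values:
  assumes "P \<in> poly_over T" "f \<in> D" "g \<in> D"
  shows "form_value (map_poly (pdL s) P) x (pform p f q g) = p * form_value P x (pform p f q g)" (is ?A)
    "form_value (map_poly (pdL s + pdR s) P) x (pform p f q g) = (p + q) * form_value P x (pform p f q g)" (is ?B)
    "form_value (map_poly (twist s) P) x (pform p f q g) = form_value P x (pform q g p f)" (is ?C)
proof -
  show ?A
    by (rule Q.form_value_map[OF assms(1)]) (simp_all add: pd_zero pd_values assms)
  show ?B
    by (rule Q.form_value_map[OF assms(1)]) (simp_all add: pd_zero pd_values assms algebra_simps)
  have "form_value (map_poly (twist s) P) x (pform p f q g) = 1 * form_value P x (pform q g p f)"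
    by (rule Q.form_value_map[OF assms(1)]) (simp_all add: pd_zero pd_values assms)
  then show ?C by simp
qed

lemma subst_values:
  assumes P: "P \<in> poly_over T" and D: "f \<in> D" "g \<in> D"
  shows "form_value (subst1 (lam1 - map_poly (pdL s)) P) x (pform p f q g) = form_value P (x - p) (pform p f q g)"
    "form_value (subst1 (- lam1 - map_poly (pdL s)) P) x (pform p f q g) = form_value P (- x - p) (pform p f q g)"
    "form_value (subst1 (- lam1 - map_poly (pdL s + pdR s)) P) x (pform p f q g) = form_value P (- x - p - q) (pform p f q g)"
    "form_value (subst1 lam1 P) x (pform p f q g) = form_value P x (pform p f q g)"
  by (rule Q.form_value_subst1[OF P];
    simp add: over_closed pd_poly_values D algebra_simps del: plus_fun_apply)+

lemma subst_over_T:
  assumes P: "P \<in> poly_over T"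
  shows "subst1 (lam1 - map_poly (pdL s)) P \<in> poly_over T" "subst1 (- lam1 - map_poly (pdL s)) P \<in> poly_over T"
    "subst1 (- lam1 - map_poly (pdL s + pdR s)) P \<in> poly_over T" "subst1 lam1 P \<in> poly_over T"
  by (rule Q.subst1_over[OF P]; simp add: over_closed del: plus_fun_apply)+

lemma linear_on_ops: "linear_on s UNIV s (Lop br a)" "linear_on s UNIV s (Rop s br a)"
  using clL[of a] clR[of a] by (simp_all add: linear_on_def conformal_linear_def)

lemma act_over_T:
  "t \<in> T \<Longrightarrow> actL s (Lop br a) t \<in> poly_over T" "t \<in> T \<Longrightarrow> actL s (Rop s br a) t \<in> poly_over T"
  "t \<in> T \<Longrightarrow> actR s (Lop br a) t \<in> poly_over T" "t \<in> T \<Longrightarrow> actR s (Rop s br a) t \<in> poly_over T"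
  by (intro Q.act_form_values linear_on_ops; assumption)+

lemma map_cob:
  "map_poly \<Delta> p \<in> poly_over T" "form_value (map_poly \<Delta> p) x \<beta> = \<Delta> (peval s p [:x:]) \<beta>" (is ?A)
proof -
  show "map_poly \<Delta> p \<in> poly_over T" by (rule poly_over_map[of _ UNIV]) (simp_all add: cob_0 cob_in)
  show ?A
    by (induction p) (simp_all add: cob_0 map_poly_pCons cob_add cob_scale, simp add: fun_scale_def)
qed

text \<open>
  Both sides are evaluated at products of fibre functionals, where \<open>\<partial> \<otimes> id\<close> is a scalar and
  \<open>R(a)\<close> turns into its adjoint.
\<close>

lemma first_condition_iff:
  "subst1 (lam1 - map_poly (pdL s)) (actL s (Rop s br a) (\<Delta> b)) =
     map_poly (twist s) (subst1 (- lam1 - map_poly (pdL s)) (actL s (Rop s br b) (\<Delta> a))) \<longleftrightarrow>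
   (\<forall>f\<in>D. \<forall>g\<in>D. \<forall>p q x. cob x (RS (x - p) a f) q g b = cob (- x) (RS (- x - q) b g) p f a)"
  by (subst tensor_poly_eq_iff)
    (simp_all add: over_closed subst_over_T act_over_T cob_in pd_poly_values subst_values act_values cob_value RS_in)

text \<open>
  The value of the right-hand side at \<open>f\<^sub>m \<otimes> g\<^sub>n\<close> has the terms of \<open>jac_form_cob\<close>, with \<open>k =
  - l - m - n\<close> as the value of \<open>- \<lambda> - \<partial>\<^sup>\<otimes>\<^sup>2\<close>.
\<close>

lemma second_condition_iff:
  "map_poly \<Delta> (br a b) =
     subst1 (- lam1 - map_poly (pdL s + pdR s)) (actR s (Rop s br b) (twist s (\<Delta> a) + \<Delta> a)) -
     subst1 (- lam1 - map_poly (pdL s + pdR s)) (actL s (Lop br b) (twist s (\<Delta> a) + \<Delta> a)) -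
     subst1 (- lam1 - map_poly (pdL s + pdR s)) (actL s (Rop s br b) (twist s (\<Delta> a) + \<Delta> a)) +
     (subst1 lam1 (actR s (Lop br a) (\<Delta> b)) + subst1 lam1 (actL s (Lop br a) (\<Delta> b))) \<longleftrightarrow>
   (\<forall>f\<in>D. \<forall>g\<in>D. \<forall>m n l. jac_form (a, 0) l (0, f) m (0, g) n (b, 0) = 0)"
proof -
  define t where "t = twist s (\<Delta> a) + \<Delta> a"
  have t: "t \<in> T" unfolding t_def by (intro Q.tensor_add Q.tensor_operator_values cob_in)
  have tv: "t (pform p f q g) = cob q g p f a + cob p f q g a" if "f \<in> D" "g \<in> D" for p f q g
    using that by (simp add: t_def pd_values cob_in cob_value)
  have "(map_poly \<Delta> (br a b) =
     subst1 (- lam1 - map_poly (pdL s + pdR s)) (actR s (Rop s br b) t) -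
     subst1 (- lam1 - map_poly (pdL s + pdR s)) (actL s (Lop br b) t) -
     subst1 (- lam1 - map_poly (pdL s + pdR s)) (actL s (Rop s br b) t) +
     (subst1 lam1 (actR s (Lop br a) (\<Delta> b)) + subst1 lam1 (actL s (Lop br a) (\<Delta> b)))) \<longleftrightarrow>
   (\<forall>f\<in>D. \<forall>g\<in>D. \<forall>m n l. cob m f n g (bQ l a b) =
      - t (pform m f (n + (- l - m - n)) (RS (- l - m - n) b g))
      + t (pform (m + (- l - m - n)) (LS (- l - m - n) b f) n g)
      + t (pform (m + (- l - m - n)) (RS (- l - m - n) b f) n g)
      + (- cob m f (n + l) (LS l a g) b - cob (m + l) (LS l a f) n g b))"
    by (subst tensor_poly_eq_iff)
      (simp_all add: map_cob over_closed subst_over_T act_over_T t cob_in subst_values act_values cob_value LS_in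
        flip: bval_def del: plus_fun_apply)
  also have "\<dots> \<longleftrightarrow> (\<forall>f\<in>D. \<forall>g\<in>D. \<forall>m n l. jac_form (a, 0) l (0, f) m (0, g) n (b, 0) = 0)"
  proof (intro ball_cong all_cong1 refl)
    fix f g and m n l :: 'k assume D: "f \<in> D" "g \<in> D"
    let ?k = "- l - m - n"
    have k: "l + m + n + ?k = 0" by simp
    have "jac_form (a, 0) l (0, f) m (0, g) n (b, 0) = cob m f n g (bQ l a b) -
      (- t (pform m f (n + ?k) (RS ?k b g)) + t (pform (m + ?k) (LS ?k b f) n g)
      + t (pform (m + ?k) (RS ?k b f) n g)
      + (- cob m f (n + l) (LS l a g) b - cob (m + l) (LS l a f) n g b))"
      unfolding jac_form_cob[OF D k] tv[OF D(1) RS_in[OF D(2)]] tv[OF LS_in[OF D(1)] D(2)] tv[OF RS_in[OF D(1)] D(2)]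
      by (simp add: algebra_simps)
    then show "(cob m f n g (bQ l a b) =
      - t (pform m f (n + ?k) (RS ?k b g)) + t (pform (m + ?k) (LS ?k b f) n g)
      + t (pform (m + ?k) (RS ?k b f) n g)
      + (- cob m f (n + l) (LS l a g) b - cob (m + l) (LS l a f) n g b)) \<longleftrightarrow>
      jac_form (a, 0) l (0, f) m (0, g) n (b, 0) = 0" by (simp only: right_minus_eq)
  qed
  finally show ?thesis unfolding t_def .
qed

text \<open>
  The two conditions correspond to the two kinds of four-point functions that decide whether
  the sum is a Leibniz algebra; the variable of the first condition is \<open>\<lambda> = l + m\<close>.
\<close>

theorem bialgebra_iff_leibniz:
  "leibniz_conformal_bialgebra s br \<Delta> \<longleftrightarrow> leibniz_conformal_algebra MA.sE E MA.brE"
proof -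
  have sym_form: "(\<forall>p q x. cob x (RS (x - p) a f) q g b = cob (- x) (RS (- x - q) b g) p f a) \<longleftrightarrow>
      (\<forall>l m n. sym_form (a, 0) l (0, f) m (0, g) n (b, 0) (- l - m - n) = 0)" if D: "f \<in> D" "g \<in> D" for a b f g
  proof -
    have *: "sym_form (a, 0) l (0, f) m (0, g) n (b, 0) (- l - m - n) =
        cob (- (l + m)) (RS (- (l + m) - n) b g) m f a - cob (l + m) (RS (l + m - m) a f) n g b" for l m n
    proof -
      have e: "n + (- l - m - n) = - (l + m)" "- l - m - n = - (l + m) - n" "l + m - m = l" by simp_all
      show ?thesis using sym_form_cob[OF D, of l m n "- l - m - n" a b] unfolding e by simp
    qed
    show ?thesis
    proof
      assume "\<forall>p q x. cob x (RS (x - p) a f) q g b = cob (- x) (RS (- x - q) b g) p f a"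
      then show "\<forall>l m n. sym_form (a, 0) l (0, f) m (0, g) n (b, 0) (- l - m - n) = 0"
        unfolding * by (simp only: diff_self simp_thms)
    next
      assume R: "\<forall>l m n. sym_form (a, 0) l (0, f) m (0, g) n (b, 0) (- l - m - n) = 0"
      show "\<forall>p q x. cob x (RS (x - p) a f) q g b = cob (- x) (RS (- x - q) b g) p f a"
      proof (intro allI)
        fix p q x
        show "cob x (RS (x - p) a f) q g b = cob (- x) (RS (- x - q) b g) p f a"
          using R[unfolded *, rule_format, of "x - p" p q] by simp
      qed
    qed
  qed
  show ?thesis
    unfolding leibniz_conformal_bialgebra_def Let_def first_condition_iff second_condition_iff
      leibniz_iff_four_point
    using leibQ coalgebra sym_form by auto
qed

end

theorem corollary3p7:
  fixes s :: "'k::field_char_0 poly \<Rightarrow> 'q::ab_group_add \<Rightarrow> 'q"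
    and br :: "'q \<Rightarrow> 'q \<Rightarrow> 'q poly"
    and \<Delta> :: "'q \<Rightarrow> ('k, 'q) tensor2"
    and brd :: "('q \<Rightarrow> 'k poly) \<Rightarrow> ('q \<Rightarrow> 'k poly) \<Rightarrow> ('q \<Rightarrow> 'k poly) poly"
  assumes "finite_leibniz_conformal_algebra s UNIV br"
    and "free_module s UNIV"
    and "kd_hom s UNIV (tensor_scale s) (tensor_space s) \<Delta>"
    and "leibniz_conformal_algebra dual_scale (conformal_dual s UNIV) brd"
    and "\<And>f g a. f \<in> conformal_dual s UNIV \<Longrightarrow> g \<in> conformal_dual s UNIV \<Longrightarrow>
           app (\<lambda>h. pair_dual h a) mu (subst lam (brd f g)) =
           tensor_pairing s f g lam (mu - lam) (\<Delta> a)"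
  shows "(matched_pair s UNIV br dual_scale (conformal_dual s UNIV) brd
            (Lstar s br) (- Lstar s br - Rstar s br)
            (dual_Lstar s brd) (- dual_Lstar s brd - dual_Rstar s brd)
          \<longleftrightarrow>
          (\<exists>brE. conformal_manin_triple (prod_scale s dual_scale) (UNIV \<times> conformal_dual s UNIV) brE
                    (UNIV \<times> {0}) ({0} \<times> conformal_dual s UNIV) standard_form \<and>
                 (\<forall>a b. brE (a, 0) (b, 0) = map_poly (\<lambda>x. (x, 0)) (br a b)) \<and>
                 (\<forall>f\<in>conformal_dual s UNIV. \<forall>g\<in>conformal_dual s UNIV.
                    brE (0, f) (0, g) = map_poly (\<lambda>h. (0, h)) (brd f g))))
         \<and>
         (matched_pair s UNIV br dual_scale (conformal_dual s UNIV) brd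
            (Lstar s br) (- Lstar s br - Rstar s br)
            (dual_Lstar s brd) (- dual_Lstar s brd - dual_Rstar s brd)
          \<longleftrightarrow>
          leibniz_conformal_bialgebra s br \<Delta>)"
proof -
  interpret dual_leibniz s br brd
    by unfold_locales (fact assms)+
  interpret dual_cobracket s br brd \<Delta>
    by unfold_locales (fact assms)+
  show ?thesis
    unfolding MA.matched_pair_iff_leibniz[OF leibQ leibD] manin_triple_iff_leibniz bialgebra_iff_leibniz
    by simp
qed

end
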